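(* Let $G$ be a connected simple bridgeless cubic $(n,m)$-graph that has only real flow roots. Denote the flow polynomial of $G$ by $F(G,t)=\sum_{i=0}^{m-n+1}c_i t^i$. Then for all $0\leqslant i\leqslant m-n+1$, $b_i\leqslant |c_i|$, where $b_i$ is the coefficient of $t^i$ in the expansion $$\sum_{i=0}^{m-n+1}b_i t^i=(t+1)(t+2)^{n/2-2}(t+3)^2,$$ with the equality holding if and only if $G\cong G^*$, where $G^*$ is the graph described in the context.
   Context: An $(n,m)$-graph is a finite graph with $n$ vertices and $m$ edges; a cubic graph is one in which every vertex has degree 3 (so $n$ is even); a simple graph has no loops and no multiple edges; a bridge is an edge whose removal increases the number of components, and a graph is bridgeless if it has no bridge. The flow polynomial of an $(n,m)$-graph $G$ is $$F(G,t)=\sum_{Z\subseteq E(G)}(-1)^{m-|Z|}\,t^{|Z|+c(Z)-n},$$ where $c(Z)$ is the number of connected components of the spanning subgraph of $G$ with vertex set $V(G)$ and edge set $Z$. A flow root of $G$ is a zero of $F(G,t)$. The graph $G^*$ on $n$ vertices ($n$ even, $n\geqslant 8$) is the following: put $r=(n-8)/2$. The vertices of $G^*$ are $p,q,p',q'$ and $a_0,\dots,a_{r+1},b_0,\dots,b_{r+1}$. Its edges are $pq$, $a_0p$, $a_0q$, $b_0p$, $b_0q$; $p'q'$, $a_{r+1}p'$, $a_{r+1}q'$, $b_{r+1}p'$, $b_{r+1}q'$; the edges $a_ia_{i+1}$ and $b_ib_{i+1}$ for $0\leqslant i\leqslant r$; and the edges $a_ib_i$ for $1\leqslant i\leqslant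 r$. (That is, a ladder closed off at each end by a copy of $K_4$ minus an edge.)
   Formalization: Assumes n ≥ 6, since for K_4 (n = 4) b_0 = 9 > 6 = |c_0|; the equality characterization (equality for all i at once iff G ≅ G* ) is stated only for n ≥ 8, where G* is defined, since for n = 6 the prism attains equality. *)

theory Defs
  imports Complex_Main "HOL-Computational_Algebra.Polynomial"
begin

text \<open>Finite undirected graphs, loops and parallel edges allowed: each edge carries its set of
  end vertices, which is a singleton precisely for a loop.\<close>

record ('v, 'e) mgraph =
  verts :: "'v set"
  edges :: "'e set"
  ends  :: "'e \<Rightarrow> 'v set"

definition fin_mgraph :: "('v, 'e) mgraph \<Rightarrow> bool" where
  "fin_mgraph G \<longleftrightarrow> finite (verts G) \<and> finite (edges G) \<and>
     (\<forall>e\<in>edges G. ends G e \<subseteq> verts G \<and> card (ends G e) \<in> {1, 2})"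

definition simple_mgraph :: "('v, 'e) mgraph \<Rightarrow> bool" where
  "simple_mgraph G \<longleftrightarrow> fin_mgraph G \<and> (\<forall>e\<in>edges G. card (ends G e) \<noteq> 1) \<and>
     inj_on (ends G) (edges G)"

text \<open>The second summand makes a loop contribute 2 to the degree of its end.\<close>

definition degr :: "('v, 'e) mgraph \<Rightarrow> 'v \<Rightarrow> nat" where
  "degr G v = card {e \<in> edges G. v \<in> ends G e} + card {e \<in> edges G. ends G e = {v}}"

definition cubic_mgraph :: "('v, 'e) mgraph \<Rightarrow> bool" where
  "cubic_mgraph G \<longleftrightarrow> (\<forall>v\<in>verts G. degr G v = 3)"

text \<open>Connectivity in the spanning subgraph with edge set \<open>Z\<close>, as an equivalence relation on
  the vertices; its classes are the connected components.\<close>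

definition conn_rel :: "('v, 'e) mgraph \<Rightarrow> 'e set \<Rightarrow> ('v \<times> 'v) set" where
  "conn_rel G Z = {(u, v). \<exists>e\<in>Z. ends G e = {u, v}}\<^sup>* \<inter> verts G \<times> verts G"

definition num_comps :: "('v, 'e) mgraph \<Rightarrow> 'e set \<Rightarrow> nat" where
  "num_comps G Z = card (verts G // conn_rel G Z)"

definition connected_mgraph :: "('v, 'e) mgraph \<Rightarrow> bool" where
  "connected_mgraph G \<longleftrightarrow> num_comps G (edges G) = 1"

definition bridge :: "('v, 'e) mgraph \<Rightarrow> 'e \<Rightarrow> bool" where
  "bridge G e \<longleftrightarrow> e \<in> edges G \<and> num_comps G (edges G - {e}) > num_comps G (edges G)"

definition bridgeless :: "('v, 'e) mgraph \<Rightarrow> bool" where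
  "bridgeless G \<longleftrightarrow> \<not> (\<exists>e. bridge G e)"

text \<open>The natural-number subtractions do not truncate for a finite graph, since
  \<open>card (verts G) \<le> card Z + num_comps G Z\<close>.\<close>

definition flow_poly :: "('v, 'e) mgraph \<Rightarrow> int poly" where
  "flow_poly G = (\<Sum>Z\<in>Pow (edges G).
     monom ((- 1) ^ (card (edges G) - card Z)) (card Z + num_comps G Z - card (verts G)))"

definition flow_roots :: "('v, 'e) mgraph \<Rightarrow> complex set" where
  "flow_roots G = {z. poly (map_poly of_int (flow_poly G)) z = 0}"

definition mgraph_iso :: "('v, 'e) mgraph \<Rightarrow> ('w, 'f) mgraph \<Rightarrow> bool" where
  "mgraph_iso G H \<longleftrightarrow> (\<exists>f g. bij_betw f (verts G) (verts H) \<and> bij_betw g (edges G) (edges H) \<and>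
     (\<forall>e\<in>edges G. ends H (g e) = f ` ends G e))"

datatype gstar_vertex = Vp | Vq | Vp' | Vq' | Va nat | Vb nat

text \<open>Only meaningful for even \<open>n \<ge> 8\<close>.  Edges are their own two-element sets of ends.\<close>

definition gstar :: "nat \<Rightarrow> (gstar_vertex, gstar_vertex set) mgraph" where
  "gstar n = (let r = (n - 8) div 2 in
     \<lparr> verts = {Vp, Vq, Vp', Vq'} \<union> Va ` {0..r + 1} \<union> Vb ` {0..r + 1},
       edges =
         {{Vp, Vq}, {Va 0, Vp}, {Va 0, Vq}, {Vb 0, Vp}, {Vb 0, Vq}} \<union>
         {{Vp', Vq'}, {Va (r + 1), Vp'}, {Va (r + 1), Vq'}, {Vb (r + 1), Vp'}, {Vb (r + 1), Vq'}} \<union>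
         (\<lambda>i. {Va i, Va (i + 1)}) ` {0..r} \<union> (\<lambda>i. {Vb i, Vb (i + 1)}) ` {0..r} \<union>
         (\<lambda>i. {Va i, Vb i}) ` {1..r},
       ends = (\<lambda>e. e) \<rparr>)"

end

theory Submission
  imports Defs "HOL-Computational_Algebra.Fundamental_Theorem_Algebra"
begin

text \<open>Let \<open>G\<close> have \<open>n = 2k\<close> vertices, so that its flow polynomial is monic of degree \<open>k + 1\<close>, and let
\<open>p\<^sub>1\<close> and \<open>p\<^sub>2\<close> be the sum of the roots and the sum of their squares.  The proof shows that a
real-rooted flow polynomial is forced to be
\<open>(t - 1) (t - 2)\<^sup>j (t - 3)\<^sup>k\<^sup>-\<^sup>j\<close> with \<open>p\<^sub>1 = 3k + 1 - j\<close>, and then that \<open>j \<le> k - 2\<close>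
with equality exactly for the ladder of the statement.  Replacing a factor \<open>t + 2\<close> by \<open>t + 3\<close>
increases all coefficients, and the comparison with \<open>j = k - 2\<close> is the theorem.

For the shape of the polynomial there are two ingredients.  The first is combinatorial and holds
for every bridgeless cubic graph: \<open>p\<^sub>2 \<le> 5 p\<^sub>1 - 6k - 4\<close> (\<open>psum_bound\<close>).  At a two-edge
cut the flow polynomial factorizes (\<open>flow_poly_two_edge_cut\<close>), both sides of the inequality
are additive, and only three-edge-connected graphs remain.  For these \<open>p\<^sub>1 = 3k\<close> and
\<open>p\<^sub>2 = 3k + 2T\<close>, where \<open>T\<close> counts the three-edge cuts; by parity such cuts do not cross, they form
a laminar family of odd vertex sets, and there are at most \<open>3k - 2\<close> of them.
The second is arithmetic (\<open>real_rooted_roots_2_3\<close>).  Remove the root 1 and write the other roots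
as \<open>3 - \<mu>\<close>.  The inequality becomes \<open>\<Sum>\<mu>\<^sup>2 \<le> \<Sum>\<mu>\<close>.  The product of the nonzero \<open>\<mu>\<close>
is a nonzero integer up to sign, being a coefficient of a shifted integer polynomial, hence by the
inequality of the means \<open>\<Sum>\<mu>\<^sup>2\<close> is at least the number of nonzero \<open>\<mu>\<close>.  Together these give
\<open>\<Sum>(\<mu> - 1)\<^sup>2 \<le> 0\<close> over the nonzero \<open>\<mu>\<close>, so every \<open>\<mu>\<close> is 0 or 1.

The bound \<open>j \<le> k - 2\<close> says \<open>p\<^sub>1 \<ge> n + 3\<close>.  Splitting at two-edge cuts creates graphs with one
marked edge that may be parallel to another edge, while all else is simple.  Such a graph has
\<open>p\<^sub>1 \<ge> n + 2\<close>, with equality only for a ladder that is closed at one end and carries the mark at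
the other (\<open>marked_extremal_if_simple_off_mark\<close>).  Since \<open>p\<^sub>1 + 1\<close> of a graph is the sum of the
\<open>p\<^sub>1\<close> of its two sides, a simple graph has \<open>p\<^sub>1 \<ge> n + 3\<close>, and equality makes both sides such half
ladders, which glue to the extremal graph.\<close>

section \<open>Components and edge cuts\<close>

definition closed_under :: "('v, 'e) mgraph \<Rightarrow> 'e set \<Rightarrow> 'v set \<Rightarrow> bool" where
  "closed_under G Z S \<longleftrightarrow> (\<forall>e\<in>Z. ends G e \<inter> S = {} \<or> ends G e \<subseteq> S)"

definition edge_cut :: "('v, 'e) mgraph \<Rightarrow> 'v set \<Rightarrow> 'e set" where
  "edge_cut G S = {e \<in> edges G. ends G e \<inter> S \<noteq> {} \<and> \<not> ends G e \<subseteq> S}"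

lemma closed_under_conn_rel:
  assumes "(u, v) \<in> conn_rel G Z" "closed_under G Z S" "u \<in> S"
  shows "v \<in> S"
proof -
  have "(u, v) \<in> {(u, v). \<exists>e\<in>Z. ends G e = {u, v}}\<^sup>*"
    using assms(1) by (simp add: conn_rel_def)
  then show ?thesis
    by (induction rule: rtrancl_induct) (use assms(2,3) in \<open>auto simp: closed_under_def\<close>)
qed

lemma equiv_conn_rel: "equiv (verts G) (conn_rel G Z)"
proof -
  have "sym ({(u, v). \<exists>e\<in>Z. ends G e = {u, v}}\<^sup>*)"
    by (intro sym_rtrancl) (auto simp: sym_def insert_commute)
  then show ?thesis
    unfolding conn_rel_def
    by (intro equivI) (auto simp: refl_on_def sym_def trans_def)
qed

lemma conn_rel_refl: "u \<in> verts G \<Longrightarrow> (u, u) \<in> conn_rel G Z"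
  by (simp add: conn_rel_def)

lemma conn_rel_sym: "(u, v) \<in> conn_rel G Z \<Longrightarrow> (v, u) \<in> conn_rel G Z"
  using equiv_conn_rel[of G Z] by (meson equiv_def symE)

lemma conn_rel_trans:
  "(u, v) \<in> conn_rel G Z \<Longrightarrow> (v, w) \<in> conn_rel G Z \<Longrightarrow> (u, w) \<in> conn_rel G Z"
  using equiv_conn_rel[of G Z] by (meson equiv_def transE)

lemma conn_rel_verts: "(u, v) \<in> conn_rel G Z \<Longrightarrow> u \<in> verts G \<and> v \<in> verts G"
  by (simp add: conn_rel_def)

lemma conn_rel_mono: "Y \<subseteq> Z \<Longrightarrow> conn_rel G Y \<subseteq> conn_rel G Z"
  unfolding conn_rel_def by (intro Int_mono rtrancl_mono) auto

lemma conn_rel_edge: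
  assumes "e \<in> Z" "ends G e = {u, v}" "u \<in> verts G" "v \<in> verts G"
  shows "(u, v) \<in> conn_rel G Z"
  using assms unfolding conn_rel_def by auto

lemma ends_pair:
  assumes "fin_mgraph G" "e \<in> edges G"
  obtains u v where "ends G e = {u, v}" "u \<in> verts G" "v \<in> verts G"
proof -
  have c: "card (ends G e) = 1 \<or> card (ends G e) = 2" and sub: "ends G e \<subseteq> verts G"
    using assms by (auto simp: fin_mgraph_def)
  from c have "\<exists>u v. ends G e = {u, v}"
    by (auto simp: card_1_singleton_iff card_2_iff)
  then obtain u v where "ends G e = {u, v}" by blast
  with sub that show thesis by auto
qed

text \<open>Closed sets replace walks in all connectivity arguments below: a vertex is reachable exactly if
every closed set around the start contains it, and this lemma supplies the smallest such set.\<close>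
lemma closed_under_component:
  assumes "fin_mgraph G" "Z \<subseteq> edges G"
  shows "closed_under G Z (conn_rel G Z `` {x})"
  unfolding closed_under_def
proof (rule ballI)
  fix e assume e: "e \<in> Z"
  obtain u v where uv: "ends G e = {u, v}" "u \<in> verts G" "v \<in> verts G"
    using e assms(2) by (auto intro: ends_pair[OF assms(1)])
  have "(x, u) \<in> conn_rel G Z \<longleftrightarrow> (x, v) \<in> conn_rel G Z"
    using conn_rel_edge[OF e uv] conn_rel_sym conn_rel_trans by metis
  then show "ends G e \<inter> conn_rel G Z `` {x} = {} \<or> ends G e \<subseteq> conn_rel G Z `` {x}"
    using uv by auto
qed

text \<open>The rank recursion of the graphic matroid.  All component counts below are obtained from it by
adding or removing one edge at a time.\<close>
lemma num_comps_insert: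
  assumes G: "fin_mgraph G" "insert e Z \<subseteq> edges G" and uv: "ends G e = {u, v}"
  shows "num_comps G Z = num_comps G (insert e Z) + (if (u, v) \<in> conn_rel G Z then 0 else 1)"
proof -
  let ?R = "conn_rel G Z" and ?R' = "conn_rel G (insert e Z)" and ?V = "verts G"
  have eR: "equiv ?V ?R" and eR': "equiv ?V ?R'" by (rule equiv_conn_rel)+
  have V: "u \<in> ?V" "v \<in> ?V" "finite ?V" using G uv by (auto simp: fin_mgraph_def)
  have sub: "?R \<subseteq> ?R'" by (intro conn_rel_mono) auto
  have cl: "closed_under G Z (?R `` {x})" for x
    using G by (intro closed_under_component) auto
  have uv': "(u, v) \<in> ?R'" using conn_rel_edge[of e "insert e Z" G u v] uv V by auto
  show ?thesis
  proof (cases "(u, v) \<in> ?R")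
    case True
    have "?R' \<subseteq> ?R"
    proof (rule subrelI)
      fix x y assume xy: "(x, y) \<in> ?R'"
      then have "x \<in> ?V" by (auto simp: conn_rel_def)
      then have xx: "x \<in> ?R `` {x}" by (simp add: conn_rel_refl)
      have "closed_under G (insert e Z) (?R `` {x})"
        using cl[of x] uv conn_rel_trans[OF _ True] conn_rel_trans[OF _ conn_rel_sym[OF True]]
        by (auto simp: closed_under_def)
      from closed_under_conn_rel[OF xy this xx] show "(x, y) \<in> ?R" by simp
    qed
    with sub have "?R' = ?R" by blast
    then show ?thesis using True by (simp add: num_comps_def)
  next
    case False
    let ?U = "?R `` {u}" and ?W = "?R `` {v}"
    have "?U \<in> ?V // ?R" "?W \<in> ?V // ?R" using V by (auto intro: quotientI)
    have dis: "?U \<inter> ?W = {}" using False by (auto dest: conn_rel_trans[OF _ conn_rel_sym])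
    have ne: "?U \<noteq> ?W" using dis V conn_rel_refl[of u G Z] by blast
    have UW: "?R' `` {x} = ?U \<union> ?W" if "x \<in> ?U \<union> ?W" for x
    proof
      have "closed_under G (insert e Z) (?U \<union> ?W)"
        using cl[of u] cl[of v] uv V
        by (auto simp: closed_under_def conn_rel_refl)
      then show "?R' `` {x} \<subseteq> ?U \<union> ?W"
        using closed_under_conn_rel that by fastforce
      have "(u, x) \<in> ?R' \<or> (v, x) \<in> ?R'" using that sub by auto
      then have "(x, u) \<in> ?R'" "(x, v) \<in> ?R'"
        using uv' by (meson conn_rel_sym conn_rel_trans)+
      then show "?U \<union> ?W \<subseteq> ?R' `` {x}"
        using sub by (auto dest: conn_rel_trans)
    qed
    have other: "?R' `` {x} = ?R `` {x}" if "x \<in> ?V" "x \<notin> ?U \<union> ?W" for x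
    proof
      have "u \<notin> ?R `` {x}" "v \<notin> ?R `` {x}"
        using that by (auto intro: conn_rel_sym)
      then have "closed_under G (insert e Z) (?R `` {x})"
        using cl[of x] uv by (auto simp: closed_under_def)
      moreover have "x \<in> ?R `` {x}" using that by (simp add: conn_rel_refl)
      ultimately show "?R' `` {x} \<subseteq> ?R `` {x}" using closed_under_conn_rel by fastforce
    qed (use sub in auto)
    have inUW: "?R `` {x} \<in> {?U, ?W}" if "x \<in> ?U \<union> ?W" for x
      using that eR equiv_class_eq[OF eR, of u x] equiv_class_eq[OF eR, of v x] by auto
    have notUW: "?R `` {x} \<notin> {?U, ?W}" if "x \<in> ?V" "x \<notin> ?U \<union> ?W" for x
    proof -
      have "x \<in> ?R `` {x}" using that by (simp add: conn_rel_refl)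
      then show ?thesis using that by auto
    qed
    have q': "?V // ?R' = insert (?U \<union> ?W) (?V // ?R - {?U, ?W})"
    proof (intro equalityI subsetI)
      fix C assume "C \<in> ?V // ?R'"
      then obtain x where x: "x \<in> ?V" "C = ?R' `` {x}" by (auto simp: quotient_def)
      show "C \<in> insert (?U \<union> ?W) (?V // ?R - {?U, ?W})"
      proof (cases "x \<in> ?U \<union> ?W")
        case True then show ?thesis using UW x by auto
      next
        case False
        then show ?thesis using other[OF x(1)] notUW[OF x(1)] x quotientI[of x ?V ?R] by auto
      qed
    next
      fix C assume C: "C \<in> insert (?U \<union> ?W) (?V // ?R - {?U, ?W})"
      have "u \<in> ?U" using V conn_rel_refl by fast
      then have 1: "?U \<union> ?W \<in> ?V // ?R'" using UW[of u] V quotientI[of u ?V ?R'] by auto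
      show "C \<in> ?V // ?R'"
      proof (cases "C = ?U \<union> ?W")
        case True then show ?thesis using 1 by simp
      next
        case False
        then have "C \<in> ?V // ?R" "C \<notin> {?U, ?W}" using C by auto
        then obtain x where x: "x \<in> ?V" "C = ?R `` {x}" by (auto simp: quotient_def)
        with \<open>C \<notin> {?U, ?W}\<close> inUW have "x \<notin> ?U \<union> ?W" by blast
        then show ?thesis using other[OF x(1)] x quotientI[of x ?V ?R'] by auto
      qed
    qed
    have fin: "finite (?V // ?R)"
      using V(3) by (simp add: quotient_def)
    have new: "?U \<union> ?W \<notin> ?V // ?R"
    proof
      assume "?U \<union> ?W \<in> ?V // ?R"
      then obtain x where "?U \<union> ?W = ?R `` {x}" by (auto simp: quotient_def)
      moreover have "u \<in> ?U" "v \<in> ?W" using V by (simp_all add: conn_rel_refl)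
      ultimately have "(x, u) \<in> ?R" "(x, v) \<in> ?R" by auto
      then show False using False by (meson conn_rel_sym conn_rel_trans)
    qed
    have "card {?U, ?W} \<le> card (?V // ?R)"
      using fin \<open>?U \<in> _\<close> \<open>?W \<in> _\<close> by (intro card_mono) auto
    then have "2 \<le> card (?V // ?R)" using ne by simp
    moreover have "card (?V // ?R - {?U, ?W}) = card (?V // ?R) - 2"
      using \<open>?U \<in> _\<close> \<open>?W \<in> _\<close> ne by (subst card_Diff_subset) auto
    ultimately have "card (?V // ?R) = card (?V // ?R') + 1"
      unfolding q' using fin new by (subst card_insert_disjoint) auto
    then show ?thesis using False by (simp add: num_comps_def)
  qed
qed

lemma num_comps_empty: "num_comps G {} = card (verts G)"
proof -
  have "conn_rel G {} = Id_on (verts G)" by (auto simp: conn_rel_def)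
  then have "verts G // conn_rel G {} = (\<lambda>x. {x}) ` verts G"
    by (auto simp: quotient_def)
  then show ?thesis unfolding num_comps_def by (simp add: card_image)
qed

lemma num_comps_insert_le:
  assumes "fin_mgraph G" "insert e Z \<subseteq> edges G"
  shows "num_comps G (insert e Z) \<le> num_comps G Z" "num_comps G Z \<le> num_comps G (insert e Z) + 1"
proof -
  obtain u v where "ends G e = {u, v}"
    by (rule ends_pair[OF assms(1), of e]) (use assms(2) in auto)
  from num_comps_insert[OF assms this]
  show "num_comps G (insert e Z) \<le> num_comps G Z" "num_comps G Z \<le> num_comps G (insert e Z) + 1"
    by (auto split: if_splits)
qed

lemma card_verts_le_num_comps:
  assumes "fin_mgraph G" "Z \<subseteq> edges G"
  shows "card (verts G) \<le> card Z + num_comps G Z"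
proof -
  have "finite Z" using assms finite_subset by (auto simp: fin_mgraph_def)
  then show ?thesis using assms(2)
  proof (induction Z)
    case empty then show ?case by (simp add: num_comps_empty)
  next
    case (insert e Z)
    then show ?case using num_comps_insert_le[OF assms(1), of e Z] by simp
  qed
qed

lemma num_comps_ge_2_iff:
  assumes G: "fin_mgraph G" "Z \<subseteq> edges G"
  shows "2 \<le> num_comps G Z \<longleftrightarrow>
    (\<exists>S. S \<subseteq> verts G \<and> S \<noteq> {} \<and> S \<noteq> verts G \<and> edge_cut G S \<inter> Z = {})"
proof
  let ?R = "conn_rel G Z"
  have eR: "equiv (verts G) ?R" by (rule equiv_conn_rel)
  have fin: "finite (verts G // ?R)" using G by (auto simp: fin_mgraph_def quotient_def)
  {
    assume "2 \<le> num_comps G Z"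
    then obtain C where C: "C \<in> verts G // ?R" and "\<exists>D. D \<in> verts G // ?R \<and> D \<noteq> C"
      unfolding num_comps_def using card_le_Suc0_iff_eq[OF fin] by fastforce
    then obtain D where D: "D \<in> verts G // ?R" "D \<noteq> C" by blast
    have "C \<subseteq> verts G" "C \<noteq> {}" "D \<noteq> {}" "D \<subseteq> verts G" "C \<inter> D = {}"
      using C D eR quotient_disj[OF eR C D(1)] in_quotient_imp_non_empty[OF eR]
        in_quotient_imp_subset[OF eR] by auto
    moreover obtain x where "C = ?R `` {x}" using C by (auto simp: quotient_def)
    then have "edge_cut G C \<inter> Z = {}"
      using closed_under_component[OF G, of x] by (auto simp: edge_cut_def closed_under_def)
    ultimately show "\<exists>S. S \<subseteq> verts G \<and> S \<noteq> {} \<and> S \<noteq> verts G \<and> edge_cut G S \<inter> Z = {}"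
      by (intro exI[of _ C]) auto
  }
  {
    assume "\<exists>S. S \<subseteq> verts G \<and> S \<noteq> {} \<and> S \<noteq> verts G \<and> edge_cut G S \<inter> Z = {}"
    then obtain S u v where S: "S \<subseteq> verts G" "u \<in> S" "v \<in> verts G" "v \<notin> S"
      "edge_cut G S \<inter> Z = {}" by blast
    have "closed_under G Z S" using S(5) G(2) by (auto simp: closed_under_def edge_cut_def)
    then have "(u, v) \<notin> ?R" using closed_under_conn_rel S by metis
    then have "?R `` {u} \<noteq> ?R `` {v}" using eq_equiv_class_iff[OF eR] S by auto
    moreover have "{?R `` {u}, ?R `` {v}} \<subseteq> verts G // ?R" using S by (auto intro: quotientI)
    ultimately show "2 \<le> num_comps G Z"
      unfolding num_comps_def using card_mono[OF fin] by (metis card_2_iff)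
  }
qed

lemma num_comps_pos:
  assumes "fin_mgraph G" "verts G \<noteq> {}"
  shows "1 \<le> num_comps G Z"
proof -
  have "finite (verts G // conn_rel G Z)" "verts G // conn_rel G Z \<noteq> {}"
    using assms by (auto simp: quotient_def fin_mgraph_def)
  then show ?thesis unfolding num_comps_def by (simp add: Suc_le_eq card_gt_0_iff)
qed

section \<open>Bridgeless cubic graphs and the leading coefficients of the flow polynomial\<close>

lemma num_comps_le_union:
  assumes "fin_mgraph G" "Z \<union> W \<subseteq> edges G"
  shows "num_comps G Z \<le> num_comps G (Z \<union> W) + card W"
proof -
  have "finite W" using assms finite_subset by (auto simp: fin_mgraph_def)
  then show ?thesis using assms(2)
  proof (induction W)
    case empty then show ?case by simp
  next
    case (insert e W)
    then show ?case using num_comps_insert_le(2)[OF assms(1), of e "Z \<union> W"] by simp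
  qed
qed

text \<open>\<open>card X + 1 - num_comps G (edges G - X)\<close> is the rank of \<open>X\<close> in the cographic matroid; the
inequality is its monotonicity.  It allows every set with many edges to be handled through a subset of
fixed small size.\<close>
lemma num_comps_delete_mono:
  assumes "fin_mgraph G" "Y \<subseteq> X" "X \<subseteq> edges G"
  shows "num_comps G (edges G - X) + card Y \<le> num_comps G (edges G - Y) + card X"
proof -
  have "finite X" using assms finite_subset by (auto simp: fin_mgraph_def)
  have "(edges G - X) \<union> (X - Y) = edges G - Y" using assms by auto
  then have "num_comps G (edges G - X) \<le> num_comps G (edges G - Y) + card (X - Y)"
    using num_comps_le_union[OF assms(1), of "edges G - X" "X - Y"] assms(3) by auto
  moreover have "card (X - Y) + card Y = card X"
    using card_Diff_subset[of Y X] card_mono[OF \<open>finite X\<close> assms(2)]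
      finite_subset[OF assms(2) \<open>finite X\<close>] assms(2) by simp
  ultimately show ?thesis by simp
qed

definition edge_connected :: "nat \<Rightarrow> ('v, 'e) mgraph \<Rightarrow> bool" where
  "edge_connected l G \<longleftrightarrow> verts G \<noteq> {} \<and>
     (\<forall>S. S \<subseteq> verts G \<and> S \<noteq> {} \<and> S \<noteq> verts G \<longrightarrow> l \<le> card (edge_cut G S))"

text \<open>Loops are excluded, parallel edges are not: splitting a simple graph creates parallel edges.
Edge connectivity 2 expresses connected and bridgeless at once.\<close>
definition bridgeless_cubic :: "('v, 'e) mgraph \<Rightarrow> bool" where
  "bridgeless_cubic G \<longleftrightarrow> fin_mgraph G \<and> (\<forall>e\<in>edges G. card (ends G e) = 2) \<and>
     (\<forall>v\<in>verts G. card {e \<in> edges G. v \<in> ends G e} = 3) \<and> edge_connected 2 G"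

lemma edge_connectedD:
  "edge_connected l G \<Longrightarrow> S \<subseteq> verts G \<Longrightarrow> S \<noteq> {} \<Longrightarrow> S \<noteq> verts G \<Longrightarrow> l \<le> card (edge_cut G S)"
  by (simp add: edge_connected_def)

lemma bridgeless_cubicD:
  assumes "bridgeless_cubic G"
  shows "fin_mgraph G" "finite (verts G)" "finite (edges G)" "verts G \<noteq> {}"
    "e \<in> edges G \<Longrightarrow> ends G e \<subseteq> verts G" "e \<in> edges G \<Longrightarrow> card (ends G e) = 2"
    "v \<in> verts G \<Longrightarrow> card {e \<in> edges G. v \<in> ends G e} = 3" "edge_connected 2 G"
  using assms by (auto simp: bridgeless_cubic_def fin_mgraph_def edge_connected_def)

lemma edge_cut_subset: "edge_cut G S \<subseteq> edges G"
  by (auto simp: edge_cut_def)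

lemma edge_cut_complement:
  assumes "fin_mgraph G"
  shows "edge_cut G (verts G - S) = edge_cut G S"
  using assms by (auto simp: edge_cut_def fin_mgraph_def)

lemma finite_edge_cut: "fin_mgraph G \<Longrightarrow> finite (edge_cut G S)"
  by (auto simp: edge_cut_def fin_mgraph_def)

lemma num_comps_delete_few:
  assumes "fin_mgraph G" "edge_connected l G" "X \<subseteq> edges G" "card X < l"
  shows "num_comps G (edges G - X) = 1"
proof -
  have "finite X" using assms finite_subset by (auto simp: fin_mgraph_def)
  have "\<not> 2 \<le> num_comps G (edges G - X)"
  proof
    assume "2 \<le> num_comps G (edges G - X)"
    then obtain S where S: "S \<subseteq> verts G" "S \<noteq> {}" "S \<noteq> verts G" "edge_cut G S \<inter> (edges G - X) = {}"
      using num_comps_ge_2_iff[OF assms(1), of "edges G - X"] by auto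
    then have "edge_cut G S \<subseteq> X" using edge_cut_subset by fastforce
    then have "card (edge_cut G S) \<le> card X" using \<open>finite X\<close> by (simp add: card_mono)
    then show False using edge_connectedD[OF assms(2) S(1-3)] assms(4) by simp
  qed
  moreover have "1 \<le> num_comps G (edges G - X)"
    using num_comps_pos assms by (auto simp: edge_connected_def)
  ultimately show ?thesis by linarith
qed

lemma handshake:
  assumes G: "bridgeless_cubic G" and S: "S \<subseteq> verts G"
  shows "3 * card S = 2 * card {e \<in> edges G. ends G e \<subseteq> S} + card (edge_cut G S)"
proof -
  note D = bridgeless_cubicD[OF G]
  have fS: "finite S" using S D(2) finite_subset by blast
  have "3 * card S = (\<Sum>v\<in>S. card {e \<in> edges G. v \<in> ends G e})"
    using D(7) S by (subst sum.cong[of S S _ "\<lambda>_. 3"]) auto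
  also have "\<dots> = (\<Sum>v\<in>S. \<Sum>e\<in>{e \<in> edges G. v \<in> ends G e}. 1)" by simp
  also have "\<dots> = (\<Sum>e\<in>edges G. \<Sum>v\<in>{v \<in> S. v \<in> ends G e}. 1)"
    using sum.swap_restrict[OF fS D(3)] .
  also have "\<dots> = (\<Sum>e\<in>edges G. card {v \<in> S. v \<in> ends G e})" by simp
  also have "\<dots> = (\<Sum>e\<in>edges G. (if ends G e \<subseteq> S then 2 else 0) + (if e \<in> edge_cut G S then 1 else 0))"
  proof (rule sum.cong)
    fix e assume e: "e \<in> edges G"
    from D(6)[OF e] obtain u v where uv: "ends G e = {u, v}" "u \<noteq> v"
      by (auto simp: card_2_iff)
    have "{w \<in> S. w \<in> ends G e} = (if u \<in> S then {u} else {}) \<union> (if v \<in> S then {v} else {})"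
      using uv by auto
    then show "card {w \<in> S. w \<in> ends G e} =
        (if ends G e \<subseteq> S then 2 else 0) + (if e \<in> edge_cut G S then 1 else 0)"
      using uv e by (auto simp: edge_cut_def)
  qed simp
  also have "\<dots> = 2 * card {e \<in> edges G. ends G e \<subseteq> S} + card {e \<in> edges G. e \<in> edge_cut G S}"
    using D(3) by (simp add: sum.distrib sum.If_cases Int_def mult.commute)
  also have "{e \<in> edges G. e \<in> edge_cut G S} = edge_cut G S" by (auto simp: edge_cut_def)
  finally show ?thesis .
qed

lemma edge_cut_all: "fin_mgraph G \<Longrightarrow> edge_cut G (verts G) = {}"
  by (auto simp: edge_cut_def fin_mgraph_def)

lemma bridgeless_cubic_counts:
  assumes G: "bridgeless_cubic G"
  obtains k where "card (verts G) = 2 * k" "card (edges G) = 3 * k" "1 \<le> k"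
proof -
  note D = bridgeless_cubicD[OF G]
  have "{e \<in> edges G. ends G e \<subseteq> verts G} = edges G" using D(5) by auto
  then have eq: "3 * card (verts G) = 2 * card (edges G)"
    using handshake[OF G, of "verts G"] edge_cut_all[OF D(1)] by simp
  then have "even (card (verts G))" by presburger
  then obtain k where k: "card (verts G) = 2 * k" by blast
  have "card (verts G) \<noteq> 0" using D by simp
  then show thesis using k eq that[of k] by auto
qed

text \<open>Reindexing by the complement \<open>X\<close> of \<open>Z\<close> sorts the summands by cographic rank: the coefficient
\<open>i\<close> places below the top collects exactly the sets \<open>X\<close> of rank \<open>i\<close>.\<close>
lemma coeff_flow_poly_from_top:
  assumes G: "fin_mgraph G"
    and i: "i + card (verts G) \<le> card (edges G) + 1"
  shows "coeff (flow_poly G) (card (edges G) + 1 - card (verts G) - i) =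
    (\<Sum>X | X \<subseteq> edges G \<and> card X + 1 = num_comps G (edges G - X) + i. (- 1) ^ card X)"
proof -
  let ?E = "edges G" and ?n = "card (verts G)"
  let ?d = "card ?E + 1 - ?n - i"
  have fE: "finite ?E" using G by (simp add: fin_mgraph_def)
  have "coeff (flow_poly G) ?d = (\<Sum>Z\<in>Pow ?E.
      if card Z + num_comps G Z - ?n = ?d then (- 1) ^ (card ?E - card Z) else 0)"
    by (simp add: flow_poly_def coeff_sum)
  also have "\<dots> = (\<Sum>X\<in>Pow ?E. if card X + 1 = num_comps G (?E - X) + i then (- 1) ^ card X else 0)"
  proof (rule sum.reindex_bij_witness[of _ "\<lambda>X. ?E - X" "\<lambda>X. ?E - X"])
    fix Z assume Z: "Z \<in> Pow ?E"
    have c: "card (?E - Z) = card ?E - card Z" "card Z \<le> card ?E"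
      using Z fE by (auto simp: card_Diff_subset[OF finite_subset[OF _ fE]] card_mono)
    have "?n \<le> card Z + num_comps G Z" using card_verts_le_num_comps[OF G] Z by auto
    then have "card Z + num_comps G Z - ?n = ?d \<longleftrightarrow> card (?E - Z) + 1 = num_comps G Z + i"
      using c i by linarith
    moreover have "?E - (?E - Z) = Z" using Z by auto
    ultimately show "(if card (?E - Z) + 1 = num_comps G (?E - (?E - Z)) + i then (- 1) ^ card (?E - Z) else 0)
      = (if card Z + num_comps G Z - ?n = ?d then (- 1) ^ (card ?E - card Z) else (0::int))"
      using c by simp
  qed auto
  also have "\<dots> = (\<Sum>X \<in> {X \<in> Pow ?E. card X + 1 = num_comps G (?E - X) + i}. (- 1) ^ card X)"
    using fE by (subst sum.inter_filter) auto
  also have "{X \<in> Pow ?E. card X + 1 = num_comps G (?E - X) + i} =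
      {X. X \<subseteq> ?E \<and> card X + 1 = num_comps G (?E - X) + i}" by auto
  finally show ?thesis .
qed

lemma degree_flow_poly_le:
  assumes G: "fin_mgraph G" and conn: "num_comps G (edges G) = 1"
  shows "degree (flow_poly G) \<le> card (edges G) + 1 - card (verts G)"
  unfolding flow_poly_def
proof (rule degree_sum_le)
  fix Z assume Z: "Z \<in> Pow (edges G)"
  have f: "finite (edges G)" using G by (simp add: fin_mgraph_def)
  have "num_comps G Z \<le> num_comps G (Z \<union> (edges G - Z)) + card (edges G - Z)"
    using num_comps_le_union[OF G, of Z "edges G - Z"] Z by auto
  moreover have "Z \<union> (edges G - Z) = edges G" using Z by auto
  moreover have "card (edges G - Z) + card Z = card (edges G)"
    using Z f card_mono[OF f, of Z] by (auto simp: card_Diff_subset[OF finite_subset[OF _ f]])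
  ultimately have "card Z + num_comps G Z - card (verts G) \<le> card (edges G) + 1 - card (verts G)"
    using conn by simp
  then show "degree (monom ((- 1) ^ (card (edges G) - card Z)) (card Z + num_comps G Z - card (verts G)) :: int poly)
     \<le> card (edges G) + 1 - card (verts G)"
    using degree_monom_le order_trans by blast
qed (use G in \<open>auto simp: fin_mgraph_def\<close>)

text \<open>Without bridges only the empty set has cographic rank 0.\<close>
lemma flow_poly_monic:
  assumes G: "bridgeless_cubic G" and k: "card (verts G) = 2 * k"
  shows "degree (flow_poly G) = k + 1" "lead_coeff (flow_poly G) = 1"
proof -
  note D = bridgeless_cubicD[OF G]
  have m: "card (edges G) = 3 * k" and k1: "1 \<le> k"
    using k by (auto intro: bridgeless_cubic_counts[OF G])
  have conn: "num_comps G (edges G) = 1"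
    using num_comps_delete_few[OF D(1) D(8), of "{}"] by simp
  have le: "degree (flow_poly G) \<le> k + 1"
    using degree_flow_poly_le[OF D(1) conn] k m by simp
  have "{X. X \<subseteq> edges G \<and> card X + 1 = num_comps G (edges G - X) + 0} = {{}}"
  proof (intro equalityI subsetI)
    fix X assume X: "X \<in> {X. X \<subseteq> edges G \<and> card X + 1 = num_comps G (edges G - X) + 0}"
    show "X \<in> {{}}"
    proof (rule ccontr)
      assume "X \<notin> {{}}"
      then obtain x where "x \<in> X" by auto
      then show False
        using num_comps_delete_mono[OF D(1), of "{x}" X]
          num_comps_delete_few[OF D(1) D(8), of "{x}"] X by auto
    qed
  qed (use conn in auto)
  then have "coeff (flow_poly G) (k + 1) = 1"
    using coeff_flow_poly_from_top[OF D(1), of 0] k m by simp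
  then show "degree (flow_poly G) = k + 1" "lead_coeff (flow_poly G) = 1"
    using le le_degree[of "flow_poly G" "k + 1"] by (auto simp: le_antisym)
qed

section \<open>Power sums of the roots of a monic polynomial\<close>

text \<open>For a monic polynomial, by Newton's identities, the sum of the roots and the sum of their squares.
Reading the coefficients off the reflected polynomial avoids truncated subtraction in the index
when the degree is small.\<close>
definition psum1 :: "'a::comm_ring_1 poly \<Rightarrow> 'a" where
  "psum1 P = - coeff (reflect_poly P) 1"

definition psum2 :: "'a::comm_ring_1 poly \<Rightarrow> 'a" where
  "psum2 P = (coeff (reflect_poly P) 1)\<^sup>2 - 2 * coeff (reflect_poly P) 2"

lemma psum_mult:
  fixes P Q :: "'a::idom poly"
  assumes "lead_coeff P = 1" "lead_coeff Q = 1"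
  shows "psum1 (P * Q) = psum1 P + psum1 Q" "psum2 (P * Q) = psum2 P + psum2 Q"
  using assms by (auto simp: psum1_def psum2_def reflect_poly_mult coeff_mult numeral_2_eq_2
      algebra_simps power2_eq_square)

lemma psum_linear:
  fixes a :: "'a::idom"
  shows "psum1 [:- a, 1:] = a" "psum2 [:- a, 1:] = a\<^sup>2"
  by (auto simp: psum1_def psum2_def coeff_reflect_poly)

section \<open>Three-edge-connected cubic graphs\<close>

text \<open>With three components each of them would be left by at least three of the four deleted edges, but a
deleted edge leaves at most two components: \<open>3 \<cdot> 3 > 2 \<cdot> 4\<close>.\<close>
lemma num_comps_delete_four:
  assumes G: "bridgeless_cubic G" and ec: "edge_connected 3 G" and Y: "Y \<subseteq> edges G" "card Y = 4"
  shows "num_comps G (edges G - Y) \<le> 2"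
proof (rule ccontr)
  note D = bridgeless_cubicD[OF G]
  let ?Q = "verts G // conn_rel G (edges G - Y)"
  assume "\<not> num_comps G (edges G - Y) \<le> 2"
  then have "3 \<le> card ?Q" by (simp add: num_comps_def)
  then obtain T where T: "T \<subseteq> ?Q" "card T = 3" by (rule obtain_subset_with_card_n)
  from T(2) obtain A B C where ABC: "T = {A, B, C}" "A \<noteq> B" "A \<noteq> C" "B \<noteq> C"
    unfolding card_3_iff by blast
  have eq: "equiv (verts G) (conn_rel G (edges G - Y))" by (rule equiv_conn_rel)
  have in_Q: "A \<in> ?Q" "B \<in> ?Q" "C \<in> ?Q" using T ABC by auto
  have disj: "A \<inter> B = {}" "A \<inter> C = {}" "B \<inter> C = {}"
    using quotient_disj[OF eq] in_Q ABC by auto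
  have ne: "P \<noteq> {}" "P \<subseteq> verts G" if "P \<in> ?Q" for P
    using that in_quotient_imp_non_empty[OF eq] in_quotient_imp_subset[OF eq] by auto
  have cut: "edge_cut G P \<subseteq> Y" if P: "P \<in> ?Q" for P
  proof -
    obtain x where "P = conn_rel G (edges G - Y) `` {x}" using P by (auto simp: quotient_def)
    then have "closed_under G (edges G - Y) P"
      using closed_under_component[OF D(1)] by auto
    then show ?thesis by (auto simp: closed_under_def edge_cut_def)
  qed
  have fY: "finite Y" using Y(2) by (simp add: card_ge_0_finite)
  have "A \<noteq> verts G" "B \<noteq> verts G" "C \<noteq> verts G"
    using ne[OF in_Q(1)] ne[OF in_Q(2)] ne[OF in_Q(3)] disj by auto
  then have ge: "3 \<le> card (edge_cut G A)" "3 \<le> card (edge_cut G B)" "3 \<le> card (edge_cut G C)"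
    using edge_connectedD[OF ec] ne[OF in_Q(1)] ne[OF in_Q(2)] ne[OF in_Q(3)] by auto
  have "edge_cut G A \<inter> edge_cut G B \<inter> edge_cut G C = {}"
  proof (rule ccontr)
    assume "edge_cut G A \<inter> edge_cut G B \<inter> edge_cut G C \<noteq> {}"
    then obtain e where e: "e \<in> edge_cut G A" "e \<in> edge_cut G B" "e \<in> edge_cut G C" by auto
    then have "card (ends G e) = 2" using D(6) by (auto simp: edge_cut_def)
    then obtain u v where "ends G e = {u, v}" by (auto simp: card_2_iff)
    with e disj show False by (auto simp: edge_cut_def)
  qed
  then have "card (edge_cut G A \<inter> edge_cut G B) + card (edge_cut G C) \<le> 4"
    using card_Un_disjoint[of "edge_cut G A \<inter> edge_cut G B" "edge_cut G C"]
      card_mono[OF fY, of "edge_cut G A \<inter> edge_cut G B \<union> edge_cut G C"]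
      finite_edge_cut[OF D(1)] cut in_Q Y(2) by auto
  moreover have "card (edge_cut G A \<union> edge_cut G B) \<le> 4"
    using card_mono[OF fY, of "edge_cut G A \<union> edge_cut G B"] cut in_Q Y(2) by auto
  ultimately show False
    using card_Un_Int[OF finite_edge_cut[OF D(1), of A] finite_edge_cut[OF D(1), of B]] ge by linarith
qed

text \<open>In a three-edge-connected cubic graph the sets of cographic rank 1 are the single edges, and those
of rank 2 are the pairs of edges and the three-edge cuts; a larger set has larger rank, because four
edges already leave at most two components.\<close>
lemma psum_three_connected:
  assumes G: "bridgeless_cubic G" and ec: "edge_connected 3 G"
  shows "psum1 (flow_poly G) = int (card (edges G))"
    "psum2 (flow_poly G) = int (card (edges G)) +
       2 * int (card {X. X \<subseteq> edges G \<and> card X = 3 \<and> num_comps G (edges G - X) = 2})"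
proof -
  note D = bridgeless_cubicD[OF G]
  let ?m = "card (edges G)"
  let ?T = "{X. X \<subseteq> edges G \<and> card X = 3 \<and> num_comps G (edges G - X) = 2}"
  obtain k where k: "card (verts G) = 2 * k" and m: "?m = 3 * k" and k1: "1 \<le> k"
    by (rule bridgeless_cubic_counts[OF G])
  note dl = num_comps_delete_few[OF D(1) ec]
  have conn: "num_comps G (edges G) = 1" using dl[of "{}"] by simp
  have fin: "finite X" if "X \<subseteq> edges G" for X using that D(3) finite_subset by blast
  have c: "coeff (reflect_poly (flow_poly G)) i =
      (\<Sum>X | X \<subseteq> edges G \<and> card X + 1 = num_comps G (edges G - X) + i. (- 1) ^ card X)" if "i \<le> 2" for i
    using coeff_flow_poly_from_top[OF D(1), of i] flow_poly_monic[OF G k] k m k1 that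
    by (simp add: coeff_reflect_poly)
  have big: "num_comps G (edges G - X) + 1 \<le> card X" if X: "X \<subseteq> edges G" "2 \<le> card X" for X
  proof -
    obtain Y where "Y \<subseteq> X" "card Y = 2" using X(2) by (rule obtain_subset_with_card_n)
    with X(1) have "num_comps G (edges G - Y) = 1" by (intro dl) auto
    then show ?thesis
      using num_comps_delete_mono[OF D(1) \<open>Y \<subseteq> X\<close> X(1)] \<open>card Y = 2\<close> by linarith
  qed
  have big4: "num_comps G (edges G - X) + 2 \<le> card X" if X: "X \<subseteq> edges G" "4 \<le> card X" for X
  proof -
    obtain Y where "Y \<subseteq> X" "card Y = 4" using X(2) by (rule obtain_subset_with_card_n)
    with X(1) have "num_comps G (edges G - Y) \<le> 2"
      by (intro num_comps_delete_four[OF G ec]) auto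
    then show ?thesis
      using num_comps_delete_mono[OF D(1) \<open>Y \<subseteq> X\<close> X(1)] \<open>card Y = 4\<close> by linarith
  qed
  have s1: "{X. X \<subseteq> edges G \<and> card X + 1 = num_comps G (edges G - X) + 1} = {X. X \<subseteq> edges G \<and> card X = 1}"
  proof (intro Collect_cong conj_cong refl)
    fix X assume X: "X \<subseteq> edges G"
    consider "card X < 2" | "2 \<le> card X" by linarith
    then show "(card X + 1 = num_comps G (edges G - X) + 1) = (card X = 1)"
    proof cases
      case 1 then show ?thesis using dl[OF X] by auto
    next
      case 2 then show ?thesis using big[OF X] by auto
    qed
  qed
  have c1: "coeff (reflect_poly (flow_poly G)) 1 = - int ?m"
  proof -
    have "coeff (reflect_poly (flow_poly G)) 1 = (\<Sum>X | X \<subseteq> edges G \<and> card X = 1. - 1)"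
      unfolding c[OF one_le_numeral] s1 by (rule sum.cong) auto
    then show ?thesis using n_subsets[OF D(3), of 1] by simp
  qed
  have s2: "{X. X \<subseteq> edges G \<and> card X + 1 = num_comps G (edges G - X) + 2} =
      {X. X \<subseteq> edges G \<and> card X = 2} \<union> ?T"
  proof (rule set_eqI)
    fix X
    consider "\<not> X \<subseteq> edges G" | "X \<subseteq> edges G" "card X < 3" | "X \<subseteq> edges G" "card X = 3"
      | "X \<subseteq> edges G" "4 \<le> card X" by linarith
    then show "X \<in> {X. X \<subseteq> edges G \<and> card X + 1 = num_comps G (edges G - X) + 2} \<longleftrightarrow>
      X \<in> {X. X \<subseteq> edges G \<and> card X = 2} \<union> ?T"
    proof cases
      case 2 then show ?thesis using dl[of X] by auto
    next
      case 4 then show ?thesis using big4[of X] by auto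
    qed auto
  qed
  have c2: "coeff (reflect_poly (flow_poly G)) 2 = int (?m choose 2) - int (card ?T)"
  proof -
    have fT: "finite ?T" "finite {X. X \<subseteq> edges G \<and> card X = 2}" using D(3) by auto
    have "coeff (reflect_poly (flow_poly G)) 2 =
        (\<Sum>X | X \<subseteq> edges G \<and> card X = 2. (- 1) ^ card X) + (\<Sum>X\<in>?T. (- 1) ^ card X)"
      unfolding c[OF order_refl] s2 by (rule sum.union_disjoint) (use fT in auto)
    also have "\<dots> = (\<Sum>X | X \<subseteq> edges G \<and> card X = 2. 1) + (\<Sum>X\<in>?T. - 1)"
      by (intro arg_cong2[of _ _ _ _ "(+)"] sum.cong) auto
    finally show ?thesis using n_subsets[OF D(3), of 2] by simp
  qed
  show "psum1 (flow_poly G) = int ?m" using c1 by (simp add: psum1_def)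
  have m1: "int (?m - 1) = int ?m - 1" using k1 m by (simp add: of_nat_diff)
  have "2 * (?m choose 2) = ?m * (?m - 1)"
    unfolding choose_two by (rule dvd_mult_div_cancel) (cases "even ?m"; simp)
  then have "int (2 * (?m choose 2)) = int (?m * (?m - 1))" by (rule arg_cong)
  then have "2 * int (?m choose 2) = int ?m * (int ?m - 1)" using m1 by simp
  then show "psum2 (flow_poly G) = int ?m + 2 * int (card ?T)"
    using c1 c2 by (simp add: psum2_def algebra_simps power2_eq_square)
qed

text \<open>Contract a minimal member \<open>A\<close> to one of its points.  This removes an even number, at least 2, of
points and exactly one set, and it keeps sizes odd and at least 3 and the family laminar.\<close>
lemma card_laminar_odd:
  fixes F :: "'a set set"
  assumes "finite V" "F \<subseteq> Pow V" "F \<noteq> {}"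
    and "\<And>A. A \<in> F \<Longrightarrow> odd (card A) \<and> card A \<noteq> 1"
    and "\<And>A B. A \<in> F \<Longrightarrow> B \<in> F \<Longrightarrow> A \<inter> B = {} \<or> A \<subseteq> B \<or> B \<subseteq> A"
  shows "2 * card F + 1 \<le> card V"
proof -
  have "finite F" using assms(1) by (intro finite_subset[OF assms(2)]) simp
  then show ?thesis using assms
  proof (induction "card F" arbitrary: F V rule: less_induct)
    case less
    note V = less.prems(2) and sub = less.prems(3) and odd = less.prems(5) and lam = less.prems(6)
    obtain A where A: "A \<in> F" and min: "\<And>B. B \<in> F \<Longrightarrow> card A \<le> card B"
    proof -
      obtain A0 where "A0 \<in> F" using less.prems(4) by auto
      from ex_has_least_nat[of "\<lambda>A. A \<in> F", OF this, of card] that show thesis by auto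
    qed
    have finA: "finite B" if "B \<in> F" for B using that sub by (auto intro: finite_subset[OF _ V])
    have oddA: "odd (card A)" "card A \<noteq> 1" using odd[OF A] by auto
    then have cA: "3 \<le> card A" by presburger
    then have "A \<noteq> {}" by auto
    then obtain a where a: "a \<in> A" by blast
    define D where "D = A - {a}"
    have cD: "card D + 1 = card A" using a cA by (simp add: D_def)
    have "D \<subseteq> V" using A sub by (auto simp: D_def)
    have cases: "B \<inter> A = {} \<or> A \<subset> B" if "B \<in> F" "B \<noteq> A" for B
      using lam[OF that(1) A] min[OF that(1)] that psubset_card_mono[OF finA[OF A], of B] by auto
    define F' where "F' = (\<lambda>B. B - D) ` (F - {A})"
    have inj: "inj_on (\<lambda>B. B - D) (F - {A})"
    proof (rule inj_onI)
      fix B C assume BC: "B \<in> F - {A}" "C \<in> F - {A}" "B - D = C - D"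
      have "a \<in> B \<longleftrightarrow> a \<in> C" using BC(3) by (auto simp: D_def)
      then have "A \<subseteq> B \<longleftrightarrow> A \<subseteq> C" "B \<inter> A = {} \<longleftrightarrow> C \<inter> A = {}"
        using cases[of B] cases[of C] BC a by auto
      then show "B = C" using cases[of B] cases[of C] BC by (auto simp: D_def)
    qed
    have cF: "card F' + 1 = card F"
      using card_image[OF inj] card_Suc_Diff1[OF less.prems(1) A] by (simp add: F'_def)
    have "card (V - D) = card V - card D"
      using \<open>D \<subseteq> V\<close> V by (simp add: card_Diff_subset finite_subset)
    moreover have "card A \<le> card V" using A sub V by (auto intro: card_mono)
    ultimately have cV: "card (V - D) + card D = card V" using cD by simp
    show ?case
    proof (cases "F' = {}")
      case True
      then have "card F = 1" using cF by simp
      then show ?thesis using cA \<open>card A \<le> card V\<close> by simp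
    next
      case False
      have "2 * card F' + 1 \<le> card (V - D)"
      proof (rule less.hyps)
        show "card F' < card F" using cF by simp
        show "finite F'" "finite (V - D)" "F' \<subseteq> Pow (V - D)" "F' \<noteq> {}"
          using less.prems(1) V sub False by (auto simp: F'_def)
      next
        fix B' assume "B' \<in> F'"
        then obtain B where B: "B \<in> F" "B \<noteq> A" "B' = B - D" by (auto simp: F'_def)
        show "odd (card B') \<and> card B' \<noteq> 1"
        proof (cases "A \<subset> B")
          case True
          then have "D \<subseteq> B" by (auto simp: D_def)
          then have "card B' + card D = card B"
            using finA[OF B(1)] B(3) card_mono[of B D]
            by (simp add: card_Diff_subset[OF finite_subset[of D B]])
          moreover have "card A < card B" using True finA[OF B(1)] by (simp add: psubset_card_mono)
          moreover have "odd (card A)" "odd (card B)" using odd A B by auto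
          ultimately show ?thesis using cD by presburger
        next
          case False
          then have "B' = B" using cases[OF B(1,2)] B(3) by (auto simp: D_def)
          then show ?thesis using odd[OF B(1)] by simp
        qed
      next
        fix B' C' assume "B' \<in> F'" "C' \<in> F'"
        then obtain B C where "B \<in> F" "B \<noteq> A" "B' = B - D" "C \<in> F" "C \<noteq> A" "C' = C - D"
          by (auto simp: F'_def)
        then show "B' \<inter> C' = {} \<or> B' \<subseteq> C' \<or> C' \<subseteq> B'" using lam[of B C] by auto
      qed
      then show ?thesis using cF cV cD cA by linarith
    qed
  qed
qed

lemma edge_cut_submodular:
  assumes G: "bridgeless_cubic G"
  shows "card (edge_cut G (A \<inter> B)) + card (edge_cut G (A \<union> B)) \<le> card (edge_cut G A) + card (edge_cut G B)"
    and "card (edge_cut G (A - B)) + card (edge_cut G (B - A)) \<le> card (edge_cut G A) + card (edge_cut G B)"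
proof -
  note D = bridgeless_cubicD[OF G]
  let ?i = "\<lambda>S e. if e \<in> edge_cut G S then 1 else 0 :: nat"
  have c: "card (edge_cut G S) = (\<Sum>e\<in>edges G. ?i S e)" for S
  proof -
    have "edge_cut G S = {e \<in> edges G. e \<in> edge_cut G S}" by (auto simp: edge_cut_def)
    then show ?thesis using D(3) by (simp add: sum.If_cases Int_def)
  qed
  have mem: "\<exists>u v. \<forall>S. e \<in> edge_cut G S \<longleftrightarrow> (u \<in> S) \<noteq> (v \<in> S)" if e: "e \<in> edges G" for e
  proof -
    obtain u v where "ends G e = {u, v}" using D(6)[OF e] by (auto simp: card_2_iff)
    then show ?thesis using e by (intro exI[of _ u] exI[of _ v]) (auto simp: edge_cut_def)
  qed
  have "?i (A \<inter> B) e + ?i (A \<union> B) e \<le> ?i A e + ?i B e" if e: "e \<in> edges G" for e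
  proof -
    obtain u v where "\<And>S. e \<in> edge_cut G S \<longleftrightarrow> (u \<in> S) \<noteq> (v \<in> S)" using mem[OF e] by blast
    then show ?thesis by (cases "u \<in> A"; cases "v \<in> A"; cases "u \<in> B"; cases "v \<in> B") simp_all
  qed
  then show "card (edge_cut G (A \<inter> B)) + card (edge_cut G (A \<union> B)) \<le> card (edge_cut G A) + card (edge_cut G B)"
    unfolding c sum.distrib[symmetric] by (rule sum_mono)
  have "?i (A - B) e + ?i (B - A) e \<le> ?i A e + ?i B e" if e: "e \<in> edges G" for e
  proof -
    obtain u v where "\<And>S. e \<in> edge_cut G S \<longleftrightarrow> (u \<in> S) \<noteq> (v \<in> S)" using mem[OF e] by blast
    then show ?thesis by (cases "u \<in> A"; cases "v \<in> A"; cases "u \<in> B"; cases "v \<in> B") simp_all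
  qed
  then show "card (edge_cut G (A - B)) + card (edge_cut G (B - A)) \<le> card (edge_cut G A) + card (edge_cut G B)"
    unfolding c sum.distrib[symmetric] by (rule sum_mono)
qed

lemma edge_cut_parity:
  assumes "bridgeless_cubic G" "S \<subseteq> verts G"
  shows "even (card (edge_cut G S)) \<longleftrightarrow> even (card S)"
  using handshake[OF assms] by presburger

text \<open>If two such sets cross, all four corners are nonempty and proper, so each corner has at least three
boundary edges.  One of the corners \<open>A \<inter> B\<close> and \<open>A - B\<close> has even size, because \<open>A\<close> has odd size,
and then at least four boundary edges; submodularity bounds it and its opposite corner together
by \<open>3 + 3\<close>.\<close>
lemma three_cuts_laminar:
  assumes G: "bridgeless_cubic G" and ec: "edge_connected 3 G"
    and A: "A \<subseteq> verts G" "card (edge_cut G A) = 3" and B: "B \<subseteq> verts G" "card (edge_cut G B) = 3"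
    and AB: "A \<union> B \<noteq> verts G"
  shows "A \<inter> B = {} \<or> A \<subseteq> B \<or> B \<subseteq> A"
proof (rule ccontr)
  note D = bridgeless_cubicD[OF G]
  assume "\<not> ?thesis"
  then have ne: "A \<inter> B \<noteq> {}" "A - B \<noteq> {}" "B - A \<noteq> {}" by auto
  have cut: "3 \<le> card (edge_cut G S)" if "S \<subseteq> A \<union> B" "S \<noteq> {}" for S
    using edge_connectedD[OF ec, of S] that A B AB by auto
  have even4: "4 \<le> card (edge_cut G S)" if "S \<subseteq> A \<union> B" "S \<noteq> {}" "even (card S)" for S
    using cut[OF that(1,2)] edge_cut_parity[OF G, of S] that A B by (cases "card (edge_cut G S) = 3") auto
  have "finite A" using A(1) D(2) finite_subset by blast
  then have "card (A \<inter> B) + card (A - B) = card A"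
    by (metis card_Int_Diff)
  moreover have "odd (card A)" using edge_cut_parity[OF G A(1)] A(2) by simp
  ultimately have "even (card (A \<inter> B)) \<or> even (card (A - B))" by presburger
  then consider "even (card (A \<inter> B))" | "even (card (A - B))" by blast
  then show False
  proof cases
    case 1
    then show False
      using even4[OF _ ne(1) 1] cut[of "A \<union> B"] ne edge_cut_submodular(1)[OF G, of A B] A(2) B(2)
      by (fastforce simp: le_infI1)
  next
    case 2
    then show False
      using even4[OF _ ne(2) 2] cut[OF _ ne(3)] edge_cut_submodular(2)[OF G, of A B] A(2) B(2)
      by (fastforce simp: le_infI1)
  qed
qed

text \<open>Represent each cut by its side that avoids a fixed vertex \<open>r\<close>.  There are at most \<open>2k - 1\<close>
singletons, and at most \<open>k - 1\<close> other sides by the bound for laminar families.\<close>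
lemma card_three_cuts:
  assumes G: "bridgeless_cubic G" and ec: "edge_connected 3 G" and k: "card (verts G) = 2 * k"
  shows "card {X. X \<subseteq> edges G \<and> card X = 3 \<and> num_comps G (edges G - X) = 2} + 2 \<le> 3 * k"
proof -
  note D = bridgeless_cubicD[OF G]
  obtain r where r: "r \<in> verts G" using D(4) by auto
  let ?U = "verts G - {r}"
  have cU: "card ?U + 1 = 2 * k" "1 \<le> k"
    using r D(2) k card_gt_0_iff[of "verts G"] by (auto simp: card_Suc_Diff1)
  define L where "L = {A. A \<subseteq> ?U \<and> card (edge_cut G A) = 3}"
  define F where "F = {A \<in> L. card A \<noteq> 1}"
  have finL: "finite L" using D(2) by (auto simp: L_def)
  have "{X. X \<subseteq> edges G \<and> card X = 3 \<and> num_comps G (edges G - X) = 2} \<subseteq> edge_cut G ` L"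
  proof
    fix X assume X: "X \<in> {X. X \<subseteq> edges G \<and> card X = 3 \<and> num_comps G (edges G - X) = 2}"
    then have "2 \<le> num_comps G (edges G - X)" by simp
    then obtain S where S: "S \<subseteq> verts G" "S \<noteq> {}" "S \<noteq> verts G" "edge_cut G S \<inter> (edges G - X) = {}"
      using num_comps_ge_2_iff[OF D(1), of "edges G - X"] by auto
    have "edge_cut G S \<subseteq> X" using S(4) edge_cut_subset by fastforce
    moreover have "3 \<le> card (edge_cut G S)" using edge_connectedD[OF ec S(1-3)] .
    moreover have "finite X" using X by (simp add: card_ge_0_finite)
    ultimately have eq: "edge_cut G S = X" using X by (simp add: card_subset_eq card_seteq)
    define A where "A = (if r \<in> S then verts G - S else S)"
    have "edge_cut G A = X" using eq edge_cut_complement[OF D(1)] by (simp add: A_def)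
    moreover have "A \<subseteq> ?U" using S(1) by (auto simp: A_def)
    ultimately show "X \<in> edge_cut G ` L" using X by (auto simp: L_def)
  qed
  then have "card {X. X \<subseteq> edges G \<and> card X = 3 \<and> num_comps G (edges G - X) = 2} \<le> card L"
    using finL surj_card_le by blast
  also have "card L \<le> card ((\<lambda>v. {v}) ` ?U \<union> F)"
    using D(2) finL by (intro card_mono) (auto simp: F_def L_def card_1_singleton_iff)
  also have "\<dots> \<le> card ((\<lambda>v. {v}) ` ?U) + card F" by (rule card_Un_le)
  also have "\<dots> \<le> card ?U + card F" using D(2) by (simp add: card_image_le)
  finally have le: "card {X. X \<subseteq> edges G \<and> card X = 3 \<and> num_comps G (edges G - X) = 2} \<le> card ?U + card F" .
  have "2 * card F + 1 \<le> card ?U" if "F \<noteq> {}"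
  proof (rule card_laminar_odd[OF _ _ that])
    show "finite ?U" "F \<subseteq> Pow ?U" using D(2) by (auto simp: F_def L_def)
  next
    fix A assume "A \<in> F"
    then show "odd (card A) \<and> card A \<noteq> 1"
      using edge_cut_parity[OF G, of A] by (auto simp: F_def L_def)
  next
    fix A B assume "A \<in> F" "B \<in> F"
    then show "A \<inter> B = {} \<or> A \<subseteq> B \<or> B \<subseteq> A"
      using r by (intro three_cuts_laminar[OF G ec]) (auto simp: F_def L_def)
  qed
  moreover have "1 \<le> card ?U" using cU by linarith
  ultimately have "2 * card F + 1 \<le> card ?U" by (cases "F = {}") auto
  then show ?thesis using le cU by linarith
qed

lemma psum_bound_three_connected:
  assumes G: "bridgeless_cubic G" and ec: "edge_connected 3 G" and k: "card (verts G) = 2 * k"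
  shows "psum2 (flow_poly G) + 6 * int k + 4 \<le> 5 * psum1 (flow_poly G)"
proof -
  have "card (edges G) = 3 * k" using k by (auto intro: bridgeless_cubic_counts[OF G])
  then show ?thesis using psum_three_connected[OF G ec] card_three_cuts[OF G ec k] by simp
qed

section \<open>Integer polynomials whose power sums force the roots 2 and 3\<close>

text \<open>The inequality of the means in the weak form needed, from \<open>ln x \<le> x - 1\<close>.\<close>
lemma prod_mset_pos_ge_1_sum_ge_size:
  fixes M :: "real multiset"
  assumes "\<And>x. x \<in># M \<Longrightarrow> 0 < x" and "1 \<le> prod_mset M"
  shows "real (size M) \<le> sum_mset M"
proof -
  have "0 < prod_mset M \<and> ln (prod_mset M) \<le> sum_mset M - real (size M)"
    using assms(1)
  proof (induction M)
    case empty then show ?case by simp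
  next
    case (add x M)
    then have "0 \<notin># M" "0 < x" "0 < prod_mset M" "ln (prod_mset M) \<le> sum_mset M - real (size M)" by force+
    moreover have "ln x \<le> x - 1" using \<open>0 < x\<close> by (rule ln_le_minus_one)
    ultimately show ?case by (simp add: ln_mult)
  qed
  then show ?thesis using assms(2) by (smt (verit) ln_ge_zero)
qed

lemma monic_linear_product:
  fixes M :: "'a::idom multiset"
  shows "lead_coeff (\<Prod>x\<in>#M. [:- x, 1:]) = 1" "degree (\<Prod>x\<in>#M. [:- x, 1:]) = size M"
proof -
  have "lead_coeff (\<Prod>x\<in>#M. [:- x, 1:]) = 1 \<and> degree (\<Prod>x\<in>#M. [:- x, 1:]) = size M"
  proof (induction M)
    case (add x M)
    then have "(\<Prod>x\<in>#M. [:- x, 1:]) \<noteq> 0" by auto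
    then have "degree (\<Prod>y\<in>#add_mset x M. [:- y, 1:]) = 1 + degree (\<Prod>y\<in>#M. [:- y, 1:])"
      by (simp add: degree_mult_eq del: mult_pCons_left)
    then have "degree (\<Prod>y\<in>#add_mset x M. [:- y, 1:]) = size (add_mset x M)"
      using add by simp
    moreover have "lead_coeff (\<Prod>y\<in>#add_mset x M. [:- y, 1:]) = 1"
      unfolding image_mset_add_mset prod_mset.add_mset lead_coeff_mult conjunct1[OF add] by simp
    ultimately show ?case by blast
  qed simp
  then show "lead_coeff (\<Prod>x\<in>#M. [:- x, 1:]) = 1" "degree (\<Prod>x\<in>#M. [:- x, 1:]) = size M" by auto
qed

lemma psum_prod_linear:
  fixes M :: "'a::idom multiset"
  shows "psum1 (\<Prod>x\<in>#M. [:- x, 1:]) = sum_mset M"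
    "psum2 (\<Prod>x\<in>#M. [:- x, 1:]) = (\<Sum>x\<in>#M. x\<^sup>2)"
proof -
  have "psum1 (\<Prod>x\<in>#M. [:- x, 1:]) = sum_mset M \<and> psum2 (\<Prod>x\<in>#M. [:- x, 1:]) = (\<Sum>x\<in>#M. x\<^sup>2)"
  proof (induction M)
    case empty show ?case by (simp add: psum1_def psum2_def)
  next
    case (add x M)
    then show ?case
      using psum_mult[of "[:- x, 1:]" "\<Prod>x\<in>#M. [:- x, 1:]"] monic_linear_product[of M]
      by (simp add: psum_linear del: mult_pCons_left)
  qed
  then show "psum1 (\<Prod>x\<in>#M. [:- x, 1:]) = sum_mset M"
    "psum2 (\<Prod>x\<in>#M. [:- x, 1:]) = (\<Sum>x\<in>#M. x\<^sup>2)" by auto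
qed

lemma map_poly_of_int_mult:
  fixes P Q :: "int poly"
  shows "(map_poly of_int (P * Q) :: complex poly) = map_poly of_int P * map_poly of_int Q"
  by (rule poly_eqI) (simp add: coeff_map_poly coeff_mult)

lemma psum_map_poly_of_int:
  "psum1 (map_poly of_int P :: complex poly) = of_int (psum1 P)"
  "psum2 (map_poly of_int P :: complex poly) = of_int (psum2 P)"
  by (auto simp: psum1_def psum2_def coeff_reflect_poly coeff_map_poly degree_map_poly)

lemma pcompose_linear_product:
  fixes M :: "'a::idom multiset"
  shows "pcompose (\<Prod>x\<in>#M. [:- x, 1:]) [:c, 1:] = (\<Prod>x\<in>#M. [:- (x - c), 1:])"
proof (induction M)
  case (add x M)
  then show ?case by (simp add: pcompose_mult pcompose_pCons del: mult_pCons_left)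
qed (simp add: pcompose_1)

lemma map_poly_of_int_pcompose:
  "(map_poly of_int (pcompose P Q) :: complex poly) = pcompose (map_poly of_int P) (map_poly of_int Q)"
proof (induction P)
  case (pCons a P)
  have "(map_poly of_int (A + B) :: complex poly) = map_poly of_int A + map_poly of_int B" for A B :: "int poly"
    by (rule poly_eqI) (simp add: coeff_map_poly)
  then show ?case using pCons by (simp add: pcompose_pCons map_poly_pCons map_poly_of_int_mult)
qed simp

text \<open>In terms of \<open>\<mu> = 3 - x\<close> for the roots \<open>x\<close>, the hypothesis on the power sums reads
\<open>\<Sum>\<mu>\<^sup>2 \<le> \<Sum>\<mu>\<close>.  Integrality turns the nonzero \<open>\<mu>\<close> into a multiset whose product has absolute
value at least 1, which bounds \<open>\<Sum>\<mu>\<^sup>2\<close> from below by their number; then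
\<open>\<Sum>(\<mu> - 1)\<^sup>2 = \<Sum>\<mu>\<^sup>2 - 2 \<Sum>\<mu> + size \<le> 0\<close>.\<close>
lemma real_rooted_roots_2_3:
  fixes Q :: "int poly"
  assumes monic: "lead_coeff Q = 1"
    and real: "\<And>z::complex. poly (map_poly of_int Q) z = 0 \<Longrightarrow> z \<in> \<real>"
    and bound: "psum2 Q + 6 * int (degree Q) \<le> 5 * psum1 Q"
  obtains j where "j \<le> degree Q" "Q = [:- 2, 1:] ^ j * [:- 3, 1:] ^ (degree Q - j)"
    "psum1 Q = 3 * int (degree Q) - int j"
proof -
  let ?c = "map_poly of_int :: int poly \<Rightarrow> complex poly"
  define M0 where "M0 = proots (?c Q)"
  have "lead_coeff (?c Q) = 1" using monic by (simp add: degree_map_poly coeff_map_poly)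
  then have M0: "(\<Prod>x\<in>#M0. [:- x, 1:]) = ?c Q"
    using complex_poly_decompose_multiset[of "?c Q"] by (simp add: M0_def)
  have sM0: "size M0 = degree Q"
    using monic_linear_product(2)[of M0] unfolding M0 by (simp add: degree_map_poly)
  have roots: "z \<in> \<real>" if "z \<in># M0" for z
    using that by (intro real) (simp add: M0[symmetric] poly_prod_mset)
  define M where "M = image_mset Re M0"
  have M0M: "M0 = image_mset complex_of_real M"
    unfolding M_def image_mset.compositionality
    by (rule sym, rule multiset.map_ident_strong) (use roots in \<open>auto simp: complex_is_Real_iff complex_eq_iff\<close>)
  have sM: "size M = degree Q" using sM0 by (simp add: M_def)
  have of_real_sum: "complex_of_real (\<Sum>x\<in>#K. g x) = (\<Sum>x\<in>#K. complex_of_real (g x))"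
    for g :: "real \<Rightarrow> real" and K
    by (induction K) auto
  have sum1: "sum_mset M = of_int (psum1 Q)"
  proof -
    have "complex_of_real (sum_mset M) = of_int (psum1 Q)"
      using psum_map_poly_of_int(1)[of Q] psum_prod_linear(1)[of M0] M0 M0M
        of_real_sum[of "\<lambda>x. x" M] by simp
    then show ?thesis by (metis of_real_eq_iff of_real_of_int_eq)
  qed
  have sum2: "(\<Sum>x\<in>#M. x\<^sup>2) = of_int (psum2 Q)"
  proof -
    have "complex_of_real (\<Sum>x\<in>#M. x\<^sup>2) = of_int (psum2 Q)"
      using psum_map_poly_of_int(2)[of Q] psum_prod_linear(2)[of M0] M0 M0M
      by (simp add: image_mset.compositionality comp_def of_real_sum)
    then show ?thesis by (metis of_real_eq_iff of_real_of_int_eq)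
  qed
  define N where "N = filter_mset (\<lambda>x. x \<noteq> 3) M"
  have MN: "M = N + replicate_mset (count M 3) 3"
    unfolding N_def by (metis filter_eq_replicate_mset multiset_partition union_commute)
  \<comment> \<open>The multiplicity of 3: the factor \<open>x ^ a\<close> splits off after shifting the roots by 3.\<close>
  define a where "a = count M 3"
  have int_prod: "1 \<le> \<bar>\<Prod>x\<in>#N. 3 - x\<bar>"
  proof -
    define P where "P = pcompose Q [:3, 1:]"
    have "?c P = (\<Prod>x\<in>#M0. [:- (x - 3), 1:])"
      unfolding P_def map_poly_of_int_pcompose M0[symmetric]
      by (simp add: map_poly_pCons pcompose_linear_product)
    also have "\<dots> = (\<Prod>x\<in>#N. [:3 - complex_of_real x, 1:]) * [:0, 1:] ^ a"
      unfolding M0M by (subst MN) (simp add: a_def image_mset.compositionality comp_def del: mult_pCons_right)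
    finally have "?c P = monom 1 a * (\<Prod>x\<in>#N. [:3 - complex_of_real x, 1:])"
      by (simp add: monom_altdef mult.commute del: mult_pCons_right mult_pCons_left)
    then have "coeff (?c P) a = coeff (\<Prod>x\<in>#N. [:3 - complex_of_real x, 1:]) 0"
      by (simp add: coeff_monom_mult)
    also have "\<dots> = (\<Prod>x\<in>#N. 3 - complex_of_real x)"
      unfolding poly_0_coeff_0[symmetric] by (simp add: poly_prod_mset image_mset.compositionality comp_def)
    also have "\<dots> = complex_of_real (\<Prod>x\<in>#N. 3 - x)"
      by (induction N) auto
    finally have "complex_of_real (\<Prod>x\<in>#N. 3 - x) = of_int (coeff P a)" by (simp add: coeff_map_poly)
    then have eq: "(\<Prod>x\<in>#N. 3 - x) = of_int (coeff P a)" by (metis of_real_eq_iff of_real_of_int_eq)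
    moreover have "(\<Prod>x\<in>#N. 3 - x) \<noteq> 0" by (auto simp: N_def prod_mset_zero_iff)
    ultimately have "coeff P a \<noteq> 0" by auto
    then show ?thesis unfolding eq by (simp flip: of_int_abs)
  qed
  have "(\<Prod>x\<in>#N. (3 - x)\<^sup>2) = (\<Prod>x\<in>#N. 3 - x)\<^sup>2"
    by (induction N) (auto simp: power_mult_distrib)
  also have "1 \<le> \<dots>" using int_prod by (simp add: one_le_power abs_le_square_iff[of 1, simplified])
  finally have prod_ge: "1 \<le> (\<Prod>x\<in>#N. (3 - x)\<^sup>2)" .
  have size_le: "real (size N) \<le> (\<Sum>x\<in>#N. (3 - x)\<^sup>2)"
  proof -
    have "0 < y" if "y \<in># image_mset (\<lambda>x. (3 - x)\<^sup>2) N" for y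
      using that by (auto simp: N_def)
    from prod_mset_pos_ge_1_sum_ge_size[OF this prod_ge] show ?thesis by simp
  qed
  have dist: "(\<Sum>x\<in>#K. (3 - x)\<^sup>2) = (\<Sum>x\<in>#K. x\<^sup>2) - 6 * sum_mset K + 9 * real (size K)"
    "(\<Sum>x\<in>#K. 3 - x) = 3 * real (size K) - sum_mset K"
    "(\<Sum>x\<in>#K. (2 - x)\<^sup>2) = (\<Sum>x\<in>#K. (3 - x)\<^sup>2) - 2 * (\<Sum>x\<in>#K. 3 - x) + real (size K)"
    for K :: "real multiset"
    by (induction K; simp add: power2_eq_square algebra_simps)+
  have NM: "(\<Sum>x\<in>#M. g x) = (\<Sum>x\<in>#N. g x)" if "g 3 = 0" for g :: "real \<Rightarrow> real"
    by (subst MN) (simp add: that)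
  have "(\<Sum>x\<in>#M. (3 - x)\<^sup>2) \<le> (\<Sum>x\<in>#M. 3 - x)"
    using bound unfolding dist(1,2) sum1 sum2 sM by linarith
  then have sq: "(\<Sum>x\<in>#N. (3 - x)\<^sup>2) \<le> (\<Sum>x\<in>#N. 3 - x)" by (simp add: NM)
  have nonneg: "0 \<le> (\<Sum>x\<in>#K. (2 - x)\<^sup>2)" for K :: "real multiset" by (induction K) auto
  have "(\<Sum>x\<in>#N. (2 - x)\<^sup>2) \<le> 0" using dist(3)[of N] sq size_le by linarith
  then have two: "x = 2" if x: "x \<in># N" for x
  proof -
    obtain K where "N = add_mset x K" using multi_member_split[OF x] by blast
    then have "(2 - x)\<^sup>2 + (\<Sum>x\<in>#K. (2 - x)\<^sup>2) \<le> 0"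
      using \<open>(\<Sum>x\<in>#N. (2 - x)\<^sup>2) \<le> 0\<close> by simp
    then have "(2 - x)\<^sup>2 \<le> 0" using nonneg[of K] by linarith
    then show ?thesis by simp
  qed
  define j where "j = size N"
  have N: "N = replicate_mset j 2"
    unfolding j_def by (rule set_mset_subset_singletonD) (use two in auto)
  have MM: "M = replicate_mset j 2 + replicate_mset a 3" using MN N by (simp add: a_def)
  have aj: "a + j = degree Q" using sM MM by simp
  have "?c Q = ?c ([:- 2, 1:] ^ j * [:- 3, 1:] ^ a)"
  proof -
    have pw: "?c (R ^ n) = (?c R) ^ n" for R n
      by (induction n) (simp_all add: map_poly_of_int_mult)
    show ?thesis unfolding M0[symmetric] M0M MM map_poly_of_int_mult pw
      by (simp add: map_poly_pCons)
  qed
  then have Q: "Q = [:- 2, 1:] ^ j * [:- 3, 1:] ^ a"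
    by (metis (no_types, lifting) coeff_map_poly of_int_0 of_int_eq_iff poly_eqI)
  have "of_int (psum1 Q) = 2 * real j + 3 * real a" using sum1 MM by simp
  then have p: "psum1 Q = 3 * int (degree Q) - int j" using aj by linarith
  have j: "j \<le> degree Q" and a: "a = degree Q - j" using aj by auto
  show thesis by (rule that[OF j Q[unfolded a] p])
qed

section \<open>Splitting a cubic graph along a two-edge cut\<close>

text \<open>One side \<open>A\<close> of a two-edge cut, made cubic again by a new edge between the ends \<open>a\<close> and \<open>b\<close> of the
cut edges.  The new edge reuses the name \<open>e\<close> of a cut edge, so that the types of vertices and edges
stay the same and induction over all graphs of these types is possible.\<close>
definition close_off :: "('v, 'e) mgraph \<Rightarrow> 'v set \<Rightarrow> 'e \<Rightarrow> 'v \<Rightarrow> 'v \<Rightarrow> ('v, 'e) mgraph" where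
  "close_off G A e a b =
     \<lparr>verts = A, edges = insert e {x \<in> edges G. ends G x \<subseteq> A}, ends = (ends G)(e := {a, b})\<rparr>"

lemma close_off_simps [simp]:
  "verts (close_off G A e a b) = A"
  "edges (close_off G A e a b) = insert e {x \<in> edges G. ends G x \<subseteq> A}"
  "ends (close_off G A e a b) = (ends G)(e := {a, b})"
  by (simp_all add: close_off_def)

locale two_edge_cut =
  fixes G :: "('v, 'e) mgraph" and A :: "'v set" and e f :: 'e and a b a' b' :: 'v
  assumes cubic: "bridgeless_cubic G"
    and A: "A \<subseteq> verts G"
    and cut: "edge_cut G A = {e, f}" and ef: "e \<noteq> f"
    and ends_e: "ends G e = {a, a'}" and ends_f: "ends G f = {b, b'}"
    and in_A: "a \<in> A" "b \<in> A" and out_A: "a' \<notin> A" "b' \<notin> A"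
begin

lemmas D = bridgeless_cubicD[OF cubic]

lemma edges_ef: "e \<in> edges G" "f \<in> edges G"
  using cut edge_cut_subset by fastforce+

lemma verts_ab: "a' \<in> verts G" "b' \<in> verts G"
  using D(5)[OF edges_ef(1)] D(5)[OF edges_ef(2)] ends_e ends_f by auto

lemma complement: "two_edge_cut G (verts G - A) e f a' b' a b"
  using cubic cut ef ends_e ends_f in_A out_A verts_ab edge_cut_complement[OF D(1)]
  by unfold_locales (auto simp: insert_commute)

lemma edges_split:
  "edges G = {x \<in> edges G. ends G x \<subseteq> A} \<union> {x \<in> edges G. ends G x \<subseteq> verts G - A} \<union> {e, f}"
proof -
  have "x \<in> edge_cut G A \<or> ends G x \<subseteq> A \<or> ends G x \<subseteq> verts G - A" if "x \<in> edges G" for x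
    using D(5)[OF that] that by (auto simp: edge_cut_def)
  then show ?thesis using cut edges_ef by auto
qed

lemma inner_not_ef: "{x \<in> edges G. ends G x \<subseteq> A} \<inter> {e, f} = {}"
  using ends_e ends_f out_A by auto

text \<open>If both cut edges met \<open>A\<close> in one vertex, the third edge at that vertex would be a bridge.\<close>
lemma a_neq_b: "a \<noteq> b"
proof
  assume "a = b"
  then have [simp]: "b = a" by simp
  have aV: "a \<in> verts G" using in_A A by auto
  have "\<not> ends G x \<subseteq> {a}" if "x \<in> edges G" for x
    using D(6)[OF that] card_mono[of "{a}" "ends G x"] by auto
  then have "edge_cut G {a} = {x \<in> edges G. a \<in> ends G x}" by (auto simp: edge_cut_def)
  then have c3: "card {x \<in> edges G. a \<in> ends G x} = 3" "card (edge_cut G {a}) = 3"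
    using D(7)[OF aV] by auto
  then have "A \<noteq> {a}" using cut ef by auto
  have "edge_cut G (A - {a}) \<subseteq> {x \<in> edges G. a \<in> ends G x} - {e, f}"
  proof
    fix x assume x: "x \<in> edge_cut G (A - {a})"
    then have "x \<noteq> e" "x \<noteq> f" using ends_e ends_f out_A by (auto simp: edge_cut_def)
    then have "x \<notin> edge_cut G A" using cut by auto
    then show "x \<in> {x \<in> edges G. a \<in> ends G x} - {e, f}"
      using x \<open>x \<noteq> e\<close> \<open>x \<noteq> f\<close> by (auto simp: edge_cut_def)
  qed
  moreover have "{e, f} \<subseteq> {x \<in> edges G. a \<in> ends G x}" using edges_ef ends_e ends_f by auto
  then have "card ({x \<in> edges G. a \<in> ends G x} - {e, f}) = 1"
    using c3 ef by (subst card_Diff_subset) auto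
  ultimately have "card (edge_cut G (A - {a})) \<le> 1"
    using card_mono[of "{x \<in> edges G. a \<in> ends G x} - {e, f}"] D(3) by auto
  moreover have "2 \<le> card (edge_cut G (A - {a}))"
    using A in_A \<open>A \<noteq> {a}\<close> aV by (intro edge_connectedD[OF D(8)]) auto
  ultimately show False by simp
qed

abbreviation "H \<equiv> close_off G A e a b"

lemma fin_H: "fin_mgraph H"
  using D A in_A finite_subset[OF A] by (auto simp: fin_mgraph_def card_insert_if)

text \<open>If \<open>S\<close> separates \<open>a\<close> from \<open>b\<close>, the new edge stands in for the one cut edge at \<open>S\<close>.  Otherwise
\<open>S\<close> or its complement in \<open>A\<close> misses both ends, and that set has the same boundary in \<open>G\<close>.\<close>
lemma edge_cut_H_cases:
  assumes "S \<subseteq> A"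
  shows "card (edge_cut H S) = card (edge_cut G S) \<or> card (edge_cut H S) = card (edge_cut G (A - S))"
proof -
  let ?I = "{x \<in> edges G. ends G x \<subseteq> A}"
  let ?C = "{x \<in> ?I. ends G x \<inter> S \<noteq> {} \<and> \<not> ends G x \<subseteq> S}"
  have e: "e \<notin> ?C" "f \<notin> ?C" using inner_not_ef by auto
  have fin: "finite ?C" using D(3) by auto
  have H: "edge_cut H S = ?C \<union> (if a \<in> S \<longleftrightarrow> b \<in> S then {} else {e})"
    using inner_not_ef by (auto simp: edge_cut_def)
  have G: "edge_cut G T = {x \<in> ?I. ends G x \<inter> T \<noteq> {} \<and> \<not> ends G x \<subseteq> T} \<union>
      (if a \<in> T then {e} else {}) \<union> (if b \<in> T then {f} else {})" if T: "T \<subseteq> A" for T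
  proof (rule set_eqI)
    fix x
    consider "x = e" | "x = f" "x \<noteq> e" | "x \<noteq> e" "x \<noteq> f" by blast
    then show "x \<in> edge_cut G T \<longleftrightarrow> x \<in> {x \<in> ?I. ends G x \<inter> T \<noteq> {} \<and> \<not> ends G x \<subseteq> T} \<union>
      (if a \<in> T then {e} else {}) \<union> (if b \<in> T then {f} else {})"
    proof cases
      case 1 then show ?thesis using ends_e in_A out_A T edges_ef ef by (auto simp: edge_cut_def)
    next
      case 2 then show ?thesis using ends_f in_A out_A T edges_ef ef by (auto simp: edge_cut_def)
    next
      case 3
      then have "x \<notin> edge_cut G A" using cut by auto
      then show ?thesis using 3 T by (auto simp: edge_cut_def)
    qed
  qed
  have C': "{x \<in> ?I. ends G x \<inter> (A - S) \<noteq> {} \<and> \<not> ends G x \<subseteq> A - S} = ?C" by auto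
  show ?thesis
    unfolding H G[OF assms] G[OF Diff_subset] C' using e fin in_A by auto
qed

lemma edge_connected_H:
  assumes "\<And>S. S \<subset> A \<Longrightarrow> S \<noteq> {} \<Longrightarrow> l \<le> card (edge_cut G S)"
  shows "edge_connected l H"
  unfolding edge_connected_def
proof (intro conjI allI impI)
  fix S assume S: "S \<subseteq> verts H \<and> S \<noteq> {} \<and> S \<noteq> verts H"
  then have "l \<le> card (edge_cut G S)" "l \<le> card (edge_cut G (A - S))"
    using assms[of S] assms[of "A - S"] by auto
  then show "l \<le> card (edge_cut H S)" using edge_cut_H_cases[of S] S by auto
qed (use in_A in auto)

lemma cubic_H: "bridgeless_cubic H"
  unfolding bridgeless_cubic_def
proof (intro conjI ballI fin_H)
  show "card (ends H x) = 2" if "x \<in> edges H" for x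
    using that a_neq_b D(6) by auto
next
  fix v assume v: "v \<in> verts H"
  then have vV: "v \<in> verts G" using A by auto
  let ?I = "{x \<in> edges G. ends G x \<subseteq> A}" and ?J = "{x \<in> edges G. ends G x \<subseteq> A \<and> v \<in> ends G x}"
  have f: "finite ?J" "e \<notin> ?J" "f \<notin> ?J" using D(3) inner_not_ef by auto
  have "{x \<in> edges G. v \<in> ends G x} =
      ?J \<union> (if v = a then {e} else {}) \<union> (if v = b then {f} else {})"
    using v ends_e ends_f edges_ef out_A by (subst edges_split) auto
  moreover have "{x \<in> edges H. v \<in> ends H x} = ?J \<union> (if v = a \<or> v = b then {e} else {})"
    using inner_not_ef by auto
  ultimately show "card {x \<in> edges H. v \<in> ends H x} = 3"
    using D(7)[OF vV] f a_neq_b by (auto split: if_splits)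
next
  show "edge_connected 2 H"
    by (rule edge_connected_H) (use A in \<open>auto intro!: edge_connectedD[OF D(8)]\<close>)
qed

end

text \<open>The summand of \<open>Z\<close> in the flow polynomial up to the common factor
\<open>(- 1) ^ card (edges G) * t ^ card (verts G)\<close>.  In this form there are no truncated exponents and
the weight is multiplicative over disjoint unions of graphs.\<close>
definition subset_weight :: "('v, 'e) mgraph \<Rightarrow> 'e set \<Rightarrow> int poly" where
  "subset_weight G Z = (- [:0, 1:]) ^ card Z * [:0, 1:] ^ num_comps G Z"

lemma flow_poly_subset_weight:
  assumes G: "fin_mgraph G"
  shows "(- 1) ^ card (edges G) * [:0, 1:] ^ card (verts G) * flow_poly G = (\<Sum>Z\<in>Pow (edges G). subset_weight G Z)"
proof -
  let ?m = "card (edges G)" and ?n = "card (verts G)"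
  have "(- 1) ^ ?m * [:0, 1:] ^ ?n * monom ((- 1) ^ (?m - card Z)) (card Z + num_comps G Z - ?n) = subset_weight G Z"
    if Z: "Z \<in> Pow (edges G)" for Z
  proof -
    have f: "finite (edges G)" using G by (simp add: fin_mgraph_def)
    have n: "?n \<le> card Z + num_comps G Z" using card_verts_le_num_comps[OF G] Z by auto
    have m: "card Z \<le> ?m" using Z f by (auto intro: card_mono)
    have "?m + (?m - card Z) = 2 * (?m - card Z) + card Z" using m by simp
    then have sgn: "(- 1 :: int poly) ^ ?m * (- 1) ^ (?m - card Z) = (- 1) ^ card Z"
      by (metis (no_types, lifting) power_add power_mult power2_minus power_one mult_1)
    have "monom ((- 1) ^ (?m - card Z)) (card Z + num_comps G Z - ?n) =
        (- 1) ^ (?m - card Z) * ([:0, 1:] :: int poly) ^ (card Z + num_comps G Z - ?n)"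
      by (simp add: monom_altdef minus_one_power_iff)
    then have "(- 1) ^ ?m * [:0, 1:] ^ ?n * monom ((- 1) ^ (?m - card Z)) (card Z + num_comps G Z - ?n) =
        ((- 1) ^ ?m * (- 1) ^ (?m - card Z)) * ([:0, 1:] ^ ?n * ([:0, 1:] :: int poly) ^ (card Z + num_comps G Z - ?n))"
      by (simp only: mult.assoc mult.left_commute)
    also have "\<dots> = (- 1) ^ card Z * [:0, 1:] ^ (card Z + num_comps G Z)"
      unfolding sgn using n by (simp flip: power_add)
    also have "\<dots> = subset_weight G Z"
      unfolding subset_weight_def power_minus[of "[:0, 1:]"] power_add by (simp only: mult.assoc)
    finally show ?thesis .
  qed
  then show ?thesis unfolding flow_poly_def sum_distrib_left by (intro sum.cong) auto
qed

lemma sum_Pow_insert: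
  assumes "finite E" "e \<notin> E"
  shows "(\<Sum>Z\<in>Pow (insert e E). g Z) = (\<Sum>Z\<in>Pow E. g Z + g (insert e Z))"
proof -
  have "inj_on (insert e) (Pow E)" using assms(2) by (auto simp: inj_on_def)
  moreover have "Pow E \<inter> insert e ` Pow E = {}" using assms(2) by auto
  ultimately show ?thesis
    using assms(1) by (simp add: Pow_insert sum.union_disjoint sum.reindex sum.distrib)
qed

lemma sum_Pow_Un:
  assumes "finite E" "finite F" "E \<inter> F = {}"
  shows "(\<Sum>Z\<in>Pow (E \<union> F). g Z) = (\<Sum>Y\<in>Pow E. \<Sum>W\<in>Pow F. g (Y \<union> W))"
proof -
  have "(\<Sum>Z\<in>Pow (E \<union> F). g Z) = (\<Sum>(Y, W)\<in>Pow E \<times> Pow F. g (Y \<union> W))"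
    by (rule sum.reindex_bij_witness[of _ "\<lambda>(Y, W). Y \<union> W" "\<lambda>Z. (Z \<inter> E, Z \<inter> F)"])
      (use assms(3) in \<open>auto intro!: arg_cong[of _ _ g]\<close>)
  then show ?thesis by (simp add: sum.cartesian_product)
qed

context two_edge_cut
begin

lemma ends_H_inner:
  assumes "x \<in> {x \<in> edges G. ends G x \<subseteq> A}"
  shows "ends H x = ends G x"
  using assms inner_not_ef by auto

abbreviation "K \<equiv> close_off G (verts G - A) e a' b'"

lemma conn_rel_union:
  assumes Y: "Y \<subseteq> {x \<in> edges G. ends G x \<subseteq> A}" and W: "W \<subseteq> {x \<in> edges G. ends G x \<subseteq> verts G - A}"
  shows "conn_rel G (Y \<union> W) = conn_rel H Y \<union> conn_rel K W"
proof (rule set_eqI)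
  interpret c: two_edge_cut G "verts G - A" e f a' b' a b by (rule complement)
  have subs: "Y \<union> W \<subseteq> edges G" "Y \<subseteq> edges H" "W \<subseteq> edges K" using Y W by auto
  have eY: "e \<notin> Y" and eW: "e \<notin> W" using Y W inner_not_ef c.inner_not_ef by auto
  have cl: "closed_under G (Y \<union> W) (S \<union> T) \<longleftrightarrow> closed_under H Y S \<and> closed_under K W T"
    if "S \<subseteq> A" "T \<subseteq> verts G - A" for S T
  proof -
    have "closed_under H Y S \<longleftrightarrow> (\<forall>x\<in>Y. ends G x \<inter> S = {} \<or> ends G x \<subseteq> S)"
      using eY by (auto simp: closed_under_def)
    moreover have "closed_under K W T \<longleftrightarrow> (\<forall>x\<in>W. ends G x \<inter> T = {} \<or> ends G x \<subseteq> T)"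
      using eW by (auto simp: closed_under_def)
    moreover have "(ends G x \<inter> (S \<union> T) = {} \<or> ends G x \<subseteq> S \<union> T) \<longleftrightarrow> (ends G x \<inter> S = {} \<or> ends G x \<subseteq> S)"
      if "x \<in> Y" for x using Y that \<open>T \<subseteq> _\<close> by auto
    moreover have "(ends G x \<inter> (S \<union> T) = {} \<or> ends G x \<subseteq> S \<union> T) \<longleftrightarrow> (ends G x \<inter> T = {} \<or> ends G x \<subseteq> T)"
      if "x \<in> W" for x using W that \<open>S \<subseteq> _\<close> by auto
    ultimately show ?thesis unfolding closed_under_def[of G] ball_Un by simp
  qed
  fix p :: "'v \<times> 'v"
  obtain u v where p: "p = (u, v)" by (cases p)
  have "(u, v) \<in> conn_rel G (Y \<union> W) \<longleftrightarrow> (u, v) \<in> conn_rel H Y \<union> conn_rel K W"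
  proof
    assume uv: "(u, v) \<in> conn_rel G (Y \<union> W)"
    then have "u \<in> verts G" by (simp add: conn_rel_def)
    show "(u, v) \<in> conn_rel H Y \<union> conn_rel K W"
    proof (cases "u \<in> A")
      case True
      let ?S = "conn_rel H Y `` {u}"
      have "?S \<subseteq> A" using conn_rel_verts[of u _ H Y] by auto
      moreover have "closed_under H Y ?S" using closed_under_component[OF fin_H subs(2)] .
      ultimately have "closed_under G (Y \<union> W) (?S \<union> {})"
        using cl[of ?S "{}"] by (auto simp: closed_under_def)
      moreover have "u \<in> ?S \<union> {}" using True conn_rel_refl[of u H] by simp
      ultimately show ?thesis using closed_under_conn_rel[OF uv] by auto
    next
      case False
      let ?S = "conn_rel K W `` {u}"
      have "?S \<subseteq> verts G - A" using conn_rel_verts[of u _ K W] by auto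
      moreover have "closed_under K W ?S" using closed_under_component[OF c.fin_H subs(3)] .
      ultimately have "closed_under G (Y \<union> W) ({} \<union> ?S)"
        using cl[of "{}" ?S] by (auto simp: closed_under_def)
      moreover have "u \<in> {} \<union> ?S" using False conn_rel_refl[of u K] \<open>u \<in> verts G\<close> by simp
      ultimately show ?thesis using closed_under_conn_rel[OF uv] by auto
    qed
  next
    assume uv: "(u, v) \<in> conn_rel H Y \<union> conn_rel K W"
    let ?S = "conn_rel G (Y \<union> W) `` {u}"
    have "?S \<subseteq> verts G" using conn_rel_verts[of u _ G "Y \<union> W"] by auto
    then have S: "?S = (?S \<inter> A) \<union> (?S - A)" "?S - A \<subseteq> verts G - A" by auto
    have "closed_under G (Y \<union> W) ?S" using closed_under_component[OF D(1) subs(1)] .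
    then have "closed_under H Y (?S \<inter> A)" "closed_under K W (?S - A)"
      using cl[of "?S \<inter> A" "?S - A"] S by auto
    moreover have "u \<in> verts G" using uv conn_rel_verts[of u v H Y] conn_rel_verts[of u v K W] A by auto
    then have "u \<in> ?S" by (simp add: conn_rel_refl)
    moreover have "u \<in> A" if "(u, v) \<in> conn_rel H Y" using conn_rel_verts[OF that] by simp
    moreover have "u \<notin> A" if "(u, v) \<in> conn_rel K W" using conn_rel_verts[OF that] by simp
    ultimately have "v \<in> ?S"
      using uv closed_under_conn_rel[of u v H Y "?S \<inter> A"] closed_under_conn_rel[of u v K W "?S - A"] by auto
    then show "(u, v) \<in> conn_rel G (Y \<union> W)" by simp
  qed
  then show "p \<in> conn_rel G (Y \<union> W) \<longleftrightarrow> p \<in> conn_rel H Y \<union> conn_rel K W" using p by simp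
qed

lemma num_comps_union:
  assumes Y: "Y \<subseteq> {x \<in> edges G. ends G x \<subseteq> A}" and W: "W \<subseteq> {x \<in> edges G. ends G x \<subseteq> verts G - A}"
  shows "num_comps G (Y \<union> W) = num_comps H Y + num_comps K W"
proof -
  let ?R = "conn_rel G (Y \<union> W)"
  have R: "?R = conn_rel H Y \<union> conn_rel K W" by (rule conn_rel_union[OF assms])
  have H: "?R `` {u} = conn_rel H Y `` {u}" if "u \<in> A" for u
    using R that conn_rel_verts[of u _ K W] by auto
  have K: "?R `` {u} = conn_rel K W `` {u}" if "u \<in> verts G - A" for u
    using R that conn_rel_verts[of u _ H Y] by auto
  have "verts G = A \<union> (verts G - A)" using A by auto
  then have "verts G // ?R = A // ?R \<union> (verts G - A) // ?R" by (auto simp: quotient_def)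
  also have "\<dots> = A // conn_rel H Y \<union> (verts G - A) // conn_rel K W"
    unfolding quotient_def using H K by auto
  finally have q: "verts G // ?R = A // conn_rel H Y \<union> (verts G - A) // conn_rel K W" .
  have "C \<noteq> {} \<and> C \<subseteq> A" if "C \<in> A // conn_rel H Y" for C
    using that in_quotient_imp_non_empty[OF equiv_conn_rel[of H Y]]
      in_quotient_imp_subset[OF equiv_conn_rel[of H Y]] by auto
  moreover have "C \<subseteq> verts G - A" if "C \<in> (verts G - A) // conn_rel K W" for C
    using that in_quotient_imp_subset[OF equiv_conn_rel[of K W]] by auto
  ultimately have "A // conn_rel H Y \<inter> (verts G - A) // conn_rel K W = {}" by blast
  moreover have "finite A" "finite (verts G - A)" using D(2) A finite_subset by auto
  ultimately show ?thesis
    unfolding num_comps_def q by (subst card_Un_disjoint) (auto simp: quotient_def)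
qed

text \<open>The cut edges are the only connection between the sides.  Hence \<open>f\<close> closes a cycle with
\<open>Y \<union> W \<union> {e}\<close> exactly if \<open>a\<close> and \<open>b\<close> are joined within \<open>A\<close> and \<open>a'\<close> and \<open>b'\<close> within the
other side.\<close>
lemma conn_cut_edges:
  assumes Y: "Y \<subseteq> {x \<in> edges G. ends G x \<subseteq> A}" and W: "W \<subseteq> {x \<in> edges G. ends G x \<subseteq> verts G - A}"
  shows "(a, a') \<notin> conn_rel G (Y \<union> W)" "(b, b') \<notin> conn_rel G (Y \<union> W)"
    "(b, b') \<in> conn_rel G (insert e (Y \<union> W)) \<longleftrightarrow> (a, b) \<in> conn_rel H Y \<and> (a', b') \<in> conn_rel K W"
proof -
  let ?R = "conn_rel G (insert e (Y \<union> W))"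
  have R: "conn_rel G (Y \<union> W) = conn_rel H Y \<union> conn_rel K W" by (rule conn_rel_union[OF assms])
  have subs: "Y \<union> W \<subseteq> edges G" using Y W by auto
  show n: "(a, a') \<notin> conn_rel G (Y \<union> W)" "(b, b') \<notin> conn_rel G (Y \<union> W)"
    unfolding R using conn_rel_verts[of _ _ H Y] conn_rel_verts[of _ _ K W] in_A out_A by auto
  have sub: "conn_rel G (Y \<union> W) \<subseteq> ?R" by (intro conn_rel_mono) auto
  show "(b, b') \<in> ?R \<longleftrightarrow> (a, b) \<in> conn_rel H Y \<and> (a', b') \<in> conn_rel K W"
  proof
    assume bb: "(b, b') \<in> ?R"
    have bS: "b \<in> verts G" "a' \<in> verts G" using in_A A verts_ab by auto
    have 1: "(b, a) \<in> conn_rel G (Y \<union> W)"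
    proof (rule ccontr)
      assume ba: "(b, a) \<notin> conn_rel G (Y \<union> W)"
      let ?S = "conn_rel G (Y \<union> W) `` {b}"
      have "?S \<subseteq> A" unfolding R using conn_rel_verts[of b _ H Y] conn_rel_verts[of b _ K W] in_A by auto
      then have "closed_under G (insert e (Y \<union> W)) ?S"
        using closed_under_component[OF D(1) subs, of b] ends_e ba out_A by (auto simp: closed_under_def)
      from closed_under_conn_rel[OF bb this] have "b' \<in> ?S" using conn_rel_refl[OF bS(1)] by simp
      then show False using n by simp
    qed
    have 2: "(b', a') \<in> conn_rel G (Y \<union> W)"
    proof (rule ccontr)
      assume ba: "(b', a') \<notin> conn_rel G (Y \<union> W)"
      let ?S = "conn_rel G (Y \<union> W) `` {b'}"
      have "?S \<inter> A = {}" unfolding R using conn_rel_verts[of b' _ H Y] conn_rel_verts[of b' _ K W] out_A by auto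
      then have "closed_under G (insert e (Y \<union> W)) ?S"
        using closed_under_component[OF D(1) subs, of b'] ends_e ba in_A by (auto simp: closed_under_def)
      from closed_under_conn_rel[OF conn_rel_sym[OF bb] this] have "b \<in> ?S"
        using conn_rel_refl[OF verts_ab(2)] by simp
      then show False using n conn_rel_sym[of b' b G "Y \<union> W"] by auto
    qed
    show "(a, b) \<in> conn_rel H Y \<and> (a', b') \<in> conn_rel K W"
      using conn_rel_sym[OF 1] conn_rel_sym[OF 2] unfolding R
      using conn_rel_verts[of _ _ H Y] conn_rel_verts[of _ _ K W] in_A out_A by auto
  next
    assume *: "(a, b) \<in> conn_rel H Y \<and> (a', b') \<in> conn_rel K W"
    have "(a, b) \<in> ?R" using * sub R by auto
    then have "(b, a) \<in> ?R" by (rule conn_rel_sym)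
    moreover have "(a, a') \<in> ?R" using ends_e in_A A verts_ab by (intro conn_rel_edge[of e]) auto
    moreover have "(a', b') \<in> ?R" using * sub R by auto
    ultimately show "(b, b') \<in> ?R" by (meson conn_rel_trans)
  qed
qed

text \<open>The sum over the edge sets of the side that connect the two ends of the cut edges.  The flow
polynomial of the closed side is this sum times \<open>1 - t\<close>, and that of \<open>G\<close> is the product of the sums
for both sides times \<open>t - 1\<close>, up to the common factors above.\<close>
definition side_sum :: "int poly" where
  "side_sum = (\<Sum>Y \<in> Pow {x \<in> edges G. ends G x \<subseteq> A}. if (a, b) \<in> conn_rel H Y then subset_weight H Y else 0)"

lemma sum_subset_weight_side:
  "(\<Sum>Z\<in>Pow (edges H). subset_weight H Z) = (1 - [:0, 1:]) * side_sum"
proof -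
  let ?I = "{x \<in> edges G. ends G x \<subseteq> A}" and ?x = "[:0, 1:] :: int poly"
  have I: "finite ?I" "e \<notin> ?I" using D(3) inner_not_ef by auto
  have "subset_weight H Y + subset_weight H (insert e Y) = (1 - ?x) * (if (a, b) \<in> conn_rel H Y then subset_weight H Y else 0)"
    if Y: "Y \<in> Pow ?I" for Y
  proof -
    have "finite Y" "e \<notin> Y" using Y I finite_subset by auto
    then have c: "card (insert e Y) = Suc (card Y)" by simp
    have "num_comps H Y = num_comps H (insert e Y) + (if (a, b) \<in> conn_rel H Y then 0 else 1)"
      by (rule num_comps_insert[OF fin_H]) (use Y in auto)
    then show ?thesis unfolding subset_weight_def c by (auto simp: algebra_simps)
  qed
  then show ?thesis
    unfolding side_sum_def sum_distrib_left close_off_simps(2) sum_Pow_insert[OF I] by (intro sum.cong) auto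
qed

text \<open>Group the edge sets by their traces \<open>Y\<close> and \<open>W\<close> on the two sides.  Of the four ways to add cut
edges, the contributions cancel unless both traces connect the ends of the cut edges, and then they
add up to \<open>t - 1\<close> times the product of the weights of \<open>Y\<close> and \<open>W\<close>.\<close>
theorem flow_poly_two_edge_cut: "flow_poly G * [:- 1, 1:] = flow_poly H * flow_poly K"
proof -
  interpret c: two_edge_cut G "verts G - A" e f a' b' a b by (rule complement)
  let ?I = "{x \<in> edges G. ends G x \<subseteq> A}" and ?J = "{x \<in> edges G. ends G x \<subseteq> verts G - A}"
    and ?x = "[:0, 1:] :: int poly"
  have "ends G x \<noteq> {}" if "x \<in> edges G" for x using D(6)[OF that] by auto
  then have fin: "finite ?I" "finite ?J" "finite (?I \<union> ?J)" "?I \<inter> ?J = {}"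
    using D(3) by auto
  have nef: "e \<notin> ?I \<union> ?J" "f \<notin> insert e (?I \<union> ?J)" using inner_not_ef c.inner_not_ef ef by auto
  have cK: "c.side_sum = (\<Sum>W \<in> Pow ?J. if (a', b') \<in> conn_rel K W then subset_weight K W else 0)"
    by (simp add: c.side_sum_def)
  have key: "subset_weight G (Y \<union> W) + subset_weight G (insert e (Y \<union> W)) +
       (subset_weight G (insert f (Y \<union> W)) + subset_weight G (insert f (insert e (Y \<union> W)))) =
     (?x - 1) * ((if (a, b) \<in> conn_rel H Y then subset_weight H Y else 0) *
       (if (a', b') \<in> conn_rel K W then subset_weight K W else 0))"
    if Y: "Y \<in> Pow ?I" and W: "W \<in> Pow ?J" for Y W
  proof -
    have YW: "Y \<subseteq> ?I" "W \<subseteq> ?J" using Y W by auto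
    let ?Z = "Y \<union> W"
    have fZ: "finite Y" "finite W"
      using finite_subset[OF YW(1) fin(1)] finite_subset[OF YW(2) fin(2)] by auto
    moreover have "Y \<inter> W = {}" using Int_mono[OF YW] fin(4) by simp
    moreover have "e \<notin> ?Z" "f \<notin> ?Z" using subsetD[OF Un_mono[OF YW]] nef by auto
    ultimately    have cards: "card ?Z = card Y + card W" "card (insert e ?Z) = Suc (card Y + card W)"
      "card (insert f ?Z) = Suc (card Y + card W)" "card (insert f (insert e ?Z)) = Suc (Suc (card Y + card W))"
      using ef by (auto simp: card_Un_disjoint)
    have Z: "insert f (insert e ?Z) \<subseteq> edges G" using YW edges_ef by auto
    have 0: "num_comps G ?Z = num_comps H Y + num_comps K W" by (rule num_comps_union[OF YW])
    have 1: "num_comps G ?Z = num_comps G (insert e ?Z) + 1"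
      using num_comps_insert[OF D(1) _ ends_e, of ?Z] conn_cut_edges(1)[OF YW] Z by auto
    have 2: "num_comps G ?Z = num_comps G (insert f ?Z) + 1"
      using num_comps_insert[OF D(1) _ ends_f, of ?Z] conn_cut_edges(2)[OF YW] Z by auto
    have 3: "num_comps G (insert e ?Z) = num_comps G (insert f (insert e ?Z)) +
        (if (a, b) \<in> conn_rel H Y \<and> (a', b') \<in> conn_rel K W then 0 else 1)"
      using num_comps_insert[OF D(1) _ ends_f, of "insert e ?Z"] conn_cut_edges(3)[OF YW] Z by auto
    have prod: "subset_weight G ?Z = subset_weight H Y * subset_weight K W"
      unfolding subset_weight_def 0 cards power_add by (simp only: mult_ac)
    have e0: "subset_weight G (insert e ?Z) = - subset_weight G ?Z"
      unfolding subset_weight_def cards 1 by (simp add: mult_ac)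
    have f0: "subset_weight G (insert f ?Z) = - subset_weight G ?Z"
      unfolding subset_weight_def cards 2 by (simp add: mult_ac)
    show ?thesis
    proof (cases "(a, b) \<in> conn_rel H Y \<and> (a', b') \<in> conn_rel K W")
      case True
      then have "num_comps G (insert f (insert e ?Z)) = num_comps G (insert e ?Z)" using 3 by simp
      then have "subset_weight G (insert f (insert e ?Z)) = - ?x * subset_weight G (insert e ?Z)"
        unfolding subset_weight_def cards by (simp only: power_Suc mult.assoc)
      then show ?thesis using True e0 f0 prod by (simp add: algebra_simps)
    next
      case False
      then have "num_comps G (insert e ?Z) = Suc (num_comps G (insert f (insert e ?Z)))" using 3 by simp
      then have "subset_weight G (insert f (insert e ?Z)) = - subset_weight G (insert e ?Z)"
        unfolding subset_weight_def cards by (simp add: mult_ac)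
      then show ?thesis using False e0 f0 by auto
    qed
  qed
  have edges: "edges G = insert f (insert e (?I \<union> ?J))" using edges_split by auto
  have "(\<Sum>Z\<in>Pow (edges G). subset_weight G Z) = (?x - 1) * (side_sum * c.side_sum)"
  proof -
    have "(\<Sum>Z\<in>Pow (edges G). subset_weight G Z) =
        (\<Sum>Z\<in>Pow (insert f (insert e (?I \<union> ?J))). subset_weight G Z)"
      by (rule arg_cong[OF edges, of "\<lambda>E. sum (subset_weight G) (Pow E)"])
    also have "\<dots> = (\<Sum>Y\<in>Pow ?I. \<Sum>W\<in>Pow ?J.
        subset_weight G (Y \<union> W) + subset_weight G (insert e (Y \<union> W)) +
       (subset_weight G (insert f (Y \<union> W)) + subset_weight G (insert f (insert e (Y \<union> W)))))"
      using fin nef by (simp add: sum_Pow_insert sum_Pow_Un sum.distrib)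
    also have "\<dots> = (\<Sum>Y\<in>Pow ?I. \<Sum>W\<in>Pow ?J.
        (?x - 1) * ((if (a, b) \<in> conn_rel H Y then subset_weight H Y else 0) *
       (if (a', b') \<in> conn_rel K W then subset_weight K W else 0)))"
      by (intro sum.cong refl key)
    also have "\<dots> = (?x - 1) * (side_sum * c.side_sum)"
      unfolding side_sum_def cK sum_product by (simp only: sum_distrib_left)
    finally show ?thesis .
  qed
  then have eq: "(?x - 1) * (\<Sum>Z\<in>Pow (edges G). subset_weight G Z) =
      (\<Sum>Z\<in>Pow (edges H). subset_weight H Z) * (\<Sum>Z\<in>Pow (edges K). subset_weight K Z)"
    unfolding sum_subset_weight_side c.sum_subset_weight_side by (simp add: algebra_simps)
  have cE: "card (edges G) = card (edges H) + card (edges K)"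
    using arg_cong[OF edges, of card] fin nef by (simp add: card_Un_disjoint)
  have cV: "card (verts G) = card (verts H) + card (verts K)"
    using A D(2) card_mono[OF D(2) A] by (simp add: card_Diff_subset[OF finite_subset[OF A D(2)]])
  have x1: "?x - 1 = [:- 1, 1:]" by (simp add: one_pCons)
  \<comment> \<open>The common factor of the weights of \<open>G\<close>; it is the product of those of the two sides.\<close>
  define u where "u = (- 1 :: int poly) ^ card (edges G) * ?x ^ card (verts G)"
  have "u * ([:- 1, 1:] * flow_poly G) = u * (flow_poly H * flow_poly K)"
    using eq unfolding flow_poly_subset_weight[OF D(1), symmetric] flow_poly_subset_weight[OF fin_H, symmetric]
      flow_poly_subset_weight[OF c.fin_H, symmetric] x1 u_def cE cV power_add
    by (simp only: mult_ac)
  moreover have "u \<noteq> 0" by (simp add: u_def)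
  ultimately show ?thesis by (simp only: mult_cancel_left mult.commute) simp
qed

lemma psum_two_edge_cut:
  "psum1 (flow_poly G) + 1 = psum1 (flow_poly H) + psum1 (flow_poly K)"
  "psum2 (flow_poly G) + 1 = psum2 (flow_poly H) + psum2 (flow_poly K)"
proof -
  interpret c: two_edge_cut G "verts G - A" e f a' b' a b by (rule complement)
  have mon: "lead_coeff (flow_poly X) = 1" if "bridgeless_cubic X" for X :: "('v, 'e) mgraph"
    using bridgeless_cubic_counts[OF that] flow_poly_monic(2)[OF that] by metis
  note m = mon[OF cubic] mon[OF cubic_H] mon[OF c.cubic_H]
  have l: "lead_coeff [:- 1, 1 :: int:] = 1" by simp
  show "psum1 (flow_poly G) + 1 = psum1 (flow_poly H) + psum1 (flow_poly K)"
    using psum_mult(1)[OF m(1) l] psum_mult(1)[OF m(2,3)] flow_poly_two_edge_cut psum_linear(1)[of "1 :: int"]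
    by simp
  show "psum2 (flow_poly G) + 1 = psum2 (flow_poly H) + psum2 (flow_poly K)"
    using psum_mult(2)[OF m(1) l] psum_mult(2)[OF m(2,3)] flow_poly_two_edge_cut psum_linear(2)[of "1 :: int"]
    by simp
qed

end

section \<open>The power sum inequality\<close>

lemma two_edge_cut_exists:
  assumes G: "bridgeless_cubic G" and "\<not> edge_connected 3 G"
  obtains A e f a b a' b' where "two_edge_cut G A e f a b a' b'"
proof -
  note D = bridgeless_cubicD[OF G]
  obtain S where S: "S \<subseteq> verts G" "S \<noteq> {}" "S \<noteq> verts G" "\<not> 3 \<le> card (edge_cut G S)"
    using assms(2) D(4) by (auto simp: edge_connected_def)
  then have "card (edge_cut G S) = 2" using edge_connectedD[OF D(8) S(1-3)] by linarith
  then obtain e f where ef: "edge_cut G S = {e, f}" "e \<noteq> f" by (auto simp: card_2_iff)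
  have ends: "\<exists>a a'. ends G x = {a, a'} \<and> a \<in> S \<and> a' \<notin> S" if x: "x \<in> {e, f}" for x
  proof -
    have x': "x \<in> edges G" "ends G x \<inter> S \<noteq> {}" "\<not> ends G x \<subseteq> S"
      using x ef(1) unfolding edge_cut_def by auto
    obtain u v where uv: "ends G x = {u, v}" using D(6)[OF x'(1)] by (auto simp: card_2_iff)
    show ?thesis
    proof (cases "u \<in> S")
      case True then show ?thesis using uv x' by (intro exI[of _ u] exI[of _ v]) auto
    next
      case False then show ?thesis using uv x' by (intro exI[of _ v] exI[of _ u]) auto
    qed
  qed
  obtain a a' where 1: "ends G e = {a, a'}" "a \<in> S" "a' \<notin> S" using ends[of e] by auto
  obtain b b' where 2: "ends G f = {b, b'}" "b \<in> S" "b' \<notin> S" using ends[of f] by auto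
  have "two_edge_cut G S e f a b a' b'"
    by unfold_locales (use G S ef 1 2 in auto)
  then show thesis by (rule that)
qed

context two_edge_cut
begin

lemma card_sides:
  "card A + card (verts G - A) = card (verts G)" "card A < card (verts G)" "card (verts G - A) < card (verts G)"
proof -
  have fA: "finite A" using finite_subset[OF A D(2)] .
  show s: "card A + card (verts G - A) = card (verts G)"
    using card_mono[OF D(2) A] by (simp add: card_Diff_subset[OF fA A])
  have "0 < card A" "0 < card (verts G - A)"
    using in_A out_A verts_ab fA D(2) by (auto simp: card_gt_0_iff)
  then show "card A < card (verts G)" "card (verts G - A) < card (verts G)" using s by linarith+
qed

lemma inj_on_ends_side:
  assumes "inj_on (ends G) {x \<in> edges G. ends G x \<subseteq> A}"
  shows "inj_on (ends H) (edges H - {e})"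
  using assms by (auto simp: inj_on_def)

text \<open>By the handshake lemma a side is of even size, and a side of size 2 would contain two parallel
edges.\<close>
lemma card_side_ge_4:
  assumes inj: "inj_on (ends G) {x \<in> edges G. ends G x \<subseteq> A}"
  shows "4 \<le> card A"
proof (rule ccontr)
  let ?I = "{x \<in> edges G. ends G x \<subseteq> A}"
  assume "\<not> 4 \<le> card A"
  have h: "3 * card A = 2 * card ?I + 2" using handshake[OF cubic A] cut ef by simp
  have "even (card A)" using h by presburger
  moreover have "0 < card A" using in_A finite_subset[OF A D(2)] by (auto simp: card_gt_0_iff)
  moreover have "card A < 4" using \<open>\<not> 4 \<le> card A\<close> by simp
  ultimately have cA: "card A = 2" by presburger
  then have "card ?I = 2" using h by simp
  then obtain x y where xy: "?I = {x, y}" "x \<noteq> y" by (auto simp: card_2_iff)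
  have "ends G z = A" if z: "z \<in> ?I" for z
    using z D(6)[of z] cA finite_subset[OF A D(2)] by (intro card_subset_eq) auto
  then have "ends G x = ends G y" using xy(1) by auto
  then show False using inj xy by (auto simp: inj_on_def)
qed

end

text \<open>At a two-edge cut the sums of \<open>psum1\<close> and of \<open>psum2\<close> over the two sides exceed the values
for \<open>G\<close> by 1 each, and the constants combine to \<open>4 + 4 + 1 - 5 = 4\<close>.\<close>
theorem psum_bound:
  assumes "bridgeless_cubic G" and "card (verts G) = 2 * k"
  shows "psum2 (flow_poly G) + 6 * int k + 4 \<le> 5 * psum1 (flow_poly G)"
  using assms
proof (induction "card (verts G)" arbitrary: G k rule: less_induct)
  case less
  show ?case
  proof (cases "edge_connected 3 G")
    case True
    then show ?thesis using psum_bound_three_connected less.prems by blast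
  next
    case False
    then obtain A e f a b a' b' where cut: "two_edge_cut G A e f a b a' b'"
      using two_edge_cut_exists[OF less.prems(1)] by metis
    interpret two_edge_cut G A e f a b a' b' by (rule cut)
    interpret c: two_edge_cut G "verts G - A" e f a' b' a b by (rule complement)
    obtain i where i: "card A = 2 * i" using bridgeless_cubic_counts[OF cubic_H] by auto
    obtain j where j: "card (verts G - A) = 2 * j" using bridgeless_cubic_counts[OF c.cubic_H] by auto
    have "psum2 (flow_poly H) + 6 * int i + 4 \<le> 5 * psum1 (flow_poly H)"
      by (rule less.hyps[OF _ cubic_H]) (use card_sides i in auto)
    moreover have "psum2 (flow_poly K) + 6 * int j + 4 \<le> 5 * psum1 (flow_poly K)"
      by (rule less.hyps[OF _ c.cubic_H]) (use card_sides j in auto)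
    moreover have "k = i + j" using card_sides(1) less.prems(2) i j by simp
    ultimately show ?thesis using psum_two_edge_cut by simp
  qed
qed

section \<open>Half ladders and the minimum of the first power sum\<close>

definition half_verts :: "nat \<Rightarrow> gstar_vertex set" where
  "half_verts i = {Vp, Vq} \<union> Va ` {0..i} \<union> Vb ` {0..i}"

definition half_edges :: "nat \<Rightarrow> gstar_vertex set set" where
  "half_edges i = {{Vp, Vq}, {Va 0, Vp}, {Va 0, Vq}, {Vb 0, Vp}, {Vb 0, Vq}} \<union>
     (\<lambda>l. {Va l, Va (l + 1)}) ` {..<i} \<union> (\<lambda>l. {Vb l, Vb (l + 1)}) ` {..<i} \<union> (\<lambda>l. {Va l, Vb l}) ` {1..i}"

text \<open>The graph without the marked edge \<open>h\<close> is one end of the extremal graph, cut off after position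
\<open>i\<close>, and \<open>h\<close> joins the two vertices at that position.  For \<open>i > 0\<close> the mark is therefore parallel to the
last rung, and for \<open>i = 0\<close> the graph is \<open>K\<^sub>4\<close>.\<close>
definition half_ladder :: "('v, 'e) mgraph \<Rightarrow> 'e \<Rightarrow> nat \<Rightarrow> ('v \<Rightarrow> gstar_vertex) \<Rightarrow> bool" where
  "half_ladder G h i \<phi> \<longleftrightarrow> inj_on \<phi> (verts G) \<and> \<phi> ` verts G = half_verts i \<and>
     (\<lambda>x. \<phi> ` ends G x) ` (edges G - {h}) = half_edges i \<and>
     h \<in> edges G \<and> \<phi> ` ends G h = {Va i, Vb i}"

lemma half_verts_Suc: "half_verts (Suc i) = half_verts i \<union> {Va (Suc i), Vb (Suc i)}"
  by (auto simp: half_verts_def atLeastAtMostSuc_conv)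

lemma half_edges_Suc:
  "half_edges (Suc i) =
     half_edges i \<union> {{Va i, Va (Suc i)}, {Vb i, Vb (Suc i)}, {Va (Suc i), Vb (Suc i)}}"
  by (auto simp: half_edges_def lessThan_Suc atLeastAtMostSuc_conv)

lemma half_edges_subset: "S \<in> half_edges i \<Longrightarrow> S \<subseteq> half_verts i \<and> S \<noteq> {}"
  by (auto simp: half_edges_def half_verts_def)

lemma half_edges_last: "{Va i, Vb i} \<in> half_edges i \<longleftrightarrow> i \<noteq> 0"
  by (cases i) (auto simp: half_edges_def doubleton_eq_iff)

lemma card_half_verts: "card (half_verts i) = 2 * i + 4"
proof -
  have inj: "inj_on Va X" "inj_on Vb X" for X by (auto simp: inj_on_def)
  have "half_verts i = ({Vp, Vq} \<union> Va ` {0..i}) \<union> Vb ` {0..i}" by (simp add: half_verts_def)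
  also have "card \<dots> = card ({Vp, Vq} \<union> Va ` {0..i}) + card (Vb ` {0..i})"
    by (rule card_Un_disjoint) auto
  also have "card ({Vp, Vq} \<union> Va ` {0..i}) = card {Vp, Vq} + card (Va ` {0..i})"
    by (rule card_Un_disjoint) auto
  finally show ?thesis by (simp add: card_image[OF inj(1)] card_image[OF inj(2)])
qed

fun swap_sides :: "gstar_vertex \<Rightarrow> gstar_vertex" where
  "swap_sides (Va i) = Vb i"
| "swap_sides (Vb i) = Va i"
| "swap_sides v = v"

lemma inj_swap_sides: "inj swap_sides"
proof (rule injI)
  fix x y assume "swap_sides x = swap_sides y" then show "x = y" by (cases x; cases y) auto
qed

lemma swap_sides_half: "swap_sides ` half_verts i = half_verts i" "(`) swap_sides ` half_edges i = half_edges i"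
  by (auto simp: half_verts_def half_edges_def image_Un image_image insert_commute)

lemma half_ladder_swap_sides:
  assumes "half_ladder G h i \<phi>"
  shows "half_ladder G h i (swap_sides \<circ> \<phi>)"
proof -
  have "(\<lambda>x. (swap_sides \<circ> \<phi>) ` ends G x) ` (edges G - {h}) =
      (`) swap_sides ` (\<lambda>x. \<phi> ` ends G x) ` (edges G - {h})"
    by (simp add: image_image image_comp)
  then have "(\<lambda>x. (swap_sides \<circ> \<phi>) ` ends G x) ` (edges G - {h}) = (`) swap_sides ` half_edges i"
    using assms by (simp add: half_ladder_def)
  moreover have "(swap_sides \<circ> \<phi>) ` verts G = swap_sides ` half_verts i"
    "(swap_sides \<circ> \<phi>) ` ends G h = swap_sides ` {Va i, Vb i}"
    using assms by (simp_all only: half_ladder_def image_comp[symmetric])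
  moreover have "inj_on (swap_sides \<circ> \<phi>) (verts G)"
    using assms by (auto simp: half_ladder_def intro: comp_inj_on inj_on_subset[OF inj_swap_sides])
  ultimately show ?thesis
    using assms by (simp add: half_ladder_def swap_sides_half insert_commute)
qed

text \<open>The reflection of the ladder allows the label of one end of the marked edge to be prescribed, so
that later constructions do not split into a straight and a crossed case.\<close>
lemma half_ladder_oriented:
  assumes "half_ladder G h i \<phi>" "ends G h = {a, b}"
  obtains \<psi> where "half_ladder G h i \<psi>" "\<psi> a = Va i" "\<psi> b = Vb i"
proof -
  have "{\<phi> a, \<phi> b} = {Va i, Vb i}" using assms by (auto simp: half_ladder_def)
  then consider "\<phi> a = Va i" "\<phi> b = Vb i" | "\<phi> a = Vb i" "\<phi> b = Va i" by (auto simp: doubleton_eq_iff)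
  then show thesis
  proof cases
    case 1 then show thesis using that assms(1) by blast
  next
    case 2 then show thesis using that[OF half_ladder_swap_sides[OF assms(1)]] by simp
  qed
qed

lemma doubleton_other:
  assumes "card S = 2" "u \<in> S"
  obtains a where "S = {a, u}"
proof -
  obtain x y where "S = {x, y}" using assms(1) by (auto simp: card_2_iff)
  then show thesis using assms(2) that[of x] that[of y] by (auto simp: insert_commute)
qed

text \<open>A pair of parallel edges splits off a graph with two vertices and three parallel edges.\<close>
lemma parallel_edges_two_edge_cut:
  assumes G: "bridgeless_cubic G" and h: "h \<in> edges G" "h' \<in> edges G" "h \<noteq> h'"
    "ends G h = {u, v}" "ends G h' = {u, v}" and n: "card (verts G) \<noteq> 2"
  obtains e f a b where "two_edge_cut G (verts G - {u, v}) e f a b u v"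
    "{x \<in> edges G. ends G x \<subseteq> {u, v}} = {h, h'}"
proof -
  note D = bridgeless_cubicD[OF G]
  have uv: "u \<noteq> v" "u \<in> verts G" "v \<in> verts G" using D(5,6)[OF h(1)] h(4) by auto
  have third: "\<exists>x. {y \<in> edges G. w \<in> ends G y} = {h, h', x} \<and> x \<notin> {h, h'}" if w: "w \<in> {u, v}" for w
  proof -
    have c: "card {y \<in> edges G. w \<in> ends G y} = 3" using D(7) uv w by auto
    have sub: "{h, h'} \<subseteq> {y \<in> edges G. w \<in> ends G y}" using h w by auto
    have "card ({y \<in> edges G. w \<in> ends G y} - {h, h'}) = 1"
      using c sub h(3) by (subst card_Diff_subset) auto
    then obtain x where "{y \<in> edges G. w \<in> ends G y} - {h, h'} = {x}" by (auto simp: card_1_singleton_iff)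
    then show ?thesis using sub by (intro exI[of _ x]) blast
  qed
  obtain e where e: "{y \<in> edges G. u \<in> ends G y} = {h, h', e}" "e \<notin> {h, h'}" using third[of u] by auto
  obtain f where f: "{y \<in> edges G. v \<in> ends G y} = {h, h', f}" "f \<notin> {h, h'}" using third[of v] by auto
  have ef: "e \<in> edges G" "u \<in> ends G e" "f \<in> edges G" "v \<in> ends G f" using e(1) f(1) by auto
  have sub_cut: "edge_cut G {u, v} \<subseteq> {e, f}"
  proof
    fix x assume x: "x \<in> edge_cut G {u, v}"
    then have "x \<in> edges G" "u \<in> ends G x \<or> v \<in> ends G x" "x \<noteq> h" "x \<noteq> h'"
      using h(4,5) by (auto simp: edge_cut_def)
    then show "x \<in> {e, f}" using e(1) f(1) by auto
  qed
  have "{u, v} \<noteq> verts G" using n uv(1) by (metis card_2_iff)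
  then have ge2: "2 \<le> card (edge_cut G {u, v})" using uv by (intro edge_connectedD[OF D(8)]) auto
  have "card (edge_cut G {u, v}) \<le> card {e, f}" using sub_cut by (intro card_mono) auto
  then have "e \<noteq> f" using ge2 by auto
  have cut: "edge_cut G {u, v} = {e, f}"
    using sub_cut ge2 \<open>e \<noteq> f\<close> by (intro card_seteq) auto
  have "v \<notin> ends G e" "u \<notin> ends G f"
    using e f ef \<open>e \<noteq> f\<close> by auto
  obtain a where a: "ends G e = {a, u}" using D(6)[OF ef(1)] ef(2) by (rule doubleton_other)
  obtain b where b: "ends G f = {b, v}" using D(6)[OF ef(3)] ef(4) by (rule doubleton_other)
  have ab: "a \<noteq> u" "b \<noteq> v" "a \<in> verts G" "b \<in> verts G"
    using D(5,6)[OF ef(1)] D(5,6)[OF ef(3)] a b by auto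
  have "two_edge_cut G (verts G - {u, v}) e f a b u v"
    by unfold_locales
      (use G cut \<open>e \<noteq> f\<close> a b ab \<open>v \<notin> ends G e\<close> \<open>u \<notin> ends G f\<close> edge_cut_complement[OF D(1)] in auto)
  moreover have "{x \<in> edges G. ends G x \<subseteq> {u, v}} = {h, h'}"
  proof -
    have "x \<in> {h, h'}" if x: "x \<in> edges G" "ends G x \<subseteq> {u, v}" for x
    proof -
      obtain w where "w \<in> ends G x" using D(6)[OF x(1)] by fastforce
      then have "x \<in> {h, h', e, f}" using x e(1) f(1) by auto
      then show ?thesis using x a b ab \<open>v \<notin> ends G e\<close> \<open>u \<notin> ends G f\<close> by auto
    qed
    then show ?thesis using h by auto
  qed
  ultimately show thesis by (rule that)
qed

text \<open>Two vertices joined by three parallel edges; the flow polynomial is \<open>(t - 1) (t - 2)\<close>.\<close>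
lemma psum1_theta:
  assumes G: "bridgeless_cubic G" and n: "card (verts G) = 2"
  shows "psum1 (flow_poly G) = 3"
proof -
  note D = bridgeless_cubicD[OF G]
  have "card (edges G) = 3" using n by (auto intro: bridgeless_cubic_counts[OF G])
  moreover have "edge_connected 3 G"
    unfolding edge_connected_def
  proof (intro conjI D(4) allI impI)
    fix S assume S: "S \<subseteq> verts G \<and> S \<noteq> {} \<and> S \<noteq> verts G"
    then have "card S < 2" "card S \<noteq> 0"
      using psubset_card_mono[OF D(2), of S] n finite_subset[OF _ D(2), of S] by auto
    then have cS: "card S = 1" by linarith
    have "finite S" using cS by (simp add: card_ge_0_finite)
    then have "\<not> ends G x \<subseteq> S" if "x \<in> edges G" for x
      using card_mono[of S "ends G x"] D(6)[OF that] cS by auto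
    then have "{x \<in> edges G. ends G x \<subseteq> S} = {}" by auto
    then have "card {x \<in> edges G. ends G x \<subseteq> S} = 0" by (simp only: card.empty)
    then show "3 \<le> card (edge_cut G S)" using handshake[OF G, of S] S cS by simp
  qed
  ultimately show ?thesis using psum_three_connected(1)[OF G] by simp
qed

lemma simple_4_three_connected:
  assumes G: "bridgeless_cubic G" and n: "card (verts G) = 4" and inj: "inj_on (ends G) (edges G)"
  shows "edge_connected 3 G"
proof (rule ccontr)
  assume "\<not> edge_connected 3 G"
  then obtain A e f a b a' b' where cut: "two_edge_cut G A e f a b a' b'"
    using two_edge_cut_exists[OF G] by metis
  interpret two_edge_cut G A e f a b a' b' by (rule cut)
  have "4 \<le> card A" by (rule card_side_ge_4) (rule inj_on_subset[OF inj], auto)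
  then show False using card_sides n by linarith
qed

lemma psum1_simple_4:
  assumes G: "bridgeless_cubic G" and n: "card (verts G) = 4" and inj: "inj_on (ends G) (edges G)"
  shows "psum1 (flow_poly G) = 6"
proof -
  have "card (edges G) = 6" using n by (auto intro: bridgeless_cubic_counts[OF G])
  then show ?thesis using psum_three_connected(1)[OF G simple_4_three_connected[OF assms]] by simp
qed

text \<open>A simple cubic graph on four vertices has all six pairs as edges.\<close>
lemma half_ladder_K4:
  assumes G: "bridgeless_cubic G" and n: "card (verts G) = 4" and inj: "inj_on (ends G) (edges G)"
    and h: "h \<in> edges G"
  shows "\<exists>\<phi>. half_ladder G h 0 \<phi>"
proof -
  note D = bridgeless_cubicD[OF G]
  obtain a b where ab: "ends G h = {a, b}" "a \<noteq> b" using D(6)[OF h] by (auto simp: card_2_iff)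
  have abV: "a \<in> verts G" "b \<in> verts G" using D(5)[OF h] ab by auto
  have "card (verts G - {a, b}) = 2" using n ab abV by (subst card_Diff_subset) auto
  then obtain p q where pq: "verts G - {a, b} = {p, q}" "p \<noteq> q" by (auto simp: card_2_iff)
  have V: "verts G = {a, b, p, q}" using pq abV by auto
  have ne: "a \<noteq> p" "a \<noteq> q" "b \<noteq> p" "b \<noteq> q" using pq by auto
  let ?P = "{{a, b}, {a, p}, {a, q}, {b, p}, {b, q}, {p, q}}"
  have "ends G ` edges G \<subseteq> ?P"
  proof
    fix S assume "S \<in> ends G ` edges G"
    then have S: "S \<subseteq> {a, b, p, q}" "card S = 2" using D(5,6) V by auto
    then obtain x y where "S = {x, y}" "x \<noteq> y" by (auto simp: card_2_iff)
    with S(1) show "S \<in> ?P" by auto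
  qed
  moreover have "card (ends G ` edges G) = 6"
    using card_image[OF inj] n by (auto intro: bridgeless_cubic_counts[OF G])
  moreover have "card ?P \<le> 6" by (intro card_insert_le_m1) auto
  ultimately have "ends G ` edges G = ?P" by (intro card_seteq) auto
  moreover have "ends G ` (edges G - {h}) = ends G ` edges G - {ends G h}"
    using inj h by (auto simp: inj_on_def)
  ultimately have E: "ends G ` (edges G - {h}) = {{a, p}, {a, q}, {b, p}, {b, q}, {p, q}}"
    using ab ne pq(2) by (auto simp: doubleton_eq_iff)
  define \<phi> where "\<phi> = (\<lambda>x. if x = a then Va 0 else if x = b then Vb 0 else if x = p then Vp else Vq)"
  have \<phi>: "\<phi> a = Va 0" "\<phi> b = Vb 0" "\<phi> p = Vp" "\<phi> q = Vq" using ab ne pq by (auto simp: \<phi>_def)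
  have "(\<lambda>x. \<phi> ` ends G x) ` (edges G - {h}) = (`) \<phi> ` ends G ` (edges G - {h})" by (simp add: image_image)
  also have "\<dots> = half_edges 0" unfolding E using \<phi> by (auto simp: half_edges_def)
  finally have "(\<lambda>x. \<phi> ` ends G x) ` (edges G - {h}) = half_edges 0" .
  moreover have "\<phi> ` verts G = half_verts 0" "inj_on \<phi> (verts G)" "\<phi> ` ends G h = {Va 0, Vb 0}"
    unfolding V ab using \<phi> by (auto simp: half_verts_def inj_on_def)
  ultimately show ?thesis using h by (auto simp: half_ladder_def)
qed

lemma half_ladder_add_rung:
  assumes cut: "two_edge_cut G A e f a b a' b'" and B: "verts G - A = {a', b'}"
    and hh: "{x \<in> edges G. ends G x \<subseteq> {a', b'}} = {h, h'}" "h \<noteq> h'"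
    and half: "half_ladder (close_off G A e a b) e i \<phi>" and \<phi>: "\<phi> a = Va i" "\<phi> b = Vb i"
  shows "half_ladder G h (Suc i) (\<phi>(a' := Va (Suc i), b' := Vb (Suc i)))"
proof -
  interpret two_edge_cut G A e f a b a' b' by (rule cut)
  interpret c: two_edge_cut G "verts G - A" e f a' b' a b by (rule complement)
  have ends_hh: "ends G x = {a', b'}" if x: "x \<in> {h, h'}" for x
  proof -
    have "x \<in> {x \<in> edges G. ends G x \<subseteq> {a', b'}}" using x hh(1) by simp
    then show ?thesis using D(6)[of x] c.a_neq_b by (intro card_subset_eq) auto
  qed
  have VA: "verts G = A \<union> {a', b'}" using B A by auto
  define \<psi> where "\<psi> = \<phi>(a' := Va (Suc i), b' := Vb (Suc i))"
  have \<psi>: "\<psi> a' = Va (Suc i)" "\<psi> b' = Vb (Suc i)" using c.a_neq_b by (auto simp: \<psi>_def)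
  have \<psi>A: "\<psi> x = \<phi> x" if "x \<in> A" for x using that out_A by (auto simp: \<psi>_def)
  have \<psi>i: "\<psi> ` S = \<phi> ` S" if S: "S \<subseteq> A" for S
    using S \<psi>A by (intro image_cong) auto
  let ?I = "{x \<in> edges G. ends G x \<subseteq> A}"
  have img: "\<phi> ` A = half_verts i" "inj_on \<phi> A" using half by (auto simp: half_ladder_def)
  have I: "edges H - {e} = ?I" using inner_not_ef by auto
  have "(\<lambda>x. \<phi> ` ends H x) ` ?I = half_edges i" using half unfolding half_ladder_def I by auto
  moreover have "(\<lambda>x. \<psi> ` ends G x) ` ?I = (\<lambda>x. \<phi> ` ends H x) ` ?I"
    by (rule image_cong) (use \<psi>i inner_not_ef in auto)
  ultimately have EI: "(\<lambda>x. \<psi> ` ends G x) ` ?I = half_edges i" by simp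
  have "edges G = ?I \<union> {h, h'} \<union> {e, f}" using edges_split hh(1) B by simp
  moreover have "h \<notin> ?I \<union> {e, f}" "h' \<noteq> h"
    using ends_hh[of h] out_A hh ends_e ends_f in_A by auto
  ultimately have "edges G - {h} = ?I \<union> {h', e, f}" by auto
  then have "(\<lambda>x. \<psi> ` ends G x) ` (edges G - {h}) =
      (\<lambda>x. \<psi> ` ends G x) ` ?I \<union> {\<psi> ` ends G h', \<psi> ` ends G e, \<psi> ` ends G f}"
    by (simp only: image_Un image_insert image_empty)
  also have "\<dots> = half_edges (Suc i)"
    unfolding EI half_edges_Suc ends_hh[of h', simplified] ends_e ends_f
    using \<psi> \<psi>A[OF in_A(1)] \<psi>A[OF in_A(2)] \<phi> by auto
  finally have 1: "(\<lambda>x. \<psi> ` ends G x) ` (edges G - {h}) = half_edges (Suc i)" .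
  have 2: "\<psi> ` verts G = half_verts (Suc i)"
    unfolding VA image_Un \<psi>i[OF order_refl] img half_verts_Suc using \<psi> by auto
  have "card A = 2 * i + 4" using card_image[OF img(2)] img(1) card_half_verts by simp
  moreover have "card (verts G) = card A + 2" using card_sides(1) B c.a_neq_b by simp
  ultimately have "card (\<psi> ` verts G) = card (verts G)" unfolding 2 card_half_verts by simp
  then have 3: "inj_on \<psi> (verts G)" using D(2) by (rule eq_card_imp_inj_on[rotated])
  have "h \<in> edges G" using hh by auto
  then show ?thesis using 1 2 3 ends_hh[of h] \<psi> by (auto simp: half_ladder_def \<psi>_def[symmetric])
qed

text \<open>Bound and equality case are one predicate because the induction needs both for smaller graphs.\<close>
definition marked_extremal :: "('v, 'e) mgraph \<Rightarrow> 'e \<Rightarrow> bool" where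
  "marked_extremal G h \<longleftrightarrow> int (card (verts G)) + 2 \<le> psum1 (flow_poly G) \<and>
     (psum1 (flow_poly G) = int (card (verts G)) + 2 \<longrightarrow> (\<exists>i \<phi>. half_ladder G h i \<phi>))"

text \<open>A three-edge-connected graph has \<open>psum1\<close> equal to \<open>3 n / 2\<close>, which exceeds
\<open>n + 3\<close> from \<open>n = 8\<close> on and equals it for \<open>n = 6\<close>.  Otherwise
the marked bound applies to both sides of a two-edge cut, and the values \<open>card + 2\<close> of the sides add
up to \<open>n + 3\<close> after the loss of 1.  The marked bound enters as a hypothesis because the two
statements are proved by one induction on the number of vertices.\<close>
lemma psum1_simple:
  assumes G: "bridgeless_cubic G" and inj: "inj_on (ends G) (edges G)" and n: "6 \<le> card (verts G)"
    and IH: "\<And>(G' :: ('v, 'e) mgraph) h. bridgeless_cubic G' \<Longrightarrow> h \<in> edges G' \<Longrightarrow>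
      inj_on (ends G') (edges G' - {h}) \<Longrightarrow> 4 \<le> card (verts G') \<Longrightarrow> card (verts G') < card (verts G) \<Longrightarrow>
      marked_extremal G' h"
  shows "int (card (verts (G :: ('v, 'e) mgraph))) + 3 \<le> psum1 (flow_poly G)"
    and "psum1 (flow_poly G) = int (card (verts G)) + 3 \<Longrightarrow> 8 \<le> card (verts G) \<Longrightarrow>
      \<exists>A e f a b a' b' i i' \<phi> \<phi>'. two_edge_cut G A e f a b a' b' \<and>
        half_ladder (close_off G A e a b) e i \<phi> \<and> half_ladder (close_off G (verts G - A) e a' b') e i' \<phi>'"
proof -
  obtain k where k: "card (verts G) = 2 * k" "card (edges G) = 3 * k" by (rule bridgeless_cubic_counts[OF G])
  have "int (card (verts G)) + 3 \<le> psum1 (flow_poly G) \<and>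
    (psum1 (flow_poly G) = int (card (verts G)) + 3 \<longrightarrow> 8 \<le> card (verts G) \<longrightarrow>
      (\<exists>A e f a b a' b' i i' \<phi> \<phi>'. two_edge_cut G A e f a b a' b' \<and>
        half_ladder (close_off G A e a b) e i \<phi> \<and> half_ladder (close_off G (verts G - A) e a' b') e i' \<phi>'))"
  proof (cases "edge_connected 3 G")
    case True
    then show ?thesis using psum_three_connected(1)[OF G] k n by auto
  next
    case False
    then obtain A e f a b a' b' where tec: "two_edge_cut G A e f a b a' b'"
      using two_edge_cut_exists[OF G] by metis
    interpret two_edge_cut G A e f a b a' b' by (rule tec)
    interpret c: two_edge_cut G "verts G - A" e f a' b' a b by (rule complement)
    have sub: "inj_on (ends G) {x \<in> edges G. ends G x \<subseteq> S}" for S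
      by (rule inj_on_subset[OF inj]) auto
    have H: "marked_extremal H e"
      by (rule IH[OF cubic_H]) (use inj_on_ends_side[OF sub] card_side_ge_4[OF sub] card_sides in auto)
    have K: "marked_extremal K e"
      by (rule IH[OF c.cubic_H]) (use c.inj_on_ends_side[OF sub] c.card_side_ge_4[OF sub] card_sides in auto)
    have n: "int (card (verts G)) = int (card (verts H)) + int (card (verts K))" using card_sides(1) by simp
    show ?thesis
    proof (intro conjI impI)
      show "int (card (verts G)) + 3 \<le> psum1 (flow_poly G)"
        using H K n psum_two_edge_cut(1) unfolding marked_extremal_def by linarith
      assume "psum1 (flow_poly G) = int (card (verts G)) + 3"
      then have "psum1 (flow_poly H) = int (card (verts H)) + 2" "psum1 (flow_poly K) = int (card (verts K)) + 2"
        using H K n psum_two_edge_cut(1) unfolding marked_extremal_def by linarith+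
      then obtain i \<phi> i' \<phi>' where "half_ladder H e i \<phi>" "half_ladder K e i' \<phi>'"
        using H K unfolding marked_extremal_def by blast
      with tec show "\<exists>A e f a b a' b' i i' \<phi> \<phi>'. two_edge_cut G A e f a b a' b' \<and>
        half_ladder (close_off G A e a b) e i \<phi> \<and> half_ladder (close_off G (verts G - A) e a' b') e i' \<phi>'"
        by blast
    qed
  qed
  then show "int (card (verts (G :: ('v, 'e) mgraph))) + 3 \<le> psum1 (flow_poly G)"
    and "psum1 (flow_poly G) = int (card (verts G)) + 3 \<Longrightarrow> 8 \<le> card (verts G) \<Longrightarrow>
      \<exists>A e f a b a' b' i i' \<phi> \<phi>'. two_edge_cut G A e f a b a' b' \<and>
        half_ladder (close_off G A e a b) e i \<phi> \<and> half_ladder (close_off G (verts G - A) e a' b') e i' \<phi>'"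
    by auto
qed

text \<open>If the mark has a parallel edge, splitting off the pair lowers both \<open>psum1\<close> and the number of
vertices by 2, and a half ladder on the rest grows by a rung.  If not, the graph is simple, and it is
\<open>K\<^sub>4\<close> or has \<open>psum1\<close> at least \<open>n + 3\<close>.\<close>
lemma marked_extremal_if_simple_off_mark:
  assumes "bridgeless_cubic G" "h \<in> edges G" "inj_on (ends G) (edges G - {h})" "4 \<le> card (verts G)"
  shows "marked_extremal (G :: ('v, 'e) mgraph) h"
  using assms
proof (induction "card (verts G)" arbitrary: G h rule: less_induct)
  case less
  note G = less.prems(1) and h = less.prems(2) and inj = less.prems(3) and n = less.prems(4)
  note D = bridgeless_cubicD[OF G]
  obtain k where "card (verts G) = 2 * k" by (rule bridgeless_cubic_counts[OF G])
  then have n': "card (verts G) \<noteq> 5" by presburger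
  show ?case
  proof (cases "inj_on (ends G) (edges G)")
    case True
    show ?thesis
    proof (cases "card (verts G) = 4")
      case 4: True
      then show ?thesis
        using psum1_simple_4[OF G 4 True] half_ladder_K4[OF G 4 True h] by (auto simp: marked_extremal_def)
    next
      case False
      then have "6 \<le> card (verts G)" using n n' by linarith
      from psum1_simple(1)[OF G True this less.hyps] show ?thesis by (simp add: marked_extremal_def)
    qed
  next
    case False
    then obtain h' where h': "h' \<in> edges G" "h \<noteq> h'" "ends G h' = ends G h"
      using inj h inj_on_insert[of "ends G" h "edges G - {h}"] by (auto simp: insert_absorb)
    obtain u v where uv: "ends G h = {u, v}" "u \<noteq> v" using D(6)[OF h] by (auto simp: card_2_iff)
    obtain e f a b where tec: "two_edge_cut G (verts G - {u, v}) e f a b u v"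
      and hh: "{x \<in> edges G. ends G x \<subseteq> {u, v}} = {h, h'}"
      by (rule parallel_edges_two_edge_cut[OF G h h'(1,2) uv(1)]) (use h' uv n in auto)
    interpret two_edge_cut G "verts G - {u, v}" e f a b u v by (rule tec)
    interpret c: two_edge_cut G "verts G - (verts G - {u, v})" e f u v a b by (rule complement)
    have uvV: "u \<in> verts G" "v \<in> verts G" using D(5)[OF h] uv by auto
    then have B: "verts G - (verts G - {u, v}) = {u, v}" by auto
    have sub: "inj_on (ends G) {x \<in> edges G. ends G x \<subseteq> verts G - {u, v}}"
      by (rule inj_on_subset[OF inj]) (use uv in auto)
    have "marked_extremal H e"
      by (rule less.hyps[OF _ cubic_H]) (use inj_on_ends_side[OF sub] card_side_ge_4[OF sub] card_sides in auto)
    moreover have "psum1 (flow_poly K) = 3" by (rule psum1_theta[OF c.cubic_H]) (use B uv in simp)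
    moreover have "card (verts G) = card (verts H) + 2" using card_sides(1) unfolding B using uv by simp
    moreover have "\<exists>j \<psi>. half_ladder G h j \<psi>" if half: "half_ladder H e i \<phi>" for i \<phi>
    proof -
      obtain \<psi> where \<psi>: "half_ladder H e i \<psi>" "\<psi> a = Va i" "\<psi> b = Vb i"
        by (rule half_ladder_oriented[OF half, of a b]) auto
      show ?thesis using half_ladder_add_rung[OF tec B hh h'(2) \<psi>] by blast
    qed
    ultimately show ?thesis using psum_two_edge_cut(1) by (auto simp: marked_extremal_def)
  qed
qed

lemma half_verts_new: "Va (Suc i) \<notin> half_verts i" "Vb (Suc i) \<notin> half_verts i"
  by (auto simp: half_verts_def)

lemma half_edges_restrict: "{S \<in> half_edges (Suc i). S \<subseteq> half_verts i} = half_edges i"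
  unfolding half_edges_Suc by (auto simp: half_verts_new dest: half_edges_subset)

lemma half_edges_top_neighbour:
  assumes "w \<in> half_verts i"
  shows "{w, Va (Suc i)} \<in> half_edges (Suc i) \<Longrightarrow> w = Va i"
    and "{w, Vb (Suc i)} \<in> half_edges (Suc i) \<Longrightarrow> w = Vb i"
proof -
  have "{w, Va (Suc i)} \<notin> half_edges i" "{w, Vb (Suc i)} \<notin> half_edges i"
    by (auto simp: half_verts_new dest: half_edges_subset)
  then show "{w, Va (Suc i)} \<in> half_edges (Suc i) \<Longrightarrow> w = Va i"
    and "{w, Vb (Suc i)} \<in> half_edges (Suc i) \<Longrightarrow> w = Vb i"
    using assms half_verts_new[of i] by (auto simp: half_edges_Suc doubleton_eq_iff)
qed

text \<open>Removing the last rung, which is parallel to the mark, inverts \<open>half_ladder_add_rung\<close>.\<close>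
lemma psum1_half_ladder:
  assumes "bridgeless_cubic G" "inj_on (ends G) (edges G - {h})" "half_ladder G h i \<phi>"
  shows "psum1 (flow_poly (G :: ('v, 'e) mgraph)) = int (card (verts G)) + 2"
  using assms
proof (induction i arbitrary: G h)
  case 0
  note G = "0.prems"(1) and inj = "0.prems"(2) and half = "0.prems"(3)
  have h: "h \<in> edges G" "\<phi> ` ends G h = {Va 0, Vb 0}" "(\<lambda>x. \<phi> ` ends G x) ` (edges G - {h}) = half_edges 0"
    and inj\<phi>: "inj_on \<phi> (verts G)" "\<phi> ` verts G = half_verts 0"
    using half by (auto simp: half_ladder_def)
  have "ends G h \<notin> ends G ` (edges G - {h})"
  proof
    assume "ends G h \<in> ends G ` (edges G - {h})"
    then have "\<phi> ` ends G h \<in> (\<lambda>x. \<phi> ` ends G x) ` (edges G - {h})" by auto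
    then show False unfolding h(2,3) using half_edges_last[of 0] by simp
  qed
  with inj have "inj_on (ends G) (insert h (edges G - {h}))" unfolding inj_on_insert by simp
  then have "inj_on (ends G) (edges G)" using insert_Diff[OF h(1)] by simp
  moreover have "card (verts G) = 4" using card_image[OF inj\<phi>(1)] inj\<phi>(2) card_half_verts[of 0] by simp
  ultimately show ?case using psum1_simple_4[OF G] by simp
next
  case (Suc i)
  note G = Suc.prems(1) and inj = Suc.prems(2) and half = Suc.prems(3)
  note D = bridgeless_cubicD[OF G]
  have h: "h \<in> edges G" "\<phi> ` ends G h = {Va (Suc i), Vb (Suc i)}"
    "(\<lambda>x. \<phi> ` ends G x) ` (edges G - {h}) = half_edges (Suc i)"
    and inj\<phi>: "inj_on \<phi> (verts G)" "\<phi> ` verts G = half_verts (Suc i)"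
    using half by (auto simp: half_ladder_def)
  have n: "card (verts G) = 2 * i + 6" using card_image[OF inj\<phi>(1)] inj\<phi>(2) card_half_verts by simp
  have "{Va (Suc i), Vb (Suc i)} \<in> half_edges (Suc i)" by (simp add: half_edges_last)
  then obtain h' where h': "h' \<in> edges G" "h \<noteq> h'" "\<phi> ` ends G h' = {Va (Suc i), Vb (Suc i)}"
    unfolding h(3)[symmetric] by auto
  have ends_hh: "ends G h' = ends G h"
    using inj_on_image_eq_iff[OF inj\<phi>(1), of "ends G h'" "ends G h"] D(5) h h' by auto
  obtain x y where "ends G h = {x, y}" using D(6)[OF h(1)] by (auto simp: card_2_iff)
  then obtain u v where uv: "ends G h = {u, v}" "\<phi> u = Va (Suc i)" "\<phi> v = Vb (Suc i)"
    using h(2) by (auto simp: doubleton_eq_iff insert_commute)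
  have uvV: "u \<in> verts G" "v \<in> verts G" "u \<noteq> v" using D(5)[OF h(1)] uv by auto
  obtain e f a b where tec: "two_edge_cut G (verts G - {u, v}) e f a b u v"
    and hh: "{x \<in> edges G. ends G x \<subseteq> {u, v}} = {h, h'}"
    by (rule parallel_edges_two_edge_cut[OF G h(1) h'(1,2) uv(1)]) (use ends_hh uv n in auto)
  let ?A = "verts G - {u, v}"
  interpret two_edge_cut G ?A e f a b u v by (rule tec)
  interpret c: two_edge_cut G "verts G - ?A" e f u v a b by (rule complement)
  have B: "verts G - ?A = {u, v}" using uvV by auto
  have "\<phi> ` ?A = \<phi> ` verts G - \<phi> ` {u, v}"
    by (rule inj_on_image_set_diff[OF inj\<phi>(1)]) (use uvV in auto)
  then have img: "\<phi> ` ?A = half_verts i"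
    using inj\<phi>(2) uv by (auto simp: half_verts_Suc) (auto simp: half_verts_def)
  have hne: "h \<noteq> e" "h \<noteq> f" using uv ends_e ends_f in_A out_A by auto
  have "\<phi> ` ends G e \<in> half_edges (Suc i)" "\<phi> ` ends G f \<in> half_edges (Suc i)"
    unfolding h(3)[symmetric] using edges_ef hne by blast+
  then have "{\<phi> a, Va (Suc i)} \<in> half_edges (Suc i)" "{\<phi> b, Vb (Suc i)} \<in> half_edges (Suc i)"
    using ends_e ends_f uv by simp_all
  moreover have "\<phi> a \<in> half_verts i" "\<phi> b \<in> half_verts i" using img in_A by blast+
  ultimately have ab: "\<phi> a = Va i" "\<phi> b = Vb i"
    using half_edges_top_neighbour by auto
  let ?I = "{x \<in> edges G. ends G x \<subseteq> ?A}"
  have I: "edges H - {e} = ?I" "h \<notin> ?I" using inner_not_ef uv by auto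
  have inA: "ends G x \<subseteq> ?A \<longleftrightarrow> \<phi> ` ends G x \<subseteq> half_verts i" if "x \<in> edges G" for x
    unfolding img[symmetric] image_subset_iff
    using D(5)[OF that] inj_on_image_mem_iff[OF inj\<phi>(1) _ Diff_subset, of _ "{u, v}"] by blast
  have "x \<in> ?I \<longleftrightarrow> x \<in> edges G - {h} \<and> \<phi> ` ends G x \<subseteq> half_verts i" for x
  proof (cases "x \<in> edges G \<and> x \<noteq> h")
    case True
    then show ?thesis using inA[of x] by simp
  next
    case False
    then show ?thesis using I(2) by blast
  qed
  then have "?I = {x \<in> edges G - {h}. \<phi> ` ends G x \<subseteq> half_verts i}" by blast
  then have "(\<lambda>x. \<phi> ` ends G x) ` ?I = {S \<in> (\<lambda>x. \<phi> ` ends G x) ` (edges G - {h}). S \<subseteq> half_verts i}"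
    by blast
  also have "\<dots> = half_edges i"
    unfolding h(3) by (rule half_edges_restrict)
  finally have "(\<lambda>x. \<phi> ` ends G x) ` ?I = half_edges i" .
  moreover have "(\<lambda>x. \<phi> ` ends H x) ` ?I = (\<lambda>x. \<phi> ` ends G x) ` ?I"
    using inner_not_ef by (intro image_cong) auto
  ultimately have "half_ladder H e i \<phi>"
    unfolding half_ladder_def I(1) using img ab inj_on_subset[OF inj\<phi>(1), of ?A] by auto
  moreover have "inj_on (ends H) (edges H - {e})"
    by (rule inj_on_ends_side, rule inj_on_subset[OF inj]) (use I in auto)
  ultimately have "psum1 (flow_poly H) = int (card (verts H)) + 2" using Suc.IH cubic_H by blast
  moreover have "psum1 (flow_poly K) = 3" by (rule psum1_theta[OF c.cubic_H]) (use B uvV in simp)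
  moreover have "card (verts G) = card (verts H) + 2" using card_sides(1) unfolding B using uvV by simp
  ultimately show ?case using psum_two_edge_cut(1) by simp
qed

section \<open>Two half ladders make the extremal graph\<close>

text \<open>The symmetry that exchanges the two ends of the extremal graph.\<close>
fun flip_ladder :: "nat \<Rightarrow> gstar_vertex \<Rightarrow> gstar_vertex" where
  "flip_ladder r Vp = Vp'"
| "flip_ladder r Vq = Vq'"
| "flip_ladder r Vp' = Vp"
| "flip_ladder r Vq' = Vq"
| "flip_ladder r (Va l) = Va (r + 1 - l)"
| "flip_ladder r (Vb l) = Vb (r + 1 - l)"

lemma flip_ladder_involution:
  assumes "j \<le> r" "x \<in> half_verts j"
  shows "flip_ladder r (flip_ladder r x) = x"
  using assms by (auto simp: half_verts_def)

lemma reverse_interval: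
  fixes i j r :: nat
  assumes "i + j = r"
  shows "(\<lambda>l. r + 1 - l) ` {0..j} = {i + 1..r + 1}" "(\<lambda>l. r - l) ` {..<j} = {i + 1..r}"
    "(\<lambda>l. r + 1 - l) ` {1..j} = {i + 1..r}"
proof -
  have "x \<in> (\<lambda>l. r + 1 - l) ` {0..j}" if "x \<in> {i + 1..r + 1}" for x
    using that assms by (intro image_eqI[of _ _ "r + 1 - x"]) auto
  then show "(\<lambda>l. r + 1 - l) ` {0..j} = {i + 1..r + 1}" using assms by auto
  have "x \<in> (\<lambda>l. r - l) ` {..<j}" if "x \<in> {i + 1..r}" for x
    using that assms by (intro image_eqI[of _ _ "r - x"]) auto
  then show "(\<lambda>l. r - l) ` {..<j} = {i + 1..r}" using assms by auto
  have "x \<in> (\<lambda>l. r + 1 - l) ` {1..j}" if "x \<in> {i + 1..r}" for x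
    using that assms by (intro image_eqI[of _ _ "r + 1 - x"]) auto
  then show "(\<lambda>l. r + 1 - l) ` {1..j} = {i + 1..r}" using assms by auto
qed

lemma flip_half_verts:
  fixes i j r :: nat
  assumes "i + j = r"
  shows "flip_ladder r ` half_verts j = {Vp', Vq'} \<union> Va ` {i + 1..r + 1} \<union> Vb ` {i + 1..r + 1}"
  unfolding half_verts_def reverse_interval(1)[OF assms, symmetric] by (simp add: image_Un image_image)

lemma flip_half_edges:
  fixes i j r :: nat
  assumes "i + j = r"
  shows "(`) (flip_ladder r) ` half_edges j =
    {{Vp', Vq'}, {Va (r + 1), Vp'}, {Va (r + 1), Vq'}, {Vb (r + 1), Vp'}, {Vb (r + 1), Vq'}} \<union>
    (\<lambda>l. {Va l, Va (l + 1)}) ` {i + 1..r} \<union> (\<lambda>l. {Vb l, Vb (l + 1)}) ` {i + 1..r} \<union>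
    (\<lambda>l. {Va l, Vb l}) ` {i + 1..r}"
proof -
  have A: "(`) (flip_ladder r) ` (\<lambda>l. {Va l, Va (l + 1)}) ` {..<j} = (\<lambda>l. {Va l, Va (l + 1)}) ` (\<lambda>l. r - l) ` {..<j}"
    unfolding image_image using assms by (intro image_cong) (auto simp: Suc_diff_le)
  have B: "(`) (flip_ladder r) ` (\<lambda>l. {Vb l, Vb (l + 1)}) ` {..<j} = (\<lambda>l. {Vb l, Vb (l + 1)}) ` (\<lambda>l. r - l) ` {..<j}"
    unfolding image_image using assms by (intro image_cong) (auto simp: Suc_diff_le)
  have C: "(`) (flip_ladder r) ` (\<lambda>l. {Va l, Vb l}) ` {1..j} = (\<lambda>l. {Va l, Vb l}) ` (\<lambda>l. r + 1 - l) ` {1..j}"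
    unfolding image_image by (intro image_cong) auto
  show ?thesis
    unfolding half_edges_def image_Un A B C reverse_interval[OF assms] by simp
qed

lemma gstar_verts:
  fixes i j r :: nat
  assumes "i + j = r"
  shows "verts (gstar (2 * r + 8)) = half_verts i \<union> flip_ladder r ` half_verts j"
    "half_verts i \<inter> flip_ladder r ` half_verts j = {}"
proof -
  have int: "{0..r + 1} = {0..i} \<union> {i + 1..r + 1}" using assms by auto
  have "verts (gstar (2 * r + 8)) = {Vp, Vq, Vp', Vq'} \<union> Va ` {0..r + 1} \<union> Vb ` {0..r + 1}"
    by (simp add: gstar_def Let_def)
  then show "verts (gstar (2 * r + 8)) = half_verts i \<union> flip_ladder r ` half_verts j"
    unfolding flip_half_verts[OF assms] unfolding half_verts_def int image_Un by auto
  show "half_verts i \<inter> flip_ladder r ` half_verts j = {}"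
    unfolding flip_half_verts[OF assms] unfolding half_verts_def by auto
qed

lemma gstar_edges:
  fixes i j r :: nat
  assumes "i + j = r"
  shows "edges (gstar (2 * r + 8)) = half_edges i \<union> (`) (flip_ladder r) ` half_edges j \<union>
    {{Va i, Va (i + 1)}, {Vb i, Vb (i + 1)}}"
proof -
  have 1: "{0..r} = {..<i} \<union> {i + 1..r} \<union> {i}" using assms by auto
  have 2: "{1..r} = {1..i} \<union> {i + 1..r}" using assms by auto
  have "edges (gstar (2 * r + 8)) =
      {{Vp, Vq}, {Va 0, Vp}, {Va 0, Vq}, {Vb 0, Vp}, {Vb 0, Vq}} \<union>
      {{Vp', Vq'}, {Va (r + 1), Vp'}, {Va (r + 1), Vq'}, {Vb (r + 1), Vp'}, {Vb (r + 1), Vq'}} \<union>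
      (\<lambda>i. {Va i, Va (i + 1)}) ` {0..r} \<union> (\<lambda>i. {Vb i, Vb (i + 1)}) ` {0..r} \<union> (\<lambda>i. {Va i, Vb i}) ` {1..r}"
    by (simp add: gstar_def Let_def)
  then show ?thesis
    unfolding flip_half_edges[OF assms] unfolding half_edges_def 1 2 image_Un
    by (simp add: Un_ac insert_commute)
qed

lemma gstar_ends: "ends (gstar n) S = S"
  by (simp add: gstar_def Let_def)

lemma iso_gstar_of_half_ladders:
  assumes tec: "two_edge_cut G A e f a b a' b'" and inj: "inj_on (ends G) (edges G)"
    and half: "half_ladder (close_off G A e a b) e i \<phi>"
    and half': "half_ladder (close_off G (verts G - A) e a' b') e i' \<phi>'"
  shows "mgraph_iso G (gstar (card (verts G)))"
proof -
  interpret two_edge_cut G A e f a b a' b' by (rule tec)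
  interpret c: two_edge_cut G "verts G - A" e f a' b' a b by (rule complement)
  obtain \<phi> where hH: "half_ladder H e i \<phi>" and \<phi>ab: "\<phi> a = Va i" "\<phi> b = Vb i"
    by (rule half_ladder_oriented[OF half, of a b]) auto
  obtain \<phi>' where hK: "half_ladder K e i' \<phi>'" and \<phi>'ab: "\<phi>' a' = Va i'" "\<phi>' b' = Vb i'"
    by (rule half_ladder_oriented[OF half', of a' b']) auto
  let ?B = "verts G - A" and ?I = "{x \<in> edges G. ends G x \<subseteq> A}"
    and ?J = "{x \<in> edges G. ends G x \<subseteq> verts G - A}"
  define r where "r = i + i'"
  then have r: "i + i' = r" by simp
  have I: "edges H - {e} = ?I" "edges K - {e} = ?J" using inner_not_ef c.inner_not_ef by auto
  have H: "inj_on \<phi> A" "\<phi> ` A = half_verts i" "(\<lambda>x. \<phi> ` ends H x) ` ?I = half_edges i"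
    using hH unfolding half_ladder_def I by auto
  have K: "inj_on \<phi>' ?B" "\<phi>' ` ?B = half_verts i'" "(\<lambda>x. \<phi>' ` ends K x) ` ?J = half_edges i'"
    using hK unfolding half_ladder_def I by auto
  have "card A = 2 * i + 4" "card ?B = 2 * i' + 4"
    using card_image[OF H(1)] card_image[OF K(1)] H(2) K(2) card_half_verts by simp_all
  then have n: "card (verts G) = 2 * r + 8" using card_sides(1) r by simp
  define \<psi> where "\<psi> = (\<lambda>x. if x \<in> A then \<phi> x else flip_ladder r (\<phi>' x))"
  have \<psi>A: "\<psi> ` S = \<phi> ` S" if "S \<subseteq> A" for S
    using that by (intro image_cong) (auto simp: \<psi>_def)
  have \<psi>B: "\<psi> ` S = flip_ladder r ` \<phi>' ` S" if "S \<subseteq> ?B" for S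
    unfolding image_image using that by (intro image_cong) (auto simp: \<psi>_def)
  have VAB: "verts G = A \<union> ?B" using A by auto
  have img: "\<psi> ` A = half_verts i" "\<psi> ` ?B = flip_ladder r ` half_verts i'"
    using \<psi>A[OF order_refl] \<psi>B[OF order_refl] H(2) K(2) by auto
  have "inj_on \<psi> A" using H(1) by (auto simp: inj_on_def \<psi>_def)
  moreover have "inj_on (flip_ladder r) (half_verts i')"
    using flip_ladder_involution[of i' r] r by (intro inj_on_inverseI[of _ "flip_ladder r"]) auto
  then have "inj_on (flip_ladder r \<circ> \<phi>') ?B" using K by (intro comp_inj_on) auto
  then have "inj_on \<psi> ?B" by (auto simp: inj_on_def \<psi>_def)
  moreover have "\<psi> ` A \<inter> \<psi> ` ?B = {}" unfolding img by (rule gstar_verts(2)[OF r])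
  ultimately have "inj_on \<psi> (A \<union> ?B)" unfolding inj_on_Un by blast
  then have inj\<psi>: "inj_on \<psi> (verts G)" using VAB by simp
  have "\<psi> ` verts G = \<psi> ` A \<union> \<psi> ` ?B" using VAB by blast
  then have bijV: "bij_betw \<psi> (verts G) (verts (gstar (card (verts G))))"
    using inj\<psi> unfolding n gstar_verts(1)[OF r] img by (simp add: bij_betw_def)
  let ?g = "\<lambda>x. \<psi> ` ends G x"
  have "inj_on ?g (edges G)"
  proof (rule inj_onI)
    fix x y assume xy: "x \<in> edges G" "y \<in> edges G" "?g x = ?g y"
    then have "ends G x = ends G y"
      using inj_on_image_eq_iff[OF inj\<psi> D(5)[OF xy(1)] D(5)[OF xy(2)]] by simp
    then show "x = y" using inj xy by (auto dest: inj_onD)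
  qed
  moreover have "?g ` edges G = edges (gstar (card (verts G)))"
  proof -
    have gI: "?g ` ?I = half_edges i"
      unfolding H(3)[symmetric] by (rule image_cong[OF refl]) (simp add: \<psi>A ends_H_inner del: close_off_simps)
    have "?g ` ?J = (`) (flip_ladder r) ` (\<lambda>x. \<phi>' ` ends K x) ` ?J"
      unfolding image_image[of "(`) (flip_ladder r)"]
      by (rule image_cong[OF refl]) (simp add: \<psi>B c.ends_H_inner del: close_off_simps)
    then have gJ: "?g ` ?J = (`) (flip_ladder r) ` half_edges i'" unfolding K(3) .
    have ge: "?g e = {Va i, Va (i + 1)}" "?g f = {Vb i, Vb (i + 1)}"
      using ends_e ends_f in_A out_A \<phi>ab \<phi>'ab r[symmetric] by (auto simp: \<psi>_def)
    have "?g ` edges G = ?g ` (?I \<union> ?J \<union> {e, f})" by (rule arg_cong[OF edges_split])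
    also have "\<dots> = edges (gstar (card (verts G)))"
      unfolding image_Un gI gJ n gstar_edges[OF r] using ge by simp
    finally show ?thesis .
  qed
  ultimately have "bij_betw ?g (edges G) (edges (gstar (card (verts G))))" by (simp add: bij_betw_def)
  then show ?thesis
    unfolding mgraph_iso_def using bijV by (intro exI[of _ \<psi>] exI[of _ ?g]) (simp add: gstar_ends)
qed

text \<open>The two edges before the final copy of \<open>K\<^sub>4\<close> minus an edge form a two-edge cut.  Both of its sides
are half ladders, whose \<open>psum1\<close> is known.\<close>
lemma psum1_of_iso_gstar:
  assumes G: "bridgeless_cubic G" and inj: "inj_on (ends G) (edges G)" and n: "8 \<le> card (verts G)"
    and iso: "mgraph_iso G (gstar (card (verts G)))"
  shows "psum1 (flow_poly G) = int (card (verts G)) + 3"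
proof -
  note D = bridgeless_cubicD[OF G]
  obtain k where k: "card (verts G) = 2 * k" by (rule bridgeless_cubic_counts[OF G])
  define r where "r = k - 4"
  have nr: "card (verts G) = 2 * r + 8" using n k by (simp add: r_def)
  let ?N = "gstar (2 * r + 8)"
  have r0: "r + 0 = r" by simp
  note gV = gstar_verts[OF r0] and gE = gstar_edges[OF r0]
  obtain \<phi> g where bV: "bij_betw \<phi> (verts G) (verts ?N)" and bE: "bij_betw g (edges G) (edges ?N)"
    and "\<forall>e\<in>edges G. ends ?N (g e) = \<phi> ` ends G e"
    using iso unfolding mgraph_iso_def nr by blast
  then have g: "g x = \<phi> ` ends G x" if "x \<in> edges G" for x using that by (simp add: gstar_ends)
  have inj\<phi>: "inj_on \<phi> (verts G)" and img\<phi>: "\<phi> ` verts G = verts ?N" using bV by (auto simp: bij_betw_def)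
  have imgg: "g ` edges G = edges ?N" and injg: "inj_on g (edges G)" using bE by (auto simp: bij_betw_def)
  let ?V1 = "half_verts r" and ?V2 = "flip_ladder r ` half_verts 0"
  let ?E1 = "half_edges r" and ?E2 = "(`) (flip_ladder r) ` half_edges 0"
  \<comment> \<open>Everything except the end \<open>a\<^sub>r\<^sub>+\<^sub>1, b\<^sub>r\<^sub>+\<^sub>1, p', q'\<close>.\<close>
  define A where "A = {x \<in> verts G. \<phi> x \<in> ?V1}"
  have B: "verts G - A = {x \<in> verts G. \<phi> x \<in> ?V2}"
    using img\<phi> gV by (auto simp: A_def)
  have pre: "\<phi> ` {x \<in> verts G. \<phi> x \<in> X} = X" if "X \<subseteq> verts ?N" for X
    using that unfolding img\<phi>[symmetric] by blast
  have imgA: "\<phi> ` A = ?V1" unfolding A_def by (rule pre) (simp add: gV(1))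
  have imgB: "\<phi> ` (verts G - A) = ?V2" unfolding B by (rule pre) (simp add: gV(1))
  have new: "Va (r + 1) \<in> ?V2" "Vb (r + 1) \<in> ?V2" "Va r \<in> ?V1" "Vb r \<in> ?V1"
    by (auto simp: flip_half_verts[OF r0]) (auto simp: half_verts_def)
  then obtain a b a' b' where a: "a \<in> A" "\<phi> a = Va r" and b: "b \<in> A" "\<phi> b = Vb r"
    and a': "a' \<in> verts G - A" "\<phi> a' = Va (r + 1)" and b': "b' \<in> verts G - A" "\<phi> b' = Vb (r + 1)"
    unfolding imgA[symmetric] imgB[symmetric] by (auto elim!: imageE)
  have E1: "S \<subseteq> ?V1 \<and> S \<noteq> {}" if "S \<in> ?E1" for S using half_edges_subset[OF that] .
  have E2: "S \<subseteq> ?V2 \<and> S \<noteq> {}" if "S \<in> ?E2" for S using that half_edges_subset[of _ 0] by blast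
  have sub: "ends G x \<subseteq> A \<longleftrightarrow> g x \<subseteq> ?V1" "ends G x \<subseteq> verts G - A \<longleftrightarrow> g x \<subseteq> ?V2" if x: "x \<in> edges G" for x
    unfolding g[OF x] using D(5)[OF x] unfolding B by (auto simp: A_def)
  obtain e where e: "e \<in> edges G" "g e = {Va r, Va (r + 1)}" using imgg gE by (metis (no_types, lifting) UnI2 imageE insertI1)
  obtain f where f: "f \<in> edges G" "g f = {Vb r, Vb (r + 1)}" using imgg gE by (metis (no_types, lifting) UnI2 imageE insertI1 insertI2)
  have gcases: "g x \<in> ?E1 \<or> g x \<in> ?E2 \<or> x = e \<or> x = f" if x: "x \<in> edges G" for x
  proof -
    have "g x \<in> edges ?N" using x imgg by auto
    then have "g x \<in> ?E1 \<or> g x \<in> ?E2 \<or> g x = g e \<or> g x = g f" unfolding gE using e f by auto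
    then show ?thesis using inj_onD[OF injg _ x] e f by auto
  qed
  have ends_e: "ends G e = {a, a'}"
    using inj_on_image_eq_iff[OF inj\<phi> D(5)[OF e(1)], of "{a, a'}"] g[OF e(1)] e(2) a a' by (auto simp: A_def)
  have ends_f: "ends G f = {b, b'}"
    using inj_on_image_eq_iff[OF inj\<phi> D(5)[OF f(1)], of "{b, b'}"] g[OF f(1)] f(2) b b' by (auto simp: A_def)
  have "e \<noteq> f" using e(2) f(2) by (auto simp: doubleton_eq_iff)
  have cut: "edge_cut G A = {e, f}"
  proof -
    have "x \<notin> edge_cut G A" if x: "x \<in> edges G" "x \<noteq> e" "x \<noteq> f" for x
    proof -
      have "ends G x \<subseteq> A \<or> ends G x \<subseteq> verts G - A"
        using gcases[OF x(1)] x sub[OF x(1)] E1 E2 by blast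
      then show ?thesis by (auto simp: edge_cut_def)
    qed
    then show ?thesis using e(1) f(1) ends_e ends_f a b a' b' by (auto simp: edge_cut_def)
  qed
  have tec: "two_edge_cut G A e f a b a' b'"
    by unfold_locales (use G cut \<open>e \<noteq> f\<close> ends_e ends_f a b a' b' in \<open>auto simp: A_def\<close>)
  interpret two_edge_cut G A e f a b a' b' by (rule tec)
  interpret c: two_edge_cut G "verts G - A" e f a' b' a b by (rule complement)
  let ?I = "{x \<in> edges G. ends G x \<subseteq> A}" and ?J = "{x \<in> edges G. ends G x \<subseteq> verts G - A}"
  have HI: "edges H - {e} = ?I" "edges K - {e} = ?J" using inner_not_ef c.inner_not_ef by auto
  have dis: "?V1 \<inter> ?V2 = {}" by (rule gV(2))
  have I: "?I = {x \<in> edges G. g x \<in> ?E1}" and J: "?J = {x \<in> edges G. g x \<in> ?E2}"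
  proof -
    have eq: "(ends G x \<subseteq> A \<longleftrightarrow> g x \<in> ?E1) \<and> (ends G x \<subseteq> verts G - A \<longleftrightarrow> g x \<in> ?E2)" if x: "x \<in> edges G" for x
    proof (cases "x = e \<or> x = f")
      case True
      then have "\<not> ends G x \<subseteq> A" "\<not> ends G x \<subseteq> verts G - A"
        using ends_e ends_f in_A out_A by auto
      then show ?thesis using sub[OF x] E1[of "g x"] E2[of "g x"] by auto
    next
      case False
      then consider "g x \<in> ?E1" | "g x \<in> ?E2" using gcases[OF x] by auto
      then show ?thesis
      proof cases
        case 1
        have "g x \<subseteq> ?V1" "\<not> g x \<subseteq> ?V2" using E1[OF 1] dis by auto
        then show ?thesis using sub[OF x] 1 E2[of "g x"] by satx
      next
        case 2
        have "g x \<subseteq> ?V2" "\<not> g x \<subseteq> ?V1" using E2[OF 2] dis by auto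
        then show ?thesis using sub[OF x] 2 E1[of "g x"] by satx
      qed
    qed
    show "?I = {x \<in> edges G. g x \<in> ?E1}"
      by (intro Collect_cong conj_cong refl) (rule conjunct1[OF eq])
    show "?J = {x \<in> edges G. g x \<in> ?E2}"
      by (intro Collect_cong conj_cong refl) (rule conjunct2[OF eq])
  qed
  have gI: "g ` ?I = ?E1" "g ` ?J = ?E2"
  proof -
    have pre: "g ` {x \<in> edges G. g x \<in> X} = X" if "X \<subseteq> edges ?N" for X
      using that unfolding imgg[symmetric] by blast
    show "g ` ?I = ?E1" unfolding I by (rule pre) (auto simp: gE)
    show "g ` ?J = ?E2" unfolding J by (rule pre) (auto simp: gE)
  qed
  have "(\<lambda>x. \<phi> ` ends H x) ` ?I = g ` ?I"
    by (rule image_cong[OF refl]) (simp add: g ends_H_inner del: close_off_simps)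
  then have hH: "half_ladder H e r \<phi>"
    unfolding half_ladder_def HI gI using imgA inj_on_subset[OF inj\<phi> A] a b by auto
  have ff: "flip_ladder r (flip_ladder r x) = x" if "x \<in> half_verts 0" for x
    by (rule flip_ladder_involution[OF _ that]) simp
  have ffS: "flip_ladder r ` flip_ladder r ` S = S" if "S \<subseteq> half_verts 0" for S
    unfolding image_image using that ff by (auto simp: image_iff) (metis ff subsetD)+
  have "(\<lambda>x. (flip_ladder r \<circ> \<phi>) ` ends K x) ` ?J = (`) (flip_ladder r) ` g ` ?J"
    unfolding image_image[of "(`) (flip_ladder r)"] image_comp[symmetric]
    by (rule image_cong[OF refl]) (simp add: g c.ends_H_inner del: close_off_simps)
  also have "\<dots> = (\<lambda>S. flip_ladder r ` flip_ladder r ` S) ` half_edges 0" unfolding gI by (simp only: image_image)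
  also have "\<dots> = (\<lambda>S. S) ` half_edges 0" by (intro image_cong refl ffS) (use half_edges_subset in blast)
  finally have "(\<lambda>x. (flip_ladder r \<circ> \<phi>) ` ends K x) ` ?J = half_edges 0" by simp
  moreover have "(flip_ladder r \<circ> \<phi>) ` (verts G - A) = half_verts 0"
    unfolding image_comp[symmetric] imgB by (rule ffS) simp
  moreover have "inj_on (flip_ladder r \<circ> \<phi>) (verts G - A)"
  proof (rule comp_inj_on)
    show "inj_on (flip_ladder r) (\<phi> ` (verts G - A))"
      unfolding imgB using ff by (intro inj_on_inverseI[of _ "flip_ladder r"]) auto
  qed (rule inj_on_subset[OF inj\<phi>], auto)
  ultimately have hK: "half_ladder K e 0 (flip_ladder r \<circ> \<phi>)"
    unfolding half_ladder_def HI using a' b' by auto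
  have sub': "inj_on (ends G) {x \<in> edges G. ends G x \<subseteq> S}" for S
    by (rule inj_on_subset[OF inj]) auto
  show ?thesis
    using psum1_half_ladder[OF cubic_H inj_on_ends_side[OF sub'] hH]
      psum1_half_ladder[OF c.cubic_H c.inj_on_ends_side[OF sub'] hK] psum_two_edge_cut(1) card_sides(1)
    by simp
qed

section \<open>Comparison of coefficients\<close>

lemma bridgeless_cubic_of_simple:
  assumes simple: "simple_mgraph G" and conn: "connected_mgraph G" and "bridgeless G" and cubic: "cubic_mgraph G"
  shows "bridgeless_cubic G"
  unfolding bridgeless_cubic_def
proof (intro conjI ballI)
  show fin: "fin_mgraph G" using simple by (simp add: simple_mgraph_def)
  show two: "card (ends G e) = 2" if "e \<in> edges G" for e
    using simple that by (auto simp: simple_mgraph_def fin_mgraph_def)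
  show "card {e \<in> edges G. v \<in> ends G e} = 3" if "v \<in> verts G" for v
  proof -
    have none: "{e \<in> edges G. ends G e = {v}} = {}" using two by force
    have "degr G v = 3" using cubic that by (simp add: cubic_mgraph_def)
    then show ?thesis unfolding degr_def none by simp
  qed
  have c1: "num_comps G (edges G) = 1" using conn by (simp add: connected_mgraph_def)
  show "edge_connected 2 G"
    unfolding edge_connected_def
  proof (intro conjI allI impI)
    show "verts G \<noteq> {}" using c1 by (auto simp: num_comps_def quotient_def)
    fix S assume S: "S \<subseteq> verts G \<and> S \<noteq> {} \<and> S \<noteq> verts G"
    show "2 \<le> card (edge_cut G S)"
    proof (rule ccontr)
      assume "\<not> 2 \<le> card (edge_cut G S)"
      then have "card (edge_cut G S) \<le> Suc 0" by simp
      then have "\<exists>e. edge_cut G S \<subseteq> {e}"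
        using card_le_Suc0_iff_eq[OF finite_edge_cut[OF fin]] by blast
      then obtain e where e: "edge_cut G S \<subseteq> {e}" by blast
      then have "edge_cut G S \<inter> (edges G - {e}) = {}" by auto
      then have ge: "2 \<le> num_comps G (edges G - {e})"
        using num_comps_ge_2_iff[OF fin, of "edges G - {e}"] S by auto
      then have "e \<in> edges G" using c1 by (cases "e \<in> edges G") auto
      then have "bridge G e" using ge c1 by (simp add: bridge_def)
      then show False using assms(3) by (auto simp: bridgeless_def)
    qed
  qed
qed

lemma coeff_mult_mono:
  fixes p p' q q' :: "int poly"
  assumes "\<And>i. 0 \<le> coeff p i" "\<And>i. coeff p i \<le> coeff p' i" "\<And>i. 0 \<le> coeff q i" "\<And>i. coeff q i \<le> coeff q' i"
  shows "0 \<le> coeff (p * q) i" "coeff (p * q) i \<le> coeff (p' * q') i"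
proof -
  have "0 \<le> coeff p' i" for i using assms(1,2) order_trans by blast
  then show "0 \<le> coeff (p * q) i" "coeff (p * q) i \<le> coeff (p' * q') i"
    unfolding coeff_mult using assms by (auto intro!: sum_nonneg sum_mono mult_mono)
qed

lemma coeff_power_mono:
  fixes p q :: "int poly"
  assumes "\<And>i. 0 \<le> coeff p i" "\<And>i. coeff p i \<le> coeff q i"
  shows "0 \<le> coeff (p ^ d) i \<and> coeff (p ^ d) i \<le> coeff (q ^ d) i"
proof (induction d arbitrary: i)
  case (Suc d)
  then show ?case unfolding power_Suc using coeff_mult_mono[of p q "p ^ d" "q ^ d"] assms by blast
qed (simp add: coeff_1)

lemma abs_coeff_reflection:
  fixes p :: "int poly"
  shows "\<bar>coeff (pcompose p [:0, - 1:]) i\<bar> = \<bar>coeff p i\<bar>"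
proof -
  have "coeff (pcompose p [:0, - 1:]) i = (- 1) ^ i * coeff p i"
  proof (induction p arbitrary: i)
    case (pCons a p)
    then show ?case by (cases i) (auto simp: pcompose_pCons)
  qed simp
  then show ?thesis by (simp add: abs_mult)
qed

text \<open>Substituting \<open>- t\<close> for \<open>t\<close> turns all factors into linear polynomials with positive coefficients, up
to a common sign.\<close>
lemma abs_coeff_alternating:
  fixes j l :: nat
  defines "P \<equiv> [:1, 1:] * [:2, 1:] ^ j * [:3, 1:] ^ l :: int poly"
  shows "\<bar>coeff ([:- 1, 1:] * ([:- 2, 1:] ^ j * [:- 3, 1:] ^ l) :: int poly) i\<bar> = coeff P i"
proof -
  have pw: "pcompose (p ^ d) q = (pcompose p q) ^ d" for p q :: "int poly" and d
    by (induction d) (simp_all add: pcompose_mult pcompose_1)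
  have neg: "[:- 1, - 1:] = - [:1, 1::int:]" "[:- 2, - 1:] = - [:2, 1::int:]" "[:- 3, - 1:] = - [:3, 1::int:]"
    by simp_all
  have "pcompose ([:- 1, 1:] * ([:- 2, 1:] ^ j * [:- 3, 1:] ^ l)) [:0, - 1:] =
      [:- 1, - 1:] * ([:- 2, - 1:] ^ j * [:- 3, - 1:] ^ l :: int poly)"
    by (simp add: pcompose_mult pw pcompose_pCons del: mult_pCons_left)
  also have "\<dots> = (- 1) ^ (Suc (j + l)) * P"
    unfolding neg power_minus[of "[:2, 1::int:]"] power_minus[of "[:3, 1::int:]"] P_def power_Suc power_add
    by (simp only: mult_ac mult_minus1 mult_minus_left mult_minus_right)
  also have "\<dots> = smult ((- 1) ^ (Suc (j + l))) P"
    by (cases "even (j + l)") simp_all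
  finally have "\<bar>coeff ([:- 1, 1:] * ([:- 2, 1:] ^ j * [:- 3, 1:] ^ l) :: int poly) i\<bar> = \<bar>coeff P i\<bar>"
    by (subst abs_coeff_reflection[symmetric]) (simp add: abs_mult del: power_Suc)
  moreover have "0 \<le> coeff P i"
  proof -
    have lin: "0 \<le> coeff [:a, 1:] i" if "0 \<le> a" for a :: int and i
      using that by (auto simp: coeff_pCons split: nat.split)
    have pow: "0 \<le> coeff ([:a, 1:] ^ d) i" if "0 \<le> a" for a :: int and d i
      using coeff_power_mono[of "[:a, 1:]" "[:a, 1:]" d i] lin[OF that] by auto
    have mult: "0 \<le> coeff (p * q) i" if "\<And>i. 0 \<le> coeff p i" "\<And>i. 0 \<le> coeff q i" for p q :: "int poly" and i
      using coeff_mult_mono(1)[of p p q q] that by simp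
    show ?thesis unfolding P_def by (intro mult lin pow) simp_all
  qed
  ultimately show ?thesis by simp
qed

text \<open>The two polynomials differ by replacing \<open>d = k - 2 - j\<close> factors \<open>t + 2\<close> by \<open>t + 3\<close>.  The constant
coefficient detects \<open>d\<close>, because \<open>2 ^ d = 3 ^ d\<close> only for \<open>d = 0\<close>.\<close>
lemma coeff_compare_exponents:
  assumes "j + 2 \<le> k"
  defines "P \<equiv> \<lambda>j. [:1, 1:] * [:2, 1:] ^ j * [:3, 1:] ^ (k - j) :: int poly"
  shows "coeff (P (k - 2)) i \<le> coeff (P j) i"
    and "coeff (P (k - 2)) 0 = coeff (P j) 0 \<longleftrightarrow> j = k - 2"
proof -
  define d where "d = k - 2 - j"
  have k: "k - 2 = j + d" "k - j = d + 2" "k - (j + d) = 2" using assms(1) by (auto simp: d_def)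
  let ?C = "[:1, 1:] * [:2, 1:] ^ j * [:3, 1:] ^ 2 :: int poly"
  have P: "P (k - 2) = ?C * [:2, 1:] ^ d" "P j = ?C * [:3, 1:] ^ d"
    unfolding P_def k power_add by (simp_all only: mult_ac)
  have C: "0 \<le> coeff ?C i" for i
    using abs_coeff_alternating[of j 2 i] by (metis abs_ge_zero)
  have base: "0 \<le> coeff [:2, 1::int:] i" "coeff [:2, 1::int:] i \<le> coeff [:3, 1:] i" for i
    by (auto simp: coeff_pCons split: nat.split)
  show "coeff (P (k - 2)) i \<le> coeff (P j) i"
    unfolding P by (rule coeff_mult_mono(2)) (use C coeff_power_mono[OF base, of d] in auto)
  have "coeff (P (k - 2)) 0 = coeff (P j) 0 \<longleftrightarrow> (2::int) ^ d = 3 ^ d"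
    unfolding P by (simp add: coeff_mult_0 flip: poly_0_coeff_0)
  also have "\<dots> \<longleftrightarrow> d = 0"
    using power_strict_mono[of "2::int" 3 d] by (cases "d = 0") auto
  finally show "coeff (P (k - 2)) 0 = coeff (P j) 0 \<longleftrightarrow> j = k - 2" using k by auto
qed

text \<open>The value at 1 is an alternating sum over all subsets of a nonempty set, so 1 is a root; the other
roots are governed by \<open>real_rooted_roots_2_3\<close>.\<close>
lemma flow_poly_real_rooted:
  assumes G: "bridgeless_cubic G" and k: "card (verts G) = 2 * k" and real: "flow_roots G \<subseteq> \<real>"
  obtains j where "j \<le> k" "flow_poly G = [:- 1, 1:] * ([:- 2, 1:] ^ j * [:- 3, 1:] ^ (k - j))"
    "psum1 (flow_poly G) = 3 * int k + 1 - int j"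
proof -
  note D = bridgeless_cubicD[OF G]
  have m: "card (edges G) = 3 * k" "1 \<le> k" using k by (auto intro: bridgeless_cubic_counts[OF G])
  have "poly (flow_poly G) 1 = 0"
  proof -
    obtain e where "e \<in> edges G" using m by fastforce
    have "poly (flow_poly G) 1 = (\<Sum>Z\<in>Pow (edges G). (- 1) ^ (card (edges G) - card Z))"
      by (simp add: flow_poly_def poly_sum poly_monom)
    also have "\<dots> = (\<Sum>Z\<in>Pow (insert e (edges G - {e})). (- 1) ^ (card (edges G) - card Z))"
      using \<open>e \<in> edges G\<close> by (simp add: insert_absorb)
    also have "\<dots> = (\<Sum>Z\<in>Pow (edges G - {e}). (- 1) ^ (card (edges G) - card Z) + (- 1) ^ (card (edges G) - card (insert e Z)))"
      by (rule sum_Pow_insert) (use D(3) in auto)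
    also have "\<dots> = 0"
    proof (rule sum.neutral, rule ballI)
      fix Z assume Z: "Z \<in> Pow (edges G - {e})"
      then have "finite Z" "e \<notin> Z" using D(3) finite_subset by auto
      moreover have "card Z < card (edges G)"
        using Z D(3) \<open>e \<in> edges G\<close> by (intro psubset_card_mono) auto
      ultimately have "card (edges G) - card Z = Suc (card (edges G) - card (insert e Z))" by simp
      then show "(- 1) ^ (card (edges G) - card Z) + (- 1) ^ (card (edges G) - card (insert e Z)) = (0::int)"
        by simp
    qed
    finally show ?thesis .
  qed
  then obtain Q where F: "flow_poly G = [:- 1, 1:] * Q" by (auto simp: poly_eq_0_iff_dvd)
  have "lead_coeff [:- 1, 1::int:] * lead_coeff Q = 1"
    using flow_poly_monic(2)[OF G k] unfolding F lead_coeff_mult .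
  then have lQ: "lead_coeff Q = 1" by simp
  have "degree (flow_poly G) = degree [:- 1, 1::int:] + degree Q"
    unfolding F by (rule degree_mult_eq) (use lQ in auto)
  then have dQ: "degree Q = k" using flow_poly_monic(1)[OF G k] by simp
  have "lead_coeff [:- 1, 1 :: int:] = 1" by simp
  note ps = psum_mult[OF this lQ, folded F, unfolded psum_linear]
  obtain j where j: "j \<le> degree Q" "Q = [:- 2, 1:] ^ j * [:- 3, 1:] ^ (degree Q - j)"
    "psum1 Q = 3 * int (degree Q) - int j"
  proof (rule real_rooted_roots_2_3[OF lQ])
    fix z :: complex assume "poly (map_poly of_int Q) z = 0"
    then have "z \<in> flow_roots G" 
      unfolding flow_roots_def F map_poly_of_int_mult by simp
    then show "z \<in> \<real>" using real by auto
  next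
    show "psum2 Q + 6 * int (degree Q) \<le> 5 * psum1 Q"
      using psum_bound[OF G k] ps dQ by simp
  qed (rule that)
  show thesis
  proof (rule that)
    show "j \<le> k" using j(1) dQ by simp
    show "flow_poly G = [:- 1, 1:] * ([:- 2, 1:] ^ j * [:- 3, 1:] ^ (k - j))"
      using F j(2) unfolding dQ by simp
    show "psum1 (flow_poly G) = 3 * int k + 1 - int j" using ps(1) j(3) dQ by simp
  qed
qed

theorem theorem1p5:
  fixes G :: "('v, 'e) mgraph" and n m :: nat and b c :: "nat \<Rightarrow> int"
  assumes "simple_mgraph G" and "connected_mgraph G" and "bridgeless G" and "cubic_mgraph G"
    and "n = card (verts G)" and "m = card (edges G)" and "n \<ge> 6"
    and "flow_roots G \<subseteq> \<real>"
    and "\<And>i. c i = coeff (flow_poly G) i"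
    and "\<And>i. b i = coeff ([:1, 1:] * [:2, 1:] ^ (n div 2 - 2) * [:3, 1:] ^ 2) i"
  shows "(\<forall>i \<le> m - n + 1. b i \<le> \<bar>c i\<bar>) \<and>
    (n \<ge> 8 \<longrightarrow> ((\<forall>i \<le> m - n + 1. b i = \<bar>c i\<bar>) \<longleftrightarrow> mgraph_iso G (gstar n)))"
proof -
  have G: "bridgeless_cubic G" by (rule bridgeless_cubic_of_simple[OF assms(1-4)])
  have inj: "inj_on (ends G) (edges G)" using assms(1) by (simp add: simple_mgraph_def)
  obtain k where k: "card (verts G) = 2 * k" by (rule bridgeless_cubic_counts[OF G])
  have nk: "n = 2 * k" "3 \<le> k" using k assms(5,7) by auto
  obtain j where j: "j \<le> k" "flow_poly G = [:- 1, 1:] * ([:- 2, 1:] ^ j * [:- 3, 1:] ^ (k - j))"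
    "psum1 (flow_poly G) = 3 * int k + 1 - int j"
    by (rule flow_poly_real_rooted[OF G k assms(8)])
  have n6: "6 \<le> card (verts G)" using assms(5,7) by simp
  have lower: "int (card (verts G)) + 3 \<le> psum1 (flow_poly G)"
    by (rule psum1_simple(1)[OF G inj n6 marked_extremal_if_simple_off_mark])
  then have jk: "j + 2 \<le> k" using j(3) k by linarith
  let ?P = "\<lambda>j. [:1, 1:] * [:2, 1:] ^ j * [:3, 1:] ^ (k - j) :: int poly"
  have c: "\<bar>c i\<bar> = coeff (?P j) i" for i
    unfolding assms(9) j(2) by (rule abs_coeff_alternating)
  have b: "b i = coeff (?P (k - 2)) i" for i
    using nk unfolding assms(10) by simp
  have "b i \<le> \<bar>c i\<bar>" for i unfolding b c by (rule coeff_compare_exponents(1)[OF jk])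
  moreover have "(\<forall>i \<le> m - n + 1. b i = \<bar>c i\<bar>) \<longleftrightarrow> mgraph_iso G (gstar n)" if n8: "n \<ge> 8"
  proof
    assume "\<forall>i \<le> m - n + 1. b i = \<bar>c i\<bar>"
    then have "j = k - 2" using coeff_compare_exponents(2)[OF jk] unfolding b c by auto
    then have "psum1 (flow_poly G) = int (card (verts G)) + 3" using j(3) k jk by linarith
    from psum1_simple(2)[OF G inj n6 marked_extremal_if_simple_off_mark this] n8 assms(5)
    show "mgraph_iso G (gstar n)" using iso_gstar_of_half_ladders[OF _ inj] by auto
  next
    assume "mgraph_iso G (gstar n)"
    then have "psum1 (flow_poly G) = int (card (verts G)) + 3"
      using psum1_of_iso_gstar[OF G inj] n8 assms(5) by simp
    then have "j = k - 2" using j(3) k jk by linarith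
    then show "\<forall>i \<le> m - n + 1. b i = \<bar>c i\<bar>" unfolding b c by simp
  qed
  ultimately show ?thesis by blast
qed

end
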